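(* Let $G=([n],E)$ be a finite simple graph. Then $\gamma_2(\mathcal{P}_G)=0$ if and only if either (i) $G$ is a forest, or (ii) all but one of the $2$-connected components of $G$ are single edges and the remaining component is isomorphic to one of $K_4$, $G_\ell$ for some $\ell\geq 3$, or $K_{2,\ell}$ for some $\ell\geq 2$.
   Context: For a finite simple graph $G=([n],E)$, the symmetric edge polytope is $\mathcal{P}_G=\mathrm{conv}(\pm(e_i-e_j) : ij\in E)\subset\mathbb{R}^n$ (if $E=\emptyset$, it is understood to be the single point $0$). It is a lattice polytope; let $d=\dim\mathcal{P}_G$. Its $h^*$-vector $(h_0^*,\dots,h_d^* )$ is defined by $|m\mathcal{P}_G\cap\mathbb{Z}^n|=\sum_{j=0}^d h_j^*\binom{m+d-j}{d}$ for all integers $m\ge 0$. It is known that $\mathcal{P}_G$ is reflexive, so $h_j^*=h_{d-j}^*$, and the $\gamma$-vector is defined by $\sum_{i=0}^{\lfloor d/2\rfloor}\gamma_i(\mathcal{P}_G) t^i(1+t)^{d-2i}=\sum_{j=0}^d h_j^*t^j$, with $\gamma_i(\mathcal{P}_G)=0$ for $i>\lfloor d/2\rfloor$. The $2$-connected components of $G$ are its inclusion-maximal $2$-connected subgraphs, where in this decomposition single edges (bridges) are also considered $2$-connected. For $\ell\ge3$, $G_\ell$ is the graph on $\ell$ vertices obtained from the complete bipartite graph $K_{2,\ell-2}$, with bipartition $\{1,2\}\cup\{3,\dots,\ell\}$, by adding the edge $12$. $K_4$ and $K_{2,\ell}$ are the complete and complete bipartite graphs. *)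

theory Defs
  imports "HOL-Analysis.Analysis" "HOL-Computational_Algebra.Polynomial"
begin

section \<open>Lattice polytopes: \<open>h\<^sup>*\<close>-vector and \<open>\<gamma>\<close>-vector\<close>

definition ehrhart_count :: "(real ^ 'n) set \<Rightarrow> nat \<Rightarrow> nat" where
  "ehrhart_count P m = card ((\<lambda>x. real m *\<^sub>R x) ` P \<inter> {x. \<forall>i. x $ i \<in> \<int>})"

definition poly_dim :: "(real ^ 'n::finite) set \<Rightarrow> nat" where
  "poly_dim P = nat (aff_dim P)"

text \<open>
  Both vectors are determined by their defining identity together with the convention that they
  vanish beyond the last index. For a lattice polytope the first one exists by Ehrhart's theorem;
  the second one exists whenever the \<open>h\<^sup>*\<close>-vector is palindromic, in particular for
  reflexive polytopes.
\<close>

definition is_h_star_vector :: "(real ^ 'n::finite) set \<Rightarrow> (nat \<Rightarrow> int) \<Rightarrow> bool" where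
  "is_h_star_vector P h \<longleftrightarrow> (let d = poly_dim P in
     (\<forall>j>d. h j = 0) \<and>
     (\<forall>m. int (ehrhart_count P m) = (\<Sum>j=0..d. h j * int ((m + d - j) choose d))))"

definition h_star :: "(real ^ 'n::finite) set \<Rightarrow> nat \<Rightarrow> int" where
  "h_star P = (THE h. is_h_star_vector P h)"

definition is_gamma_vector :: "(real ^ 'n::finite) set \<Rightarrow> (nat \<Rightarrow> int) \<Rightarrow> bool" where
  "is_gamma_vector P g \<longleftrightarrow> (let d = poly_dim P in
     (\<forall>i>d div 2. g i = 0) \<and>
     (\<Sum>i=0..d div 2. monom (g i) i * [:1, 1:] ^ (d - 2 * i)) = (\<Sum>j=0..d. monom (h_star P j) j))"

definition gamma :: "(real ^ 'n::finite) set \<Rightarrow> nat \<Rightarrow> int" where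
  "gamma P = (THE g. is_gamma_vector P g)"


section \<open>Simple graphs\<close>

text \<open>A graph is a pair of a vertex set and a set of edges, an edge being a two-element set.\<close>

type_synonym 'a graph = "'a set \<times> 'a set set"

definition simple_graph :: "'a graph \<Rightarrow> bool" where
  "simple_graph = (\<lambda>(V, E). finite V \<and> (\<forall>e\<in>E. e \<subseteq> V \<and> card e = 2))"

definition subgraph :: "'a graph \<Rightarrow> 'a graph \<Rightarrow> bool" where
  "subgraph H G \<longleftrightarrow> simple_graph H \<and> fst H \<subseteq> fst G \<and> snd H \<subseteq> snd G"

definition connected_graph :: "'a graph \<Rightarrow> bool" where
  "connected_graph = (\<lambda>(V, E). V \<noteq> {} \<and> (\<forall>u\<in>V. \<forall>v\<in>V. (u, v) \<in> {(x, y). {x, y} \<in> E}\<^sup>*))"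

definition delete_vertex :: "'a graph \<Rightarrow> 'a \<Rightarrow> 'a graph" where
  "delete_vertex = (\<lambda>(V, E) v. (V - {v}, {e \<in> E. v \<notin> e}))"

definition single_edge :: "'a graph \<Rightarrow> bool" where
  "single_edge G \<longleftrightarrow> (\<exists>u v. u \<noteq> v \<and> G = ({u, v}, {{u, v}}))"

text \<open>Single edges count as 2-connected; single vertices do not.\<close>

definition two_connected :: "'a graph \<Rightarrow> bool" where
  "two_connected G \<longleftrightarrow> single_edge G \<or>
     (card (fst G) \<ge> 3 \<and> connected_graph G \<and> (\<forall>v\<in>fst G. connected_graph (delete_vertex G v)))"

definition two_connected_components :: "'a graph \<Rightarrow> 'a graph set" where
  "two_connected_components G = {H. subgraph H G \<and> two_connected H \<and>
     (\<forall>H'. subgraph H' G \<and> two_connected H' \<and> subgraph H H' \<longrightarrow> H' = H)}"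

definition is_cycle :: "'a graph \<Rightarrow> 'a list \<Rightarrow> bool" where
  "is_cycle G c \<longleftrightarrow> length c \<ge> 3 \<and> distinct c \<and>
     (\<forall>i<length c. {c ! i, c ! (Suc i mod length c)} \<in> snd G)"

definition forest :: "'a graph \<Rightarrow> bool" where
  "forest G \<longleftrightarrow> (\<nexists>c. is_cycle G c)"

definition graph_isomorphic :: "'a graph \<Rightarrow> 'b graph \<Rightarrow> bool" where
  "graph_isomorphic G H \<longleftrightarrow>
     (\<exists>f. bij_betw f (fst G) (fst H) \<and> snd H = (\<lambda>e. f ` e) ` snd G)"

definition complete_graph :: "'a set \<Rightarrow> 'a graph" where
  "complete_graph V = (V, {e. e \<subseteq> V \<and> card e = 2})"

text \<open>The two sides are meant to be disjoint.\<close>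

definition complete_bipartite :: "'a set \<Rightarrow> 'a set \<Rightarrow> 'a graph" where
  "complete_bipartite A B = (A \<union> B, {{a, b} |a b. a \<in> A \<and> b \<in> B})"

definition K4_graph :: "nat graph" where
  "K4_graph = complete_graph {1..4}"

definition K2_graph :: "nat \<Rightarrow> nat graph" where
  "K2_graph l = complete_bipartite {1, 2} {3..l + 2}"

definition G_graph :: "nat \<Rightarrow> nat graph" where
  "G_graph l = ({1..l}, insert {1, 2} (snd (complete_bipartite {1, 2} {3..l})))"


section \<open>Symmetric edge polytopes\<close>

text \<open>
  The vertex set is the finite index type. As the condition \<open>{i, j} \<in> E\<close> is symmetric in \<open>i\<close> and
  \<open>j\<close>, both signs of each difference of unit vectors occur.
\<close>

definition sym_edge_polytope :: "'n::finite set set \<Rightarrow> (real ^ 'n) set" where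
  "sym_edge_polytope E =
     (if E = {} then {0} else convex hull {axis i 1 - axis j 1 |i j. {i, j} \<in> E})"

end

theory Submission
  imports Defs "HOL-Library.Multiset"
begin

text \<open>
  The lattice points of the dilates are counted with a unimodular triangulation obtained without any
  geometry: among all representations of a vector as a nonnegative combination of arcs (directed
  edges) take the lexicographically smallest one. Supports of minimal representations are closed
  under subsets and linearly independent, and total unimodularity makes the coefficients of lattice
  points integral. A generic vector \<open>q\<close> cuts the complete fan of supports into half-open cones, one
  for each maximal support \<open>S\<close>, so \<open>h\<^sup>*\<^sub>j\<close> is the number of \<open>S\<close> in which \<open>q\<close> has exactly \<open>j\<close>
  negative coordinates. Replacing \<open>q\<close> by \<open>- q\<close> shows that the \<open>h\<^sup>*\<close>-vector is palindromic.

  Hence \<open>\<gamma>\<^sub>2\<close> is determined by the number of vectors that are sums of at most two arcs. With \<open>c\<close> the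
  cyclomatic number, deleting a bridge does not change \<open>\<gamma>\<^sub>2\<close>, and deleting another edge \<open>uv\<close> lowers it
  by \<open>2 (2 c + 1 - overlap)\<close>, where the overlap counts short cycles through \<open>uv\<close>. The overlap is at
  most \<open>2 c + 1\<close> for an edge at a vertex of degree two, with equality only if a triangle book or a
  \<open>K\<^bsub>2,l\<^esub>\<close> already carries all cycles, and for every edge if all degrees are at least three. Induction
  on the number of edges gives \<open>\<gamma>\<^sub>2 \<ge> 0\<close> together with the equality case.
\<close>


section \<open>Lexicographically minimal representations\<close>

text \<open>\<open>h_star\<close> and \<open>gamma\<close> are definite descriptions, so nothing
  about them is available before an Ehrhart expansion valid for all dilates and its palindromicity
  are proved. The fan serves this purpose and the splitting of lattice points into arcs; afterwards
  only the dilates 0, 1 and 2 are counted. Comparing the total weight first makes a minimal flow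
  attain the least weight for its value, so membership in a dilate can be read off from it; the
  coordinates behind it only break ties, an exact substitute for a generic perturbation. Equality
  cannot determine the whole graph, because bridges are invisible to gamma_2. The induction
  therefore classifies a subset \<open>B\<close> of the edges with the cyclomatic number of
  \<open>E\<close>, and blocks appear only in a final translation.\<close>

fun lex_neg :: "real list \<Rightarrow> bool" where
  "lex_neg [] \<longleftrightarrow> False"
| "lex_neg (x # xs) \<longleftrightarrow> x < 0 \<or> x = 0 \<and> lex_neg xs"

lemma lex_neg_add:
  assumes "lex_neg (map f xs)" "lex_neg (map g xs)"
  shows "lex_neg (map (\<lambda>x. f x + g x) xs)"
  using assms by (induction xs) auto

lemma lex_neg_scale:
  assumes "c > 0" "lex_neg (map f xs)"
  shows "lex_neg (map (\<lambda>x. c * f x) xs)"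
  using assms by (induction xs) (auto simp: mult_less_0_iff)

lemma lex_neg_uminus_iff:
  "lex_neg (map (\<lambda>x. - f x) xs) \<longleftrightarrow> \<not> lex_neg (map f xs) \<and> (\<exists>x\<in>set xs. f x \<noteq> 0)"
  by (induction xs) (auto simp: not_less)

text \<open>The vectors come as a list because the position in the list decides ties between flows.
  Closure under negation lets nonnegative combinations reach all of \<open>span D\<close>, so the
  fan of faces is complete.\<close>

locale symmetric_configuration =
  fixes ds :: "'a::euclidean_space list"
  assumes uminus_closed: "a \<in> set ds \<Longrightarrow> - a \<in> set ds"
begin

abbreviation D :: "'a set" where "D \<equiv> set ds"

definition flow :: "('a \<Rightarrow> real) \<Rightarrow> bool" where
  "flow y \<longleftrightarrow> (\<forall>a. a \<notin> D \<longrightarrow> y a = 0)"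

definition val :: "('a \<Rightarrow> real) \<Rightarrow> 'a" where
  "val y = (\<Sum>a\<in>D. y a *\<^sub>R a)"

text \<open>The total order on flows that compares first the total weight and then the coordinates.\<close>

definition neg :: "('a \<Rightarrow> real) \<Rightarrow> bool" where
  "neg z \<longleftrightarrow> lex_neg (sum z D # map z ds)"

text \<open>The supports of the minimal flows are the faces of a complete simplicial fan.\<close>

definition face :: "'a set \<Rightarrow> bool" where
  "face S \<longleftrightarrow> S \<subseteq> D \<and> (\<forall>z. flow z \<and> val z = 0 \<and> (\<forall>a\<in>D - S. z a \<ge> 0) \<longrightarrow> \<not> neg z)"

lemma val_add: "val (\<lambda>a. y a + z a) = val y + val z"
  by (simp add: val_def scaleR_left_distrib sum.distrib)

lemma val_diff: "val (\<lambda>a. y a - z a) = val y - val z"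
  by (simp add: val_def scaleR_left_diff_distrib sum_subtractf)

lemma val_uminus: "val (\<lambda>a. - z a) = - val z"
  by (simp add: val_def sum_negf)

lemma val_scale: "val (\<lambda>a. c * z a) = c *\<^sub>R val z"
  by (simp add: val_def scaleR_sum_right)

lemma val_support:
  assumes "finite S" "S \<subseteq> D" "\<And>a. a \<notin> S \<Longrightarrow> y a = 0"
  shows "val y = (\<Sum>a\<in>S. y a *\<^sub>R a)"
  unfolding val_def by (rule sum.mono_neutral_right) (use assms in auto)

lemma neg_add: "neg y \<Longrightarrow> neg z \<Longrightarrow> neg (\<lambda>a. y a + z a)"
  using lex_neg_add[of y ds z] by (auto simp: neg_def sum.distrib)

lemma neg_scale: "c > 0 \<Longrightarrow> neg z \<Longrightarrow> neg (\<lambda>a. c * z a)"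
  using lex_neg_scale[of c z ds] by (auto simp: neg_def sum_distrib_left[symmetric] mult_less_0_iff)

lemma neg_sum_le: "neg z \<Longrightarrow> sum z D \<le> 0"
  by (auto simp: neg_def)

lemma sum_neg: "sum z D < 0 \<Longrightarrow> neg z"
  by (auto simp: neg_def)

text \<open>Totality and antisymmetry of the order at once. \<open>flow\<close> is required because
  the order sees only the coordinates on \<open>D\<close>.\<close>

lemma neg_uminus_iff:
  assumes "flow z"
  shows "neg (\<lambda>a. - z a) \<longleftrightarrow> \<not> neg z \<and> z \<noteq> (\<lambda>_. 0)"
proof -
  have "z \<noteq> (\<lambda>_. 0) \<longleftrightarrow> (\<exists>a\<in>D. z a \<noteq> 0)"
    using assms by (auto simp: flow_def fun_eq_iff)
  then show ?thesis
    using sum.neutral[of D z] by (auto simp: neg_def lex_neg_uminus_iff sum_negf)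
qed

lemma neg_irrefl: "\<not> neg (\<lambda>_. 0)"
  using neg_uminus_iff[of "\<lambda>_. 0"] by (simp add: flow_def)

lemma neg_imp_ex_negative:
  assumes "neg z" "flow z"
  shows "\<exists>a\<in>D. z a < 0"
proof (rule ccontr)
  assume "\<not> ?thesis"
  then have nn: "\<forall>a\<in>D. z a \<ge> 0" by auto
  with neg_sum_le[OF assms(1)] have "\<forall>a\<in>D. z a = 0"
    by (metis List.finite_set sum_nonneg sum_nonneg_eq_0_iff order_antisym)
  with assms(2) have "z = (\<lambda>_. 0)" by (auto simp: flow_def)
  with assms(1) neg_irrefl show False by simp
qed

lemma face_subset: "face S \<Longrightarrow> T \<subseteq> S \<Longrightarrow> face T"
  unfolding face_def by (meson Diff_mono order_refl order_trans subsetD)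

lemma face_empty: "face {}"
  unfolding face_def using neg_imp_ex_negative by fastforce

lemma faceD_carrier: "face S \<Longrightarrow> S \<subseteq> D"
  by (simp add: face_def)

lemma face_finite: "face S \<Longrightarrow> finite S"
  using faceD_carrier finite_subset by blast

text \<open>On \<open>S\<close> the sign condition in \<open>face\<close> is void, so a dependency
  supported in \<open>S\<close> is admissible together with its negative, and one of the two is
  below zero.\<close>

lemma face_independent:
  assumes "face S"
  shows "independent S"
proof (rule ccontr)
  assume "\<not> independent S"
  with face_finite[OF assms] obtain u where u: "\<exists>v\<in>S. u v \<noteq> 0" "(\<Sum>v\<in>S. u v *\<^sub>R v) = 0"
    by (auto simp: dependent_finite)
  define z where "z = (\<lambda>a. if a \<in> S then u a else 0)"
  have z: "flow z" "\<And>a. a \<notin> S \<Longrightarrow> z a = 0" "z \<noteq> (\<lambda>_. 0)"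
    using faceD_carrier[OF assms] u(1) by (auto simp: flow_def z_def fun_eq_iff)
  have "val z = 0"
    using val_support[OF face_finite[OF assms] faceD_carrier[OF assms] z(2)] u(2)
    by (simp add: z_def)
  then have "\<not> neg z" "\<not> neg (\<lambda>a. - z a)"
    using assms z(1,2) unfolding face_def by (auto simp: flow_def val_uminus)
  with neg_uminus_iff[OF z(1)] z(3) show False by simp
qed

lemma independent_flow_unique:
  assumes "independent S" "S \<subseteq> D" "val y = val y'"
    "\<And>a. a \<notin> S \<Longrightarrow> y a = 0" "\<And>a. a \<notin> S \<Longrightarrow> y' a = 0"
  shows "y = y'"
proof
  fix a
  have fin: "finite S" using assms(2) finite_subset by blast
  have "val (\<lambda>a. y a - y' a) = 0" by (simp add: val_diff assms)
  then have "(\<Sum>a\<in>S. (y a - y' a) *\<^sub>R a) = 0"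
    using val_support[OF fin assms(2), of "\<lambda>a. y a - y' a"] assms(4,5) by simp
  then have "a \<in> S \<Longrightarrow> y a - y' a = 0"
    using independentD[OF assms(1) fin, of "\<lambda>a. y a - y' a"] by blast
  then show "y a = y' a" using assms(4,5) by (cases "a \<in> S") auto
qed

text \<open>
  Coordinates on \<open>F\<close> are free. Walking along a dependency of the support until a coordinate off
  \<open>F\<close> vanishes shrinks the support, and since \<open>F\<close> is a face the walk never fails.
\<close>

lemma flow_reduce:
  assumes F: "face F" and y: "flow y" "\<forall>a\<in>D - F. y a \<ge> 0"
  shows "\<exists>y'. flow y' \<and> val y' = val y \<and> (\<forall>a\<in>D - F. y' a \<ge> 0) \<and>
    independent (F \<union> {a. y' a \<noteq> 0}) \<and> (y' = y \<or> neg (\<lambda>a. y' a - y a))"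
  using y
proof (induction "card ({a. y a \<noteq> 0} - F)" arbitrary: y rule: less_induct)
  case less
  let ?S = "F \<union> {a. y a \<noteq> 0}"
  have SD: "?S \<subseteq> D" using less.prems(1) faceD_carrier[OF F] by (auto simp: flow_def)
  then have fin: "finite ?S" using finite_subset by blast
  show ?case
  proof (cases "independent ?S")
    case True
    with less.prems show ?thesis by blast
  next
    case False
    with fin obtain u where u: "\<exists>v\<in>?S. u v \<noteq> 0" "(\<Sum>v\<in>?S. u v *\<^sub>R v) = 0"
      by (auto simp: dependent_finite)
    define z0 where "z0 = (\<lambda>a. if a \<in> ?S then u a else 0)"
    have z0: "flow z0" "\<And>a. a \<notin> ?S \<Longrightarrow> z0 a = 0" "z0 \<noteq> (\<lambda>_. 0)"
      using SD u(1) by (auto simp: flow_def z0_def fun_eq_iff)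
    have v0: "val z0 = 0"
      using val_support[OF fin SD z0(2)] u(2) by (simp add: z0_def)
    \<comment> \<open>Of a dependency and its negative the one below zero is kept, so every step
      along it lowers the flow.\<close>
    obtain z where z: "flow z" "\<And>a. a \<notin> ?S \<Longrightarrow> z a = 0" "neg z" "val z = 0"
    proof (cases "neg z0")
      case True
      then show ?thesis using that z0 v0 by blast
    next
      case False
      then have "neg (\<lambda>a. - z0 a)" using neg_uminus_iff[OF z0(1)] z0(3) by simp
      then show ?thesis using that[of "\<lambda>a. - z0 a"] z0 v0 by (simp add: flow_def val_uminus)
    qed
    let ?N = "{a \<in> D - F. z a < 0}"
    have "?N \<noteq> {}"
    proof
      assume "?N = {}"
      then have "\<forall>a\<in>D - F. z a \<ge> 0" by fastforce
      with F z show False by (auto simp: face_def)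
    qed
    \<comment> \<open>The ratio test of the simplex method: \<open>\<theta>\<close> is the largest
      step keeping all coordinates off \<open>F\<close> nonnegative, and it makes the coordinate at
      the minimiser \<open>b\<close> vanish.\<close>
    define \<theta> where "\<theta> = Min ((\<lambda>a. y a / - z a) ` ?N)"
    have finN: "finite ((\<lambda>a. y a / - z a) ` ?N)" by auto
    have "\<theta> \<in> (\<lambda>a. y a / - z a) ` ?N"
      unfolding \<theta>_def using finN \<open>?N \<noteq> {}\<close> by (intro Min_in) auto
    then obtain b where b: "b \<in> ?N" "\<theta> = y b / - z b" by auto
    have \<theta>_le: "\<theta> \<le> y a / - z a" if "a \<in> ?N" for a
      unfolding \<theta>_def using finN that by (intro Min_le) auto
    have yb: "y b > 0" "b \<notin> F"
      using b(1) less.prems(2) z(2)[of b] by (fastforce simp: less_le)+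
    have \<theta>pos: "\<theta> > 0" using b yb by (simp add: divide_pos_neg)
    define y1 where "y1 = (\<lambda>a. y a + \<theta> * z a)"
    have y1: "flow y1" using less.prems(1) z(1) by (simp add: flow_def y1_def)
    have val1: "val y1 = val y" by (simp add: y1_def val_add val_scale z(4))
    have nn1: "\<forall>a\<in>D - F. y1 a \<ge> 0"
    proof
      fix a assume a: "a \<in> D - F"
      show "y1 a \<ge> 0"
      proof (cases "z a < 0")
        case True
        with \<theta>_le[of a] a have "\<theta> * - z a \<le> y a" by (simp add: field_simps)
        then show ?thesis by (simp add: y1_def)
      next
        case False
        with a less.prems(2) \<theta>pos show ?thesis by (simp add: y1_def)
      qed
    qed
    have "y1 b = 0" using b by (simp add: y1_def)
    moreover have "{a. y1 a \<noteq> 0} - F \<subseteq> {a. y a \<noteq> 0} - F"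
      using z(2) by (auto simp: y1_def)
    ultimately have "{a. y1 a \<noteq> 0} - F \<subset> {a. y a \<noteq> 0} - F" using yb by auto
    then have "card ({a. y1 a \<noteq> 0} - F) < card ({a. y a \<noteq> 0} - F)"
      using fin by (intro psubset_card_mono) auto
    from less.hyps[OF this y1 nn1] obtain y' where y': "flow y'" "val y' = val y1"
      "\<forall>a\<in>D - F. y' a \<ge> 0" "independent (F \<union> {a. y' a \<noteq> 0})"
      "y' = y1 \<or> neg (\<lambda>a. y' a - y1 a)" by blast
    have n1: "neg (\<lambda>a. y1 a - y a)" using neg_scale[OF \<theta>pos z(3)] by (simp add: y1_def)
    have "neg (\<lambda>a. y' a - y a)"
      using y'(5)
    proof
      assume "neg (\<lambda>a. y' a - y1 a)"
      from neg_add[OF this n1] show ?thesis by simp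
    qed (use n1 in simp)
    with y' val1 show ?thesis by metis
  qed
qed

lemma flow_exists:
  assumes "x \<in> span D"
  shows "\<exists>y. flow y \<and> val y = x \<and> (\<forall>a. y a \<ge> 0)"
proof -
  from assms obtain c where c: "x = (\<Sum>a\<in>D. c a *\<^sub>R a)"
    by (auto simp: span_finite)
  \<comment> \<open>A negative coefficient is moved to the opposite vector, so \<open>a\<close>
    collects the positive part of \<open>c a\<close> and the negative part of
    \<open>c (- a)\<close>.\<close>
  define y where "y = (\<lambda>a. if a \<in> D then max (c a) 0 + max (- c (- a)) 0 else 0)"
  have "bij_betw uminus D D"
    by (rule bij_betw_byWitness[where f' = uminus]) (auto simp: uminus_closed)
  then have "(\<Sum>a\<in>D. max (- c (- a)) 0 *\<^sub>R a) = (\<Sum>a\<in>D. max (- c a) 0 *\<^sub>R (- a))"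
    by (subst sum.reindex_bij_betw[symmetric, where h = uminus and S = D]) auto
  then have "val y = (\<Sum>a\<in>D. max (c a) 0 *\<^sub>R a + max (- c a) 0 *\<^sub>R (- a))"
    by (simp add: val_def y_def scaleR_left_distrib sum.distrib del: scaleR_minus_right)
  also have "\<dots> = x" unfolding c
    by (rule sum.cong) (auto simp: max_def)
  finally show ?thesis
    by (intro exI[of _ y]) (auto simp: flow_def y_def)
qed

text \<open>Lexicographic linear programming with the coordinates on \<open>F\<close> unrestricted.
  By \<open>flow_reduce\<close> it suffices to minimise over flows whose support together with
  \<open>F\<close> is independent; that set determines the flow, so there are finitely many. At the
  minimum no negative relation can be added, which is the face condition.\<close>

lemma face_flow_exists:
  assumes F: "face F" and x: "x \<in> span D"
  shows "\<exists>y. flow y \<and> val y = x \<and> (\<forall>a\<in>D - F. y a \<ge> 0) \<and> face (F \<union> {a. y a \<noteq> 0})"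
proof -
  define \<Phi> where "\<Phi> = {y. flow y \<and> val y = x \<and> (\<forall>a\<in>D - F. y a \<ge> 0)}"
  define I where "I = {y \<in> \<Phi>. independent (F \<union> {a. y a \<noteq> 0})}"
  have red: "\<exists>y'\<in>I. y' = y \<or> neg (\<lambda>a. y' a - y a)" if "y \<in> \<Phi>" for y
    using flow_reduce[OF F, of y] that by (auto simp: \<Phi>_def I_def)
  have "\<Phi> \<noteq> {}" using flow_exists[OF x] by (auto simp: \<Phi>_def)
  then have "I \<noteq> {}" using red by blast
  have "inj_on (\<lambda>y. F \<union> {a. y a \<noteq> 0}) I"
  proof (rule inj_onI)
    fix y y' assume h: "y \<in> I" "y' \<in> I" "F \<union> {a. y a \<noteq> 0} = F \<union> {a. y' a \<noteq> 0}"
    show "y = y'"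
    proof (rule independent_flow_unique[of "F \<union> {a. y a \<noteq> 0}"])
      show "F \<union> {a. y a \<noteq> 0} \<subseteq> D"
        using h(1) faceD_carrier[OF F] by (auto simp: I_def \<Phi>_def flow_def)
    qed (use h in \<open>auto simp: I_def \<Phi>_def\<close>)
  qed
  moreover have "(\<lambda>y. F \<union> {a. y a \<noteq> 0}) ` I \<subseteq> Pow D"
    using faceD_carrier[OF F] by (auto simp: I_def \<Phi>_def flow_def)
  ultimately have "finite I"
    by (meson List.finite_set finite_Pow_iff inj_on_finite)
  have diff_flow: "flow (\<lambda>a. y a - y' a)" if "y \<in> \<Phi>" "y' \<in> \<Phi>" for y y'
    using that by (simp add: \<Phi>_def flow_def)
  define R where "R = (\<lambda>y' y. neg (\<lambda>a::'a. y' a - y a))"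
  have "\<exists>m\<in>I. \<forall>y\<in>I. y \<noteq> m \<longrightarrow> \<not> R y m"
  proof (rule Finite_Set.bex_min_element[OF \<open>finite I\<close> _ _ \<open>I \<noteq> {}\<close>])
    show "asymp_on I R"
    proof (rule asymp_onI)
      fix y y' assume "y \<in> I" "y' \<in> I" "R y y'"
      then show "\<not> R y' y"
        using neg_uminus_iff[OF diff_flow[of y y']] by (auto simp: R_def I_def)
    qed
    show "transp_on I R"
    proof (rule transp_onI)
      fix y1 y2 y3 assume "R y1 y2" "R y2 y3"
      then show "R y1 y3" using neg_add[of "\<lambda>a. y1 a - y2 a" "\<lambda>a. y2 a - y3 a"] by (simp add: R_def)
    qed
  qed
  then obtain m where m: "m \<in> I" "\<And>y. y \<in> I \<Longrightarrow> \<not> neg (\<lambda>a. y a - m a)"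
    using neg_irrefl by (fastforce simp: R_def)
  have m\<Phi>: "m \<in> \<Phi>" using m(1) by (simp add: I_def)
  have opt: "\<not> neg (\<lambda>a. y a - m a)" if "y \<in> \<Phi>" for y
  proof
    assume n: "neg (\<lambda>a. y a - m a)"
    from red[OF that] obtain y' where y': "y' \<in> I" "y' = y \<or> neg (\<lambda>a. y' a - y a)" by blast
    then have "neg (\<lambda>a. y' a - m a)" using n neg_add[of "\<lambda>a. y' a - y a" "\<lambda>a. y a - m a"] by auto
    with m(2)[OF y'(1)] show False by simp
  qed
  have "face (F \<union> {a. m a \<noteq> 0})"
    unfolding face_def
  proof (intro conjI allI impI)
    show "F \<union> {a. m a \<noteq> 0} \<subseteq> D"
      using m\<Phi> faceD_carrier[OF F] by (auto simp: \<Phi>_def flow_def)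
    fix z assume z: "flow z \<and> val z = 0 \<and> (\<forall>a\<in>D - (F \<union> {a. m a \<noteq> 0}). 0 \<le> z a)"
    show "\<not> neg z"
    proof
      assume "neg z"
      \<comment> \<open>A step small enough for every coordinate off \<open>F\<close> that
        decreases; the extra 1 keeps the set nonempty when none does.\<close>
      let ?P = "insert 1 ((\<lambda>a. m a / - z a) ` {a \<in> D - F. z a < 0})"
      define \<epsilon> where "\<epsilon> = Min ?P"
      have finP: "finite ?P" by auto
      have pos: "p > 0" if "p \<in> ?P" for p
      proof -
        have "m a / - z a > 0" if "a \<in> D - F" "z a < 0" for a
        proof -
          have "m a > 0" using z that m\<Phi> by (force simp: \<Phi>_def less_le)
          with that show ?thesis by (simp add: divide_pos_neg)
        qed
        with that show ?thesis by auto
      qed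
      have "\<epsilon> > 0" unfolding \<epsilon>_def using finP pos by (subst Min_gr_iff) auto
      define y where "y = (\<lambda>a. m a + \<epsilon> * z a)"
      have "y \<in> \<Phi>"
      proof -
        have "y a \<ge> 0" if a: "a \<in> D - F" for a
        proof (cases "z a < 0")
          case True
          then have "\<epsilon> \<le> m a / - z a" unfolding \<epsilon>_def using finP a by (intro Min_le) auto
          with True have "\<epsilon> * - z a \<le> m a" by (simp add: field_simps)
          then show ?thesis by (simp add: y_def)
        next
          case False
          with a m\<Phi> \<open>\<epsilon> > 0\<close> show ?thesis by (simp add: y_def \<Phi>_def)
        qed
        then show ?thesis using m\<Phi> z by (auto simp: \<Phi>_def y_def flow_def val_add val_scale)
      qed
      moreover have "neg (\<lambda>a. y a - m a)"
        using neg_scale[OF \<open>\<epsilon> > 0\<close> \<open>neg z\<close>] by (simp add: y_def)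
      ultimately show False using opt by blast
    qed
  qed
  with m\<Phi> show ?thesis by (auto simp: \<Phi>_def)
qed

text \<open>The difference of the two flows is nonnegative off the first face and its negative is
  nonnegative off the second, so neither is below zero; totality leaves only zero.\<close>

lemma face_flow_unique:
  assumes "face (F \<union> {a. y a \<noteq> 0})" "face (F \<union> {a. y' a \<noteq> 0})" "flow y" "flow y'" "val y = val y'"
    and nn: "\<forall>a\<in>D - F. y a \<ge> 0" "\<forall>a\<in>D - F. y' a \<ge> 0"
  shows "y = y'"
proof -
  let ?z = "\<lambda>a. y' a - y a"
  have z: "flow ?z" "val ?z = 0" using assms by (auto simp: flow_def val_diff)
  have "\<not> neg ?z"
    using assms(1) z nn unfolding face_def by auto
  moreover have "\<not> neg (\<lambda>a. - ?z a)"
    using assms(2) z nn unfolding face_def by (auto simp: flow_def val_diff)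
  ultimately have "?z = (\<lambda>_. 0)" using neg_uminus_iff[OF z(1)] by blast
  then show ?thesis by (auto simp: fun_eq_iff)
qed

text \<open>The total weight is compared first, so the weight of a minimal flow is the gauge of its
  value.\<close>

lemma face_flow_minimal:
  assumes "face {a. y a \<noteq> 0}" "flow y'" "val y' = val y" "\<forall>a. y' a \<ge> 0"
  shows "sum y D \<le> sum y' D"
proof -
  let ?z = "\<lambda>a. y' a - y a"
  have "flow y" using faceD_carrier[OF assms(1)] by (auto simp: flow_def)
  then have "flow ?z" "val ?z = 0" "\<forall>a\<in>D - {a. y a \<noteq> 0}. ?z a \<ge> 0"
    using assms by (auto simp: flow_def val_diff)
  then have "\<not> neg ?z" using assms(1) by (auto simp: face_def)
  then have "\<not> sum ?z D < 0" using sum_neg by blast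
  then show ?thesis by (simp add: sum_subtractf)
qed

end

section \<open>Half-open decomposition and lattice points\<close>

text \<open>Induction over the subspaces. If \<open>q\<close> avoids the earlier ones but lies in
  \<open>T\<close>, the line \<open>w + c q\<close> with \<open>w\<close> outside \<open>T\<close>
  avoids \<open>T\<close> and meets each earlier subspace at most once.\<close>

lemma subspace_not_finite_Union:
  assumes "finite \<T>" "subspace V" "\<And>T. T \<in> \<T> \<Longrightarrow> subspace T \<and> \<not> V \<subseteq> T"
  shows "\<exists>q\<in>V. \<forall>T\<in>\<T>. q \<notin> (T :: 'b::real_vector set)"
  using assms(1,3)
proof (induction \<T> rule: finite_induct)
  case empty
  then show ?case using subspace_0[OF assms(2)] by blast
next
  case (insert T \<T>)
  then obtain q where q: "q \<in> V" "\<forall>T\<in>\<T>. q \<notin> T" by auto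
  obtain w where w: "w \<in> V" "w \<notin> T" using insert.prems by blast
  show ?case
  proof (cases "q \<in> T")
    case False
    with q show ?thesis by auto
  next
    case True
    define bad where "bad = (\<lambda>T'. {c :: real. w + c *\<^sub>R q \<in> T'})"
    have "finite (bad T')" if T': "T' \<in> \<T>" for T'
    proof -
      have s: "subspace T'" using insert.prems T' by blast
      have "c = c'" if "c \<in> bad T'" "c' \<in> bad T'" for c c'
      proof (rule ccontr)
        assume "c \<noteq> c'"
        have "(w + c *\<^sub>R q) - (w + c' *\<^sub>R q) \<in> T'"
          using that by (intro subspace_diff[OF s]) (auto simp: bad_def)
        then have "(1 / (c - c')) *\<^sub>R ((c - c') *\<^sub>R q) \<in> T'"
          using subspace_scale[OF s] by (simp add: scaleR_left_diff_distrib)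
        with \<open>c \<noteq> c'\<close> q(2) T' show False by simp
      qed
      then have "\<And>c. c \<in> bad T' \<Longrightarrow> bad T' \<subseteq> {c}" by blast
      then show ?thesis by (metis finite.emptyI finite.insertI finite_subset ex_in_conv)
    qed
    then have "finite (\<Union>T'\<in>\<T>. bad T')" using insert.hyps(1) by blast
    then obtain c where c: "c \<notin> (\<Union>T'\<in>\<T>. bad T')"
      using infinite_UNIV_char_0 by (metis UNIV_eq_I)
    have "w + c *\<^sub>R q \<in> V" using w q assms(2) by (simp add: subspace_add subspace_scale)
    moreover have "w + c *\<^sub>R q \<notin> T"
    proof
      assume "w + c *\<^sub>R q \<in> T"
      moreover have s: "subspace T" using insert.prems by blast
      ultimately have "(w + c *\<^sub>R q) - c *\<^sub>R q \<in> T"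
        using True subspace_diff subspace_scale by blast
      with w show False by simp
    qed
    ultimately show ?thesis using c by (auto simp: bad_def)
  qed
qed

text \<open>Stars and bars. Splitting by whether \<open>y x\<close> is zero gives Pascal's rule,
  hence the inner induction on \<open>m\<close>.\<close>

lemma card_bounded_sum_functions:
  assumes "finite A"
  shows "card {y :: 'b \<Rightarrow> nat. (\<forall>a. a \<notin> A \<longrightarrow> y a = 0) \<and> sum y A \<le> m} = (m + card A) choose card A
    \<and> finite {y :: 'b \<Rightarrow> nat. (\<forall>a. a \<notin> A \<longrightarrow> y a = 0) \<and> sum y A \<le> m}"
  using assms
proof (induction A arbitrary: m rule: finite_induct)
  case empty
  have "{y :: 'b \<Rightarrow> nat. \<forall>a. y a = 0} = {\<lambda>_. 0}" by auto
  then show ?case by simp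
next
  case (insert x A)
  let ?X = "\<lambda>A m. {y :: 'b \<Rightarrow> nat. (\<forall>a. a \<notin> A \<longrightarrow> y a = 0) \<and> sum y A \<le> m}"
  let ?up = "\<lambda>y :: 'b \<Rightarrow> nat. y(x := Suc (y x))"
  have x: "x \<notin> A" "finite A" using insert by auto
  have upd: "sum (y(x := c)) A = sum y A" for y :: "'b \<Rightarrow> nat" and c
    by (rule sum.cong) (use x in auto)
  show ?case
  proof (induction m)
    case 0
    have "y \<in> ?X (insert x A) 0 \<longleftrightarrow> y \<in> ?X A 0" for y
      using x by (cases "y x = 0") (auto, metis)
    then have "?X (insert x A) 0 = ?X A 0" by blast
    then show ?case using insert.IH[of 0] x by simp
  next
    case (Suc m)
    have eq: "?X (insert x A) (Suc m) = ?X A (Suc m) \<union> ?up ` ?X (insert x A) m"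
    proof (intro equalityI subsetI)
      fix y assume y: "y \<in> ?X (insert x A) (Suc m)"
      show "y \<in> ?X A (Suc m) \<union> ?up ` ?X (insert x A) m"
      proof (cases "y x")
        case 0
        have "a \<notin> A \<Longrightarrow> y a = 0" for a using y 0 by (cases "a = x") auto
        with y x show ?thesis by auto
      next
        case (Suc k)
        then have "y = ?up (y(x := k))" by auto
        moreover have "y(x := k) \<in> ?X (insert x A) m"
          using y Suc x upd[of y k] by auto
        ultimately show ?thesis by blast
      qed
    next
      fix y assume "y \<in> ?X A (Suc m) \<union> ?up ` ?X (insert x A) m"
      then show "y \<in> ?X (insert x A) (Suc m)"
      proof
        assume "y \<in> ?X A (Suc m)"
        then show ?thesis using x by simp
      next
        assume "y \<in> ?up ` ?X (insert x A) m"
        then obtain y' where "y' \<in> ?X (insert x A) m" "y = ?up y'" by blast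
        then show ?thesis using x upd[of y' "Suc (y' x)"] by auto
      qed
    qed
    have "?up y \<notin> ?X A (Suc m)" for y using x(1) by (auto intro!: exI[of _ x])
    then have disj: "?X A (Suc m) \<inter> ?up ` ?X (insert x A) m = {}" by blast
    have inj: "inj_on ?up (?X (insert x A) m)"
    proof (rule inj_onI)
      fix y y' assume "?up y = ?up y'"
      then show "y = y'" by (auto simp: fun_eq_iff split: if_splits)
    qed
    show ?case
      unfolding eq using disj Suc insert.IH[of "Suc m"] x inj
      by (simp add: card_Un_disjoint card_image)
  qed
qed

text \<open>Lowering \<open>y\<close> by one on \<open>B\<close> reduces to the previous count with
  \<open>m - card B\<close>. Counted are the lattice points of bounded weight in a half-open
  unimodular cone, the walls indexed by \<open>B\<close> being removed.\<close>

lemma card_bounded_sum_functions_positive: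
  assumes "finite A" "B \<subseteq> A"
  shows "card {y :: 'b \<Rightarrow> nat. (\<forall>a. a \<notin> A \<longrightarrow> y a = 0) \<and> (\<forall>a\<in>B. y a \<noteq> 0) \<and> sum y A \<le> m}
    = (m + card A - card B) choose card A" (is "card ?Y = _")
proof (cases "card B \<le> m")
  case True
  let ?X = "{y :: 'b \<Rightarrow> nat. (\<forall>a. a \<notin> A \<longrightarrow> y a = 0) \<and> sum y A \<le> m - card B}"
  let ?up = "\<lambda>y a. y a + (if a \<in> B then 1 else 0 :: nat)"
  have s: "(\<Sum>a\<in>A. if a \<in> B then 1 else 0 :: nat) = card B"
    using assms by (simp add: sum.If_cases inf.absorb2)
  have "?Y = ?up ` ?X"
  proof (intro equalityI subsetI)
    fix y assume y: "y \<in> ?Y"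
    let ?y = "\<lambda>a. y a - (if a \<in> B then 1 else 0 :: nat)"
    have e: "y = ?up ?y" using y by force
    then have "sum y A = sum ?y A + card B"
      using s by (metis (no_types, lifting) sum.cong sum.distrib)
    then have "?y \<in> ?X" using y by auto
    with e show "y \<in> ?up ` ?X" by (rule image_eqI)
  next
    fix y assume "y \<in> ?up ` ?X"
    then show "y \<in> ?Y" using True s assms(2) by (auto simp: sum.distrib)
  qed
  moreover have "inj_on ?up ?X" by (rule inj_onI) (simp add: fun_eq_iff)
  ultimately show ?thesis
    using card_bounded_sum_functions[OF assms(1), of "m - card B"] True by (simp add: card_image)
next
  case False
  have "?Y = {}"
  proof (rule ccontr)
    assume "?Y \<noteq> {}"
    then obtain y where y: "\<forall>a\<in>B. y a \<noteq> 0" "sum y A \<le> m" by blast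
    have "card B \<le> sum y B" using y(1) sum_mono[of B "\<lambda>_. 1" y] by fastforce
    also have "\<dots> \<le> sum y A" using assms by (simp add: sum_mono2)
    finally show False using y(2) False by simp
  qed
  then have "card ?Y = 0" by (simp only: card.empty)
  moreover have "card B \<le> card A" using assms by (simp add: card_mono)
  ultimately show ?thesis using False by (simp add: binomial_eq_0)
qed

section \<open>Generic directions and half-open cells\<close>

context symmetric_configuration
begin

definition rk :: nat where "rk = dim D"

definition facets :: "'a set set" where
  "facets = {S. face S \<and> card S = rk}"

text \<open>Spans of smaller rank are avoided for all subsets of \<open>D\<close>, which makes every
  coordinate of \<open>q\<close> with respect to a facet nonzero.\<close>

definition generic :: "'a \<Rightarrow> bool" where
  "generic q \<longleftrightarrow> q \<in> span D \<and> (\<forall>S\<subseteq>D. q \<in> span S \<longrightarrow> rk \<le> dim S)"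

definition negative_part :: "'a \<Rightarrow> 'a set \<Rightarrow> 'a set" where
  "negative_part q S = {a \<in> S. representation S q a < 0}"

lemma ex_generic: "\<exists>q. generic q"
proof -
  let ?T = "span ` {S. S \<subseteq> D \<and> dim S < rk}"
  have "\<exists>q\<in>span D. \<forall>T\<in>?T. q \<notin> T"
  proof (rule subspace_not_finite_Union)
    fix T assume "T \<in> ?T"
    then obtain S where S: "T = span S" "dim S < rk" by auto
    then have "\<not> span D \<subseteq> T" using dim_subset[of "span D" "span S"] by (auto simp: rk_def)
    with S show "subspace T \<and> \<not> span D \<subseteq> T" by simp
  qed auto
  then show ?thesis by (force simp: generic_def not_less[symmetric])
qed

lemma generic_uminus: "generic q \<Longrightarrow> generic (- q)"
  unfolding generic_def by (metis span_neg add.inverse_inverse)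

lemma facets_finite: "finite facets"
  using finite_subset[of facets "Pow D"] faceD_carrier by (auto simp: facets_def)

lemma independent_D_span:
  assumes "generic q" "face S" "q \<in> span S"
  shows "S \<in> facets"
proof -
  have "rk \<le> dim S" using assms faceD_carrier by (auto simp: generic_def)
  moreover have "dim S = card S" using face_independent[OF assms(2)] dim_eq_card_independent by blast
  moreover have "dim S \<le> rk"
    unfolding rk_def using dim_subset faceD_carrier[OF assms(2)] by blast
  ultimately show ?thesis using assms(2) by (simp add: facets_def)
qed

lemma facet_span:
  assumes "S \<in> facets"
  shows "span S = span D"
proof -
  have S: "face S" "card S = rk" using assms by (auto simp: facets_def)
  then have "dim S = dim D" using face_independent dim_eq_card_independent rk_def by metis
  then show ?thesis using dim_eq_span[of S D] faceD_carrier[OF S(1)] by simp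
qed

lemma representation_facet:
  assumes "S \<in> facets" "x \<in> span D"
  shows "flow (representation S x)" "val (representation S x) = x"
    "\<And>a. a \<notin> S \<Longrightarrow> representation S x a = 0"
proof -
  have S: "face S" using assms by (auto simp: facets_def)
  show z: "\<And>a. a \<notin> S \<Longrightarrow> representation S x a = 0"
    using representation_ne_zero by blast
  then show "flow (representation S x)" using faceD_carrier[OF S] by (auto simp: flow_def)
  have "val (representation S x) = (\<Sum>a\<in>S. representation S x a *\<^sub>R a)"
    by (rule val_support) (use z S faceD_carrier face_finite in auto)
  also have "\<dots> = x"
    using sum_representation_eq[OF face_independent[OF S], of x S] assms facet_span face_finite[OF S]
    by simp
  finally show "val (representation S x) = x" .
qed

lemma representation_generic_nonzero:
  assumes "generic q" "S \<in> facets" "a \<in> S"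
  shows "representation S q a \<noteq> 0"
proof
  assume 0: "representation S q a = 0"
  have S: "face S" "card S = rk" using assms by (auto simp: facets_def)
  have q: "q \<in> span D" using assms(1) by (simp add: generic_def)
  have "q = (\<Sum>a\<in>S. representation S q a *\<^sub>R a)"
    using sum_representation_eq[OF face_independent[OF S(1)], of q S] facet_span[OF assms(2)]
      face_finite[OF S(1)] q by simp
  also have "\<dots> = (\<Sum>a\<in>S - {a}. representation S q a *\<^sub>R a)"
    by (rule sum.mono_neutral_right) (use 0 face_finite[OF S(1)] in auto)
  finally have "q \<in> span (S - {a})"
    by (metis (no_types, lifting) span_base span_scale span_sum)
  then have "rk \<le> dim (S - {a})" using assms(1) faceD_carrier[OF S(1)] unfolding generic_def by blast
  also have "\<dots> \<le> card (S - {a})" using face_finite[OF S(1)] by (simp add: dim_le_card')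
  also have "\<dots> < rk" using S assms(3) face_finite[OF S(1)]
    by (metis card_Diff1_less)
  finally show False by simp
qed

text \<open>
  The facet is the one that is entered when moving from the relative interior of the cone over
  \<open>F\<close> in the direction \<open>q\<close>.
\<close>

lemma ex1_facet:
  assumes q: "generic q" and F: "face F"
  shows "\<exists>!S. S \<in> facets \<and> negative_part q S \<subseteq> F \<and> F \<subseteq> S"
proof (rule ex_ex1I)
  have qD: "q \<in> span D" using q by (simp add: generic_def)
  \<comment> \<open>This flow can be negative only on \<open>F\<close>, which is the condition on
    the negative part; genericity makes its support together with \<open>F\<close> a full
    facet.\<close>
  from face_flow_exists[OF F qD] obtain y where y: "flow y" "val y = q" "\<forall>a\<in>D - F. y a \<ge> 0"
    "face (F \<union> {a. y a \<noteq> 0})" by blast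
  let ?S = "F \<union> {a. y a \<noteq> 0}"
  have "q = (\<Sum>a\<in>?S. y a *\<^sub>R a)"
    unfolding y(2)[symmetric] by (rule val_support) (use face_finite[OF y(4)] faceD_carrier[OF y(4)] in auto)
  then have "q \<in> span ?S"
    by (metis (no_types, lifting) span_base span_scale span_sum)
  then have S: "?S \<in> facets" using independent_D_span[OF q y(4)] by blast
  have "representation ?S q = y"
    by (rule independent_flow_unique[OF face_independent[OF y(4)] faceD_carrier[OF y(4)]])
      (use representation_facet[OF S qD] y in auto)
  moreover have "a \<in> F" if "y a < 0" for a
    using y(1,3) that by (metis DiffI flow_def linorder_not_le order_less_irrefl)
  ultimately have "negative_part q ?S \<subseteq> F" by (auto simp: negative_part_def)
  with S show "\<exists>S. S \<in> facets \<and> negative_part q S \<subseteq> F \<and> F \<subseteq> S" by blast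
next
  have qD: "q \<in> span D" using q by (simp add: generic_def)
  fix S S' assume S: "S \<in> facets \<and> negative_part q S \<subseteq> F \<and> F \<subseteq> S"
    and S': "S' \<in> facets \<and> negative_part q S' \<subseteq> F \<and> F \<subseteq> S'"
  have supp: "F \<union> {a. representation T q a \<noteq> 0} = T" if "T \<in> facets" "F \<subseteq> T" for T
    using representation_generic_nonzero[OF q that(1)] representation_facet(3)[OF that(1) qD] that
    by blast
  have nn: "\<forall>a\<in>D - F. representation T q a \<ge> 0"
    if "T \<in> facets" "negative_part q T \<subseteq> F" for T
  proof
    fix a assume "a \<in> D - F"
    then have "a \<notin> negative_part q T" using that(2) by blast
    then show "representation T q a \<ge> 0"
      using representation_facet(3)[OF that(1) qD, of a]
      by (cases "a \<in> T") (simp_all add: negative_part_def)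
  qed
  have "representation S q = representation S' q"
  proof (rule face_flow_unique[of F])
    show "face (F \<union> {a. representation S q a \<noteq> 0})" "face (F \<union> {a. representation S' q a \<noteq> 0})"
      using S S' supp by (simp_all add: facets_def)
  qed (use S S' nn representation_facet[OF _ qD] in simp_all)
  then show "S = S'" using supp S S' by metis
qed

definition h_num :: "'a \<Rightarrow> nat \<Rightarrow> nat" where
  "h_num q j = card {S \<in> facets. card (negative_part q S) = j}"

text \<open>No coordinate of \<open>q\<close> vanishes on a facet, so changing the sign of
  \<open>q\<close> complements the negative part there.\<close>

lemma h_num_uminus:
  assumes "generic q" "j \<le> rk"
  shows "h_num (- q) j = h_num q (rk - j)"
proof -
  have "card (negative_part (- q) S) = rk - card (negative_part q S)" if S: "S \<in> facets" for S
  proof -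
    have f: "face S" "card S = rk" "finite S" using S face_finite by (auto simp: facets_def)
    have "q \<in> span S" using assms(1) facet_span[OF S] by (simp add: generic_def)
    then have "representation S (- q) a = - representation S q a" for a
      using representation_neg[OF face_independent[OF f(1)]] by (simp add: fun_eq_iff)
    then have "negative_part (- q) S = S - negative_part q S"
      using representation_generic_nonzero[OF assms(1) S] by (force simp: negative_part_def)
    moreover have "negative_part q S \<subseteq> S" by (auto simp: negative_part_def)
    ultimately show ?thesis using f by (simp add: card_Diff_subset finite_subset)
  qed
  moreover have "card (negative_part q S) \<le> rk" if S: "S \<in> facets" for S
    using S face_finite card_mono[of S "negative_part q S"] by (auto simp: facets_def negative_part_def)
  ultimately have "{S \<in> facets. card (negative_part (- q) S) = j} =
      {S \<in> facets. card (negative_part q S) = rk - j}"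
    using assms(2) by force
  then show ?thesis by (simp add: h_num_def)
qed

text \<open>The facet that \<open>ex1_facet\<close> assigns to the support sorts these functions
  into disjoint classes. In the class of \<open>S\<close> the values on
  \<open>negative_part q S\<close> must be positive, and the other values on \<open>S\<close> are
  arbitrary.\<close>

lemma card_face_supported:
  assumes q: "generic q"
  shows "finite {y :: 'a \<Rightarrow> nat. face {a. y a \<noteq> 0} \<and> sum y D \<le> m}"
    and "card {y :: 'a \<Rightarrow> nat. face {a. y a \<noteq> 0} \<and> sum y D \<le> m} =
      (\<Sum>j=0..rk. h_num q j * ((m + rk - j) choose rk))"
proof -
  let ?Y = "{y :: 'a \<Rightarrow> nat. face {a. y a \<noteq> 0} \<and> sum y D \<le> m}"
  let ?Z = "\<lambda>S. {y :: 'a \<Rightarrow> nat. (\<forall>a. a \<notin> S \<longrightarrow> y a = 0) \<and> (\<forall>a\<in>negative_part q S. y a \<noteq> 0)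
    \<and> sum y S \<le> m}"
  have sumS: "sum y S = sum y D" if "S \<in> facets" "\<forall>a. a \<notin> S \<longrightarrow> y a = 0" for S and y :: "'a \<Rightarrow> nat"
    by (rule sum.mono_neutral_left) (use that faceD_carrier in \<open>auto simp: facets_def\<close>)
  have part: "(y \<in> ?Z S \<longleftrightarrow> y \<in> ?Y \<and> negative_part q S \<subseteq> {a. y a \<noteq> 0} \<and> {a. y a \<noteq> 0} \<subseteq> S)"
    if S: "S \<in> facets" for S y
  proof
    assume y: "y \<in> ?Z S"
    have "{a. y a \<noteq> 0} \<subseteq> S" using y by auto
    then have "face {a. y a \<noteq> 0}" using S face_subset by (auto simp: facets_def)
    with y sumS[OF S, of y] show "y \<in> ?Y \<and> negative_part q S \<subseteq> {a. y a \<noteq> 0} \<and> {a. y a \<noteq> 0} \<subseteq> S"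
      by auto
  next
    assume "y \<in> ?Y \<and> negative_part q S \<subseteq> {a. y a \<noteq> 0} \<and> {a. y a \<noteq> 0} \<subseteq> S"
    moreover from this have "\<forall>a. a \<notin> S \<longrightarrow> y a = 0" by blast
    ultimately show "y \<in> ?Z S" using sumS[OF S, of y] by auto
  qed
  have Y: "?Y = (\<Union>S\<in>facets. ?Z S)"
  proof (intro equalityI subsetI)
    fix y assume y: "y \<in> ?Y"
    then obtain S where "S \<in> facets" "negative_part q S \<subseteq> {a. y a \<noteq> 0}" "{a. y a \<noteq> 0} \<subseteq> S"
      using ex1_facet[OF q] by blast
    then show "y \<in> (\<Union>S\<in>facets. ?Z S)" using part y by blast
  qed (use part in blast)
  have disj: "?Z S \<inter> ?Z S' = {}" if S: "S \<in> facets" "S' \<in> facets" "S \<noteq> S'" for S S'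
  proof (rule ccontr)
    assume "?Z S \<inter> ?Z S' \<noteq> {}"
    then obtain y where y: "y \<in> ?Z S" "y \<in> ?Z S'" by blast
    with part S have "face {a. y a \<noteq> 0}" by blast
    from ex1_facet[OF q this] have "S = S'"
    proof (rule ex1E)
      fix T assume T: "\<forall>S. S \<in> facets \<and> negative_part q S \<subseteq> {a. y a \<noteq> 0} \<and> {a. y a \<noteq> 0} \<subseteq> S \<longrightarrow> S = T"
      have "S = T" using T part[OF S(1), of y] y(1) S(1) by blast
      moreover have "S' = T" using T part[OF S(2), of y] y(2) S(2) by blast
      ultimately show "S = S'" by simp
    qed
    with S(3) show False by simp
  qed
  have fin: "finite (?Z S)" if "S \<in> facets" for S
    by (rule finite_subset[OF _ card_bounded_sum_functions[THEN conjunct2, of S m]])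
      (use that face_finite in \<open>auto simp: facets_def\<close>)
  have np: "negative_part q S \<subseteq> S" for S by (auto simp: negative_part_def)
  have cardZ: "card (?Z S) = (m + rk - card (negative_part q S)) choose rk" if S: "S \<in> facets" for S
  proof -
    have "finite S" "card S = rk" using S face_finite by (auto simp: facets_def)
    with card_bounded_sum_functions_positive[OF this(1) np] show ?thesis by simp
  qed
  show "finite ?Y" unfolding Y using facets_finite fin by blast
  have "card ?Y = (\<Sum>S\<in>facets. card (?Z S))"
    unfolding Y by (rule card_UN_disjoint) (use facets_finite fin disj in auto)
  also have "\<dots> = (\<Sum>S\<in>facets. (m + rk - card (negative_part q S)) choose rk)"
    by (rule sum.cong[OF refl cardZ])
  also have "\<dots> = (\<Sum>j\<in>{0..rk}. \<Sum>S\<in>{S \<in> facets. card (negative_part q S) = j}.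
      (m + rk - card (negative_part q S)) choose rk)"
  proof (rule sum.group[symmetric])
    show "(\<lambda>S. card (negative_part q S)) ` facets \<subseteq> {0..rk}"
      using card_mono[OF face_finite np] by (force simp: facets_def)
  qed (use facets_finite in auto)
  also have "\<dots> = (\<Sum>j=0..rk. h_num q j * ((m + rk - j) choose rk))"
    by (rule sum.cong) (simp_all add: h_num_def)
  finally show "card ?Y = (\<Sum>j=0..rk. h_num q j * ((m + rk - j) choose rk))" .
qed

end

section \<open>Unimodular configurations and the count of their lattice points\<close>

locale unimodular_configuration = symmetric_configuration +
  fixes \<Lambda> :: "'a set"
  assumes lattice_0: "0 \<in> \<Lambda>"
    and lattice_add: "x \<in> \<Lambda> \<Longrightarrow> y \<in> \<Lambda> \<Longrightarrow> x + y \<in> \<Lambda>"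
    and D_lattice: "set ds \<subseteq> \<Lambda>"
    and unimodular: "S \<subseteq> set ds \<Longrightarrow> independent S \<Longrightarrow> (\<Sum>a\<in>S. f a *\<^sub>R a) \<in> \<Lambda> \<Longrightarrow> a \<in> S \<Longrightarrow> f a \<in> \<int>"
begin

text \<open>The lattice points of the \<open>m\<close>-th dilate of the convex hull of
  \<open>0\<close> and \<open>D\<close>, phrased by flows so that the count involves no
  convexity.\<close>

definition lattice_ball :: "nat \<Rightarrow> 'a set" where
  "lattice_ball m = {x \<in> \<Lambda>. \<exists>y. flow y \<and> (\<forall>a. y a \<ge> 0) \<and> sum y D \<le> real m \<and> val y = x}"

lemma lattice_scale: "x \<in> \<Lambda> \<Longrightarrow> real n *\<^sub>R x \<in> \<Lambda>"
  by (induction n) (auto simp: lattice_0 lattice_add scaleR_left_distrib)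

lemma lattice_val: "val (\<lambda>a. real (y a)) \<in> \<Lambda>"
proof -
  have "(\<Sum>a\<in>A. real (y a) *\<^sub>R a) \<in> \<Lambda>" if "finite A" "A \<subseteq> D" for A
    using that by (induction A) (auto intro: lattice_0 lattice_add lattice_scale D_lattice[THEN subsetD])
  then show ?thesis by (simp add: val_def)
qed

lemma lattice_ball_bij:
  "bij_betw (\<lambda>y a. real (y a)) {y. face {a. y a \<noteq> 0} \<and> sum y D \<le> m}
     {y. face {a. y a \<noteq> 0} \<and> (\<forall>a. y a \<ge> 0) \<and> val y \<in> \<Lambda> \<and> sum y D \<le> real m}"
  (is "bij_betw ?f ?A ?B")
proof (rule bij_betwI')
  show "?f y = ?f y' \<longleftrightarrow> y = y'" for y y' by (auto simp: fun_eq_iff)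
  show "?f y \<in> ?B" if "y \<in> ?A" for y
    using that lattice_val by (auto simp flip: of_nat_sum)
  show "\<exists>y\<in>?A. x = ?f y" if "x \<in> ?B" for x
  proof -
    let ?S = "{a. x a \<noteq> 0}"
    have S: "face ?S" using that by simp
    have "x a \<in> \<int>" for a
    proof (cases "a \<in> ?S")
      case True
      have "val x = (\<Sum>a\<in>?S. x a *\<^sub>R a)"
        by (rule val_support) (use face_finite[OF S] faceD_carrier[OF S] in auto)
      then have "(\<Sum>a\<in>?S. x a *\<^sub>R a) \<in> \<Lambda>" using that by simp
      from unimodular[OF faceD_carrier[OF S] face_independent[OF S] this True] show ?thesis .
    qed simp
    then have "x a \<in> \<nat>" for a using that by (simp add: Nats_altdef2)
    then have eq: "x = ?f (\<lambda>a. nat \<lfloor>x a\<rfloor>)"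
      by (metis (mono_tags, lifting) Nats_cases floor_of_nat nat_int)
    define y where "y = (\<lambda>a. nat \<lfloor>x a\<rfloor>)"
    have xy: "x = (\<lambda>a. real (y a))" unfolding y_def by (rule eq)
    have "y \<in> ?A" using that unfolding xy by (simp flip: of_nat_sum)
    then show ?thesis using xy by blast
  qed
qed

text \<open>Any flow may be replaced by the face-supported one with the same value, whose weight is
  no larger.\<close>

lemma lattice_ball_eq:
  "lattice_ball m = val ` {y. face {a. y a \<noteq> 0} \<and> (\<forall>a. y a \<ge> 0) \<and> val y \<in> \<Lambda> \<and> sum y D \<le> real m}"
proof (intro equalityI subsetI)
  fix x assume "x \<in> lattice_ball m"
  then obtain y where y: "flow y" "\<forall>a. y a \<ge> 0" "sum y D \<le> real m" "val y = x" "x \<in> \<Lambda>"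
    by (auto simp: lattice_ball_def)
  have "x \<in> span D" using y(4) by (auto simp: val_def intro: span_sum span_scale span_base)
  from face_flow_exists[OF face_empty this] obtain y' where y': "flow y'" "val y' = x"
    "\<forall>a\<in>D. y' a \<ge> 0" "face {a. y' a \<noteq> 0}" by auto
  have "\<forall>a. y' a \<ge> 0" using y'(1,3) by (metis flow_def order_refl)
  moreover have "sum y' D \<le> real m" using face_flow_minimal[OF y'(4) y(1)] y y' by simp
  ultimately show "x \<in> val ` {y. face {a. y a \<noteq> 0} \<and> (\<forall>a. y a \<ge> 0) \<and> val y \<in> \<Lambda> \<and> sum y D \<le> real m}"
    using y y' by (intro image_eqI[of _ _ y']) auto
next
  fix x assume "x \<in> val ` {y. face {a. y a \<noteq> 0} \<and> (\<forall>a. y a \<ge> 0) \<and> val y \<in> \<Lambda> \<and> sum y D \<le> real m}"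
  then obtain y where y: "x = val y" "face {a. y a \<noteq> 0}" "\<forall>a. y a \<ge> 0" "val y \<in> \<Lambda>" "sum y D \<le> real m"
    by blast
  moreover have "flow y" using faceD_carrier[OF y(2)] by (auto simp: flow_def)
  ultimately show "x \<in> lattice_ball m" unfolding lattice_ball_def by blast
qed

lemma card_lattice_ball:
  assumes "generic q"
  shows "card (lattice_ball m) = (\<Sum>j=0..rk. h_num q j * ((m + rk - j) choose rk))"
proof -
  let ?B = "{y. face {a. y a \<noteq> 0} \<and> (\<forall>a. y a \<ge> 0) \<and> val y \<in> \<Lambda> \<and> sum y D \<le> real m}"
  have "inj_on val ?B"
  proof (rule inj_onI)
    fix y y' assume "y \<in> ?B" "y' \<in> ?B" "val y = val y'"
    then show "y = y'"
      by (intro face_flow_unique[of "{}"]) (auto simp: flow_def dest: faceD_carrier)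
  qed
  then have "card (lattice_ball m) = card ?B" by (simp add: lattice_ball_eq card_image)
  also have "\<dots> = card {y :: 'a \<Rightarrow> nat. face {a. y a \<noteq> 0} \<and> sum y D \<le> m}"
    using bij_betw_same_card[OF lattice_ball_bij] by simp
  finally show ?thesis using card_face_supported(2)[OF assms] by simp
qed

text \<open>The integer decomposition property: unimodularity turns the minimal flow of a lattice
  point into a combination with natural coefficients. The counts for small \<open>m\<close> rest on
  it.\<close>

lemma lattice_ball_nat:
  "lattice_ball m = {val (\<lambda>a. real (y a)) |y. (\<forall>a. a \<notin> D \<longrightarrow> y a = 0) \<and> sum y D \<le> m}"
proof (intro equalityI subsetI)
  fix x assume "x \<in> lattice_ball m"
  then have "x \<in> val ` (\<lambda>y a. real (y a)) ` {y. face {a. y a \<noteq> 0} \<and> sum y D \<le> m}"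
    unfolding lattice_ball_eq bij_betw_imp_surj_on[OF lattice_ball_bij[of m]] .
  then obtain y where "x = val (\<lambda>a. real (y a))" "face {a. y a \<noteq> 0}" "sum y D \<le> m"
    by blast
  then show "x \<in> {val (\<lambda>a. real (y a)) |y. (\<forall>a. a \<notin> D \<longrightarrow> y a = 0) \<and> sum y D \<le> m}"
    using faceD_carrier[of "{a. y a \<noteq> 0}"] by blast
next
  fix x assume "x \<in> {val (\<lambda>a. real (y a)) |y. (\<forall>a. a \<notin> D \<longrightarrow> y a = 0) \<and> sum y D \<le> m}"
  then obtain y where y: "x = val (\<lambda>a. real (y a))" "\<forall>a. a \<notin> D \<longrightarrow> y a = 0" "sum y D \<le> m" by blast
  show "x \<in> lattice_ball m"
    unfolding lattice_ball_def mem_Collect_eq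
  proof (intro conjI exI[of _ "\<lambda>a. real (y a)"])
    show "(\<Sum>a\<in>D. real (y a)) \<le> real m" using y(3) by (simp flip: of_nat_sum)
  qed (use y lattice_val in \<open>auto simp: flow_def\<close>)
qed

end

section \<open>Lattice points of symmetric edge polytopes\<close>

definition arcs :: "'n::finite set set \<Rightarrow> (real ^ 'n) set" where
  "arcs E = {axis i 1 - axis j 1 |i j. {i, j} \<in> E}"

abbreviation joins :: "'a set set \<Rightarrow> ('a \<times> 'a) set" where
  "joins F \<equiv> {(x, y). {x, y} \<in> F}"

lemma finite_arcs: "finite (arcs E)"
proof -
  have "arcs E \<subseteq> (\<lambda>(i, j). axis i 1 - axis j 1) ` UNIV" by (auto simp: arcs_def)
  then show ?thesis by (rule finite_subset) simp
qed

lemma arcs_mono: "F \<subseteq> E \<Longrightarrow> arcs F \<subseteq> arcs E"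
  by (auto simp: arcs_def)

lemma arcs_uminus: "a \<in> arcs E \<Longrightarrow> - a \<in> arcs E"
proof -
  assume "a \<in> arcs E"
  then obtain i j where "{i, j} \<in> E" "a = axis i 1 - axis j 1" by (auto simp: arcs_def)
  then have "{j, i} \<in> E" "- a = axis j 1 - axis i 1" by (simp_all add: insert_commute)
  then show "- a \<in> arcs E" unfolding arcs_def by blast
qed

text \<open>\<open>C\<close> is the set reachable from \<open>i\<close>. Every arc over
  \<open>F\<close> has both ends on one side of \<open>C\<close>, so the coordinate sum over
  \<open>C\<close> kills it, while \<open>i\<close> lies inside and \<open>j\<close>
  outside.\<close>

lemma separating_cut:
  assumes "(i, j) \<notin> (joins F)\<^sup>*"
  obtains \<phi> :: "real ^ 'n::finite \<Rightarrow> real" and C where "linear \<phi>" "\<forall>x. \<phi> x = (\<Sum>w\<in>C. x $ w)"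
    "\<forall>a\<in>arcs F. \<phi> a = 0" "\<phi> (axis i 1 - axis j 1) = 1"
proof -
  define C where "C = {w. (i, w) \<in> (joins F)\<^sup>*}"
  define \<phi> where "\<phi> = (\<lambda>x :: real ^ 'n. \<Sum>w\<in>C. x $ w)"
  have lin: "linear \<phi>"
    by (rule linearI) (simp_all add: \<phi>_def sum.distrib sum_distrib_left)
  have \<phi>_axis: "\<phi> (axis x 1) = (if x \<in> C then 1 else 0)" for x
    by (simp add: \<phi>_def axis_def sum.delta)
  have "\<phi> a = 0" if "a \<in> arcs F" for a
  proof -
    from that obtain x y where xy: "{x, y} \<in> F" "a = axis x 1 - axis y 1" by (auto simp: arcs_def)
    then have "x \<in> C \<longleftrightarrow> y \<in> C"
      unfolding C_def by (auto intro: rtrancl_into_rtrancl simp: insert_commute)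
    with xy show ?thesis by (simp add: linear_diff[OF lin] \<phi>_axis)
  qed
  moreover have "i \<in> C" "j \<notin> C" using assms by (auto simp: C_def)
  then have "\<phi> (axis i 1 - axis j 1) = 1" by (simp add: linear_diff[OF lin] \<phi>_axis)
  moreover have "\<phi> x = (\<Sum>w\<in>C. x $ w)" for x by (simp add: \<phi>_def)
  ultimately show thesis using that lin by blast
qed

lemma span_arcs_iff:
  "axis i 1 - axis j 1 \<in> span (arcs F) \<longleftrightarrow> (i, j) \<in> (joins F)\<^sup>*" (is "?L \<longleftrightarrow> ?R")
proof
  assume ?R
  then show ?L
  proof (induction rule: rtrancl_induct)
    case base
    show ?case by (simp add: span_zero)
  next
    case (step y z)
    then have "axis y 1 - axis z 1 \<in> span (arcs F)"
      by (intro span_base) (auto simp: arcs_def)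
    from span_add[OF step.IH this] show ?case by simp
  qed
next
  assume L: ?L
  show ?R
  proof (rule ccontr)
    assume "\<not> ?R"
    then obtain \<phi> :: "real ^ 'a \<Rightarrow> real" and C where \<phi>: "linear \<phi>" "\<forall>x. \<phi> x = (\<Sum>w\<in>C. x $ w)"
      "\<forall>a\<in>arcs F. \<phi> a = 0" "\<phi> (axis i 1 - axis j 1) = 1" by (rule separating_cut)
    from linear_eq_0_on_span[OF \<phi>(1) _ L] \<phi>(3,4) show False by simp
  qed
qed

text \<open>The coefficient of an arc is read off by summing coordinates over one side of the cut
  that the arc defines.\<close>

lemma arcs_unimodular:
  assumes S: "S \<subseteq> arcs E" "independent S" "\<forall>i. (\<Sum>a\<in>S. f a *\<^sub>R a) $ i \<in> \<int>" and a: "a \<in> S"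
  shows "f a \<in> \<int>"
proof -
  obtain i j where ij: "{i, j} \<in> E" "a = axis i 1 - axis j 1" using S a by (auto simp: arcs_def)
  \<comment> \<open>The edges underlying the other arcs of \<open>S\<close>. Independence keeps
    \<open>a\<close> out of their span, so they leave its ends disconnected and a cut isolates the
    coefficient of \<open>a\<close>.\<close>
  define F where "F = {{x, y} |x y. axis x 1 - axis y 1 \<in> S - {a}}"
  have "arcs F \<subseteq> span (S - {a})"
  proof
    fix b assume "b \<in> arcs F"
    then obtain x y x' y' where xy: "b = axis x 1 - axis y 1" "{x, y} = {x', y'}"
      "axis x' 1 - axis y' 1 \<in> S - {a}" by (auto simp: arcs_def F_def)
    then have "b = axis x' 1 - axis y' 1 \<or> b = - (axis x' 1 - axis y' 1)"
      by (auto simp: doubleton_eq_iff)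
    with xy(3) show "b \<in> span (S - {a})" using span_base span_neg by metis
  qed
  then have "span (arcs F) \<subseteq> span (S - {a})" by (simp add: span_minimal)
  then have "a \<notin> span (arcs F)" using S(2) a by (auto simp: dependent_def)
  then have "(i, j) \<notin> (joins F)\<^sup>*" using ij span_arcs_iff by blast
  then obtain \<phi> :: "real ^ 'a \<Rightarrow> real" and C where \<phi>: "linear \<phi>" "\<forall>x. \<phi> x = (\<Sum>w\<in>C. x $ w)"
    "\<forall>a\<in>arcs F. \<phi> a = 0" "\<phi> (axis i 1 - axis j 1) = 1" by (rule separating_cut)
  have \<phi>0: "\<phi> b = 0" if b: "b \<in> S - {a}" for b
  proof -
    obtain x y where xy: "b = axis x 1 - axis y 1" using b S(1) by (auto simp: arcs_def)
    then have "{x, y} \<in> F" using b by (auto simp: F_def)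
    then have "b \<in> arcs F" unfolding arcs_def xy by blast
    then show ?thesis using \<phi>(3) by blast
  qed
  have fin: "finite S" using S(1) finite_arcs finite_subset by blast
  have "\<phi> (\<Sum>a\<in>S. f a *\<^sub>R a) = (\<Sum>b\<in>S. f b * \<phi> b)"
    by (simp add: linear_sum[OF \<phi>(1)] linear_scale[OF \<phi>(1)])
  also have "\<dots> = f a * \<phi> a + (\<Sum>b\<in>S - {a}. f b * \<phi> b)"
    using fin a by (simp add: sum.remove)
  also have "\<dots> = f a" using \<phi>0 \<phi>(4) by (simp add: ij)
  finally have "f a = (\<Sum>w\<in>C. (\<Sum>a\<in>S. f a *\<^sub>R a) $ w)" using \<phi>(2) by metis
  also have "\<dots> \<in> \<int>" using S(3) by (intro Ints_sum) blast
  finally show ?thesis .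
qed

section \<open>Arcs as a unimodular configuration, and the dilates of the polytope\<close>

abbreviation int_lattice :: "(real ^ 'n) set" where
  "int_lattice \<equiv> {x. \<forall>i. x $ i \<in> \<int>}"

lemma arcs_list:
  obtains ds where "set ds = arcs (E :: 'n::finite set set)" "unimodular_configuration ds int_lattice"
proof -
  obtain ds where ds: "set ds = arcs E" using finite_list[OF finite_arcs] by blast
  have "unimodular_configuration ds int_lattice"
  proof
    show "- a \<in> set ds" if "a \<in> set ds" for a using that arcs_uminus ds by blast
    show "set ds \<subseteq> int_lattice" by (auto simp: ds arcs_def axis_def)
    show "f a \<in> \<int>" if "S \<subseteq> set ds" "independent S" "(\<Sum>a\<in>S. f a *\<^sub>R a) \<in> int_lattice" "a \<in> S"
      for S :: "(real ^ 'n) set" and f a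
      by (rule arcs_unimodular[of S E f a]) (use that ds in auto)
  qed auto
  with ds that show ?thesis by blast
qed

lemma zero_notin_arcs:
  assumes "\<forall>e\<in>E. card e = 2"
  shows "0 \<notin> arcs E"
proof
  assume "0 \<in> arcs E"
  then obtain i j :: 'a where "{i, j} \<in> E" "axis i (1 :: real) = axis j 1"
    by (auto simp: arcs_def)
  with assms show False by (auto simp: axis_eq_axis)
qed

text \<open>An arc and its negative have midpoint zero. Adjoining \<open>0\<close> also absorbs the
  separate convention for the empty graph.\<close>

lemma sym_edge_polytope_eq:
  assumes "\<forall>e\<in>E. card e = 2"
  shows "sym_edge_polytope E = convex hull (insert 0 (arcs E))"
proof (cases "E = {}")
  case True
  then show ?thesis by (simp add: sym_edge_polytope_def arcs_def)
next
  case False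
  then obtain i j where "{i, j} \<in> E" using assms by (metis all_not_in_conv card_2_iff)
  then obtain a where a: "a \<in> arcs E" by (auto simp: arcs_def)
  have "(1 / 2) *\<^sub>R a + (1 / 2) *\<^sub>R (- a) \<in> convex hull (arcs E)"
    by (rule convexD[OF convex_convex_hull]) (use a arcs_uminus in \<open>auto intro: hull_inc\<close>)
  then have "0 \<in> convex hull (arcs E)" by simp
  then have "convex hull (insert 0 (arcs E)) = convex hull (arcs E)" by (rule hull_redundant)
  then show ?thesis using False by (simp add: sym_edge_polytope_def arcs_def)
qed

lemma poly_dim_sym_edge_polytope:
  assumes "\<forall>e\<in>E. card e = 2"
  shows "poly_dim (sym_edge_polytope E) = dim (arcs E)"
proof -
  have "dim (insert 0 (arcs E)) = dim (arcs E)" by (metis dim_span span_insert_0)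
  then show ?thesis
    unfolding poly_dim_def sym_edge_polytope_eq[OF assms] aff_dim_convex_hull
    by (subst aff_dim_zero) (auto intro: hull_inc)
qed

lemma scaled_polytope_lattice_points:
  assumes E: "\<forall>e\<in>E. card e = 2" and ds: "set ds = arcs E" "unimodular_configuration ds int_lattice"
  shows "(\<lambda>x. real m *\<^sub>R x) ` sym_edge_polytope E \<inter> int_lattice =
    unimodular_configuration.lattice_ball ds int_lattice m"
proof -
  interpret unimodular_configuration ds int_lattice by (rule ds)
  have 0: "0 \<notin> D" using zero_notin_arcs[OF E] ds by simp
  have hull: "sym_edge_polytope E =
      {\<Sum>v\<in>insert 0 D. u v *\<^sub>R v |u. (\<forall>v\<in>insert 0 D. 0 \<le> u v) \<and> sum u (insert 0 D) = 1}"
    unfolding sym_edge_polytope_eq[OF E] ds(1)[symmetric]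
    by (subst convex_hull_finite) auto
  have "(\<lambda>x. real m *\<^sub>R x) ` sym_edge_polytope E =
      {x. \<exists>y. flow y \<and> (\<forall>a. y a \<ge> 0) \<and> sum y D \<le> real m \<and> val y = x}"
  proof (intro equalityI subsetI)
    fix x assume "x \<in> (\<lambda>x. real m *\<^sub>R x) ` sym_edge_polytope E"
    then obtain u where u: "\<forall>v\<in>insert 0 D. 0 \<le> u v" "sum u (insert 0 D) = 1"
      "x = real m *\<^sub>R (\<Sum>v\<in>insert 0 D. u v *\<^sub>R v)" unfolding hull by blast
    define y where "y = (\<lambda>a. if a \<in> D then real m * u a else 0)"
    have "sum u D \<le> 1" using u 0 by simp
    then have "real m * sum u D \<le> real m" using mult_left_mono[of "sum u D" 1 "real m"] by simp
    moreover have "val y = x" using u(3) 0 by (simp add: val_def y_def scaleR_sum_right)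
    ultimately show "x \<in> {x. \<exists>y. flow y \<and> (\<forall>a. y a \<ge> 0) \<and> sum y D \<le> real m \<and> val y = x}"
      using u(1) by (auto intro!: exI[of _ y] simp: y_def flow_def sum_distrib_left)
  next
    fix x assume "x \<in> {x. \<exists>y. flow y \<and> (\<forall>a. y a \<ge> 0) \<and> sum y D \<le> real m \<and> val y = x}"
    then obtain y where y: "flow y" "\<forall>a. y a \<ge> 0" "sum y D \<le> real m" "val y = x" by blast
    have z: "(\<Sum>v\<in>insert 0 D. u v *\<^sub>R v) \<in> sym_edge_polytope E"
      if "\<forall>v\<in>insert 0 D. 0 \<le> u v" "sum u (insert 0 D) = 1" for u
      unfolding hull using that by blast
    define s where "s = sum (\<lambda>a. y a / real m) D"
    define u where "u = (\<lambda>a. if a = 0 then 1 - s else y a / real m)"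
    have uD: "sum u D = s" unfolding s_def by (rule sum.cong) (use 0 in \<open>auto simp: u_def\<close>)
    have "s \<le> 1" using y(3) by (cases "m = 0") (auto simp: s_def simp flip: sum_divide_distrib)
    then have "(\<Sum>v\<in>insert 0 D. u v *\<^sub>R v) \<in> sym_edge_polytope E"
      using y(2) uD 0 by (intro z) (auto simp: u_def)
    moreover have "x = real m *\<^sub>R (\<Sum>v\<in>insert 0 D. u v *\<^sub>R v)"
    proof (cases "m = 0")
      case True
      then have "sum y D = 0" using y sum_nonneg[of D y] by simp
      then have "\<forall>a\<in>D. y a = 0" using y(2) by (simp add: sum_nonneg_eq_0_iff)
      then have "val y = 0" by (simp add: val_def)
      with True y(4) show ?thesis by simp
    next
      case False
      have "real m *\<^sub>R (\<Sum>v\<in>insert 0 D. u v *\<^sub>R v) = (\<Sum>v\<in>D. (real m * u v) *\<^sub>R v)"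
        using 0 by (simp add: scaleR_sum_right)
      also have "\<dots> = val y"
        unfolding val_def by (rule sum.cong) (use 0 False in \<open>auto simp: u_def\<close>)
      finally show ?thesis using y(4) by simp
    qed
    ultimately show "x \<in> (\<lambda>x. real m *\<^sub>R x) ` sym_edge_polytope E" by blast
  qed
  then show ?thesis by (auto simp: lattice_ball_def)
qed

text \<open>Evaluation at \<open>m = j\<close> gives a triangular system: terms with index above
  \<open>j\<close> vanish and the term \<open>j\<close> has coefficient 1.\<close>

lemma h_star_unique:
  assumes "is_h_star_vector P h" "is_h_star_vector P h'"
  shows "h = h'"
proof
  fix j
  define d where "d = poly_dim P"
  have z: "k > d \<Longrightarrow> h k = 0 \<and> h' k = 0" for k
    using assms by (simp add: is_h_star_vector_def Let_def d_def)
  have eq: "(\<Sum>j=0..d. h j * int ((m + d - j) choose d)) = (\<Sum>j=0..d. h' j * int ((m + d - j) choose d))"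
    for m using assms by (metis is_h_star_vector_def d_def)
  show "h j = h' j"
  proof (induction j rule: less_induct)
    case (less j)
    show ?case
    proof (cases "j \<le> d")
      case True
      have split: "(\<Sum>k=0..d. g k * int ((j + d - k) choose d)) =
          (\<Sum>k=0..<j. g k * int ((j + d - k) choose d)) + g j" for g :: "nat \<Rightarrow> int"
      proof -
        have "(\<Sum>k=0..d. g k * int ((j + d - k) choose d)) =
            (\<Sum>k\<in>insert j {0..<j}. g k * int ((j + d - k) choose d))"
          by (rule sum.mono_neutral_right) (use True in \<open>auto simp: binomial_eq_0\<close>)
        then show ?thesis by simp
      qed
      have "(\<Sum>k=0..<j. h k * int ((j + d - k) choose d)) = (\<Sum>k=0..<j. h' k * int ((j + d - k) choose d))"
        by (rule sum.cong) (use less.IH in auto)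
      with eq[of j] show ?thesis by (simp add: split)
    qed (use z in simp)
  qed
qed

lemma h_star_palindromic:
  assumes E: "\<forall>e\<in>E. card e = 2"
  obtains h where "is_h_star_vector (sym_edge_polytope E) h"
    "\<And>j. j \<le> dim (arcs E) \<Longrightarrow> h (dim (arcs E) - j) = h j"
proof -
  obtain ds where ds: "set ds = arcs E" "unimodular_configuration ds int_lattice"
    by (rule arcs_list)
  interpret unimodular_configuration ds int_lattice by (rule ds)
  have d: "poly_dim (sym_edge_polytope E) = rk"
    by (simp add: poly_dim_sym_edge_polytope[OF E] rk_def ds)
  have count: "ehrhart_count (sym_edge_polytope E) m = card (lattice_ball m)" for m
    by (simp add: ehrhart_count_def scaled_polytope_lattice_points[OF E ds])
  define h where "h = (\<lambda>q j. if j \<le> rk then int (h_num q j) else 0)"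
  have h: "is_h_star_vector (sym_edge_polytope E) (h q)" if "generic q" for q
    unfolding is_h_star_vector_def d
    by (simp add: h_def count card_lattice_ball[OF that])
  obtain q where q: "generic q" using ex_generic ..
  have "h q = h (- q)" using h_star_unique[OF h[OF q] h[OF generic_uminus[OF q]]] .
  then have "h q (rk - j) = h q j" if "j \<le> rk" for j
    using h_num_uminus[OF q that] that by (metis h_def diff_le_self)
  with that[OF h[OF q]] show ?thesis by (simp add: rk_def ds)
qed

section \<open>Ehrhart counts of the first three dilates\<close>

definition sums2 :: "'n::finite set set \<Rightarrow> (real ^ 'n) set" where
  "sums2 E = {a + b |a b. a \<in> insert 0 (arcs E) \<and> b \<in> insert 0 (arcs E)}"

lemma ehrhart_count_small:
  assumes E: "\<forall>e\<in>E. card e = 2"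
  shows "ehrhart_count (sym_edge_polytope E) 0 = 1"
    and "ehrhart_count (sym_edge_polytope E) 1 = 1 + card (arcs E)"
    and "ehrhart_count (sym_edge_polytope E) 2 = card (sums2 E)"
proof -
  obtain ds where ds: "set ds = arcs E" "unimodular_configuration ds int_lattice"
    by (rule arcs_list)
  interpret unimodular_configuration ds int_lattice by (rule ds)
  have count: "ehrhart_count (sym_edge_polytope E) m = card (lattice_ball m)" for m
    by (simp add: ehrhart_count_def scaled_polytope_lattice_points[OF E ds])
  define B where "B = (\<lambda>m. {y :: real ^ 'a \<Rightarrow> nat. (\<forall>a. a \<notin> D \<longrightarrow> y a = 0) \<and> sum y D \<le> m})"
  define v where "v = (\<lambda>y :: real ^ 'a \<Rightarrow> nat. val (\<lambda>a. real (y a)))"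
  have ball: "lattice_ball m = v ` B m" for m
    unfolding lattice_ball_nat B_def v_def by blast
  have B0: "B 0 = {\<lambda>_. 0}" by (auto simp: B_def fun_eq_iff)
  have v0: "v (\<lambda>_. 0) = 0" by (simp add: v_def val_def)
  have vup: "v (y(a := Suc (y a))) = v y + a" if "a \<in> D" for y a
    using that by (simp add: v_def val_def sum.remove[of D a] scaleR_left_distrib)
  have up: "y(a := Suc (y a)) \<in> B (Suc m)" if "a \<in> D" "y \<in> B m" for y a m
    using that by (auto simp: B_def sum.remove[of D a])
  have down: "y(a := y a - 1) \<in> B m" "y = (y(a := y a - 1))(a := Suc ((y(a := y a - 1)) a))"
    if "a \<in> D" "y \<in> B (Suc m)" "y a > 0" for y a m
    using that by (auto simp: B_def sum.remove[of D a])
  have mono: "B m \<subseteq> B (Suc m)" for m by (auto simp: B_def)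
  \<comment> \<open>One more unit of weight means adding one more element of \<open>D\<close> or
    nothing; starting from the zero vector this yields the sets for 1 and 2.\<close>
  have step: "v ` B (Suc m) = {x + a |x a. x \<in> v ` B m \<and> a \<in> insert 0 D}" for m
  proof (intro equalityI subsetI)
    fix x assume "x \<in> v ` B (Suc m)"
    then obtain y where y: "y \<in> B (Suc m)" "x = v y" by blast
    show "x \<in> {x + a |x a. x \<in> v ` B m \<and> a \<in> insert 0 D}"
    proof (cases "\<exists>a\<in>D. y a > 0")
      case True
      then obtain a where a: "a \<in> D" "y a > 0" by blast
      have "x = v (y(a := y a - 1)) + a"
        using vup[OF a(1), of "y(a := y a - 1)"] down(2)[OF a(1) y(1) a(2)] y(2) by metis
      then show ?thesis using down(1)[OF a(1) y(1) a(2)] a(1) by blast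
    next
      case False
      then have "y \<in> B m" using y(1) by (auto simp: B_def)
      then have "x = v y + 0" "v y \<in> v ` B m" using y(2) by auto
      then show ?thesis by blast
    qed
  next
    fix x assume "x \<in> {x + a |x a. x \<in> v ` B m \<and> a \<in> insert 0 D}"
    then obtain y a where y: "y \<in> B m" "x = v y + a" "a \<in> insert 0 D" by blast
    show "x \<in> v ` B (Suc m)"
    proof (cases "a \<in> D")
      case True
      then show ?thesis using up[OF True y(1)] vup[OF True, of y] y(2) by (metis imageI)
    next
      case False
      with y mono show ?thesis by auto
    qed
  qed
  have l0: "v ` B 0 = {0}" by (simp add: B0 v0)
  have l1: "v ` B 1 = insert 0 D" using step[of 0] l0 by auto
  have l2: "v ` B 2 = sums2 E" using step[of 1] l1 by (simp add: sums2_def ds numeral_2_eq_2)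
  show "ehrhart_count (sym_edge_polytope E) 0 = 1" by (simp add: count ball l0)
  show "ehrhart_count (sym_edge_polytope E) 1 = 1 + card (arcs E)"
    unfolding count ball l1 using zero_notin_arcs[OF E] by (simp add: ds finite_arcs)
  show "ehrhart_count (sym_edge_polytope E) 2 = card (sums2 E)" by (simp add: count ball l2)
qed

section \<open>The \<open>\<gamma>\<close>-vector\<close>

lemma coeff_one_plus_x_power: "coeff ([:1, 1:] ^ n :: int poly) k = int (n choose k)"
proof (induction n arbitrary: k)
  case 0
  then show ?case by (cases k) auto
next
  case (Suc n)
  then show ?case by (cases k) (auto simp: coeff_pCons)
qed

text \<open>Subtracting \<open>h 0 * (1 + t)^d\<close> leaves a palindromic polynomial without
  constant and leading term. Dividing by \<open>t\<close> gives the vector \<open>h'\<close> for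
  \<open>d - 2\<close>, whose expansion supplies the later entries.\<close>

lemma gamma_expansion_exists:
  fixes h :: "nat \<Rightarrow> int"
  assumes "\<And>j. j \<le> d \<Longrightarrow> h (d - j) = h j"
  shows "\<exists>g. (\<forall>i>d div 2. g i = 0) \<and>
    (\<Sum>i=0..d div 2. monom (g i) i * [:1, 1:] ^ (d - 2 * i)) = (\<Sum>j=0..d. monom (h j) j)"
  using assms
proof (induction d arbitrary: h rule: less_induct)
  case (less d)
  consider "d = 0" | "d = 1" | k where "d = Suc (Suc k)" by (metis One_nat_def not0_implies_Suc)
  then show ?case
  proof cases
    case 1
    then show ?thesis by (intro exI[of _ "\<lambda>i. if i = 0 then h 0 else 0"]) simp
  next
    case 2
    then have "h 1 = h 0" using less.prems[of 0] by simp
    with 2 show ?thesis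
      by (intro exI[of _ "\<lambda>i. if i = 0 then h 0 else 0"]) (simp add: monom_altdef)
  next
    case 3
    define h' where "h' = (\<lambda>j. h (Suc j) - h 0 * int (d choose Suc j))"
    have "h' (k - j) = h' j" if "j \<le> k" for j
    proof -
      have e: "Suc (k - j) = d - Suc j" "Suc j \<le> d" using that 3 by auto
      show ?thesis unfolding h'_def e(1) using less.prems[OF e(2)] binomial_symmetric[OF e(2)] by simp
    qed
    with less.IH[of k h'] 3 obtain g where g: "\<forall>i>k div 2. g i = 0"
      "(\<Sum>i=0..k div 2. monom (g i) i * [:1, 1:] ^ (k - 2 * i)) = (\<Sum>j=0..k. monom (h' j) j)"
      by auto
    define G where "G = (\<lambda>i. case i of 0 \<Rightarrow> h 0 | Suc i \<Rightarrow> g i)"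
    have d2: "d div 2 = Suc (k div 2)" using 3 by simp
    have "(\<Sum>i=0..d div 2. monom (G i) i * [:1, 1:] ^ (d - 2 * i)) =
        monom (h 0) 0 * [:1, 1:] ^ d + (\<Sum>i=0..k div 2. monom (g i) (Suc i) * [:1, 1:] ^ (k - 2 * i))"
      unfolding d2 using 3 by (simp add: sum.atLeast0_atMost_Suc_shift G_def del: sum.cl_ivl_Suc)
    also have "(\<Sum>i=0..k div 2. monom (g i) (Suc i) * [:1, 1:] ^ (k - 2 * i)) =
        monom 1 1 * (\<Sum>j=0..k. monom (h' j) j)"
      unfolding g(2)[symmetric] sum_distrib_left by (simp add: mult_monom flip: mult.assoc)
    also have "\<dots> = (\<Sum>j=0..k. monom (h' j) (Suc j))"
      by (simp add: sum_distrib_left mult_monom)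
    also have "monom (h 0) 0 * [:1, 1:] ^ d + (\<Sum>j=0..k. monom (h' j) (Suc j)) = (\<Sum>j=0..d. monom (h j) j)"
    proof (rule poly_eqI)
      fix n
      have hd: "h d = h 0" using less.prems[of 0] by simp
      have c: "coeff (\<Sum>j=0..m. monom (f j) j) n = (if n \<le> m then f n else 0)" for f :: "nat \<Rightarrow> int" and m n
        by (simp add: coeff_sum coeff_monom sum.delta)
      have c': "coeff (\<Sum>j=0..k. monom (h' j) (Suc j)) n = (if n \<ge> 1 \<and> n \<le> Suc k then h' (n - 1) else 0)"
        by (cases n) (auto simp: coeff_sum coeff_monom sum.delta)
      have "coeff (monom (h 0) 0 * [:1, 1:] ^ d) n = h 0 * int (d choose n)"
        by (simp add: coeff_monom_mult coeff_one_plus_x_power)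
      then show "coeff (monom (h 0) 0 * [:1, 1:] ^ d + (\<Sum>j=0..k. monom (h' j) (Suc j))) n =
          coeff (\<Sum>j=0..d. monom (h j) j) n"
        unfolding coeff_add c c' using 3 hd by (cases n) (auto simp: h'_def not_le binomial_eq_0 le_Suc_eq)
    qed
    finally have "(\<Sum>i=0..d div 2. monom (G i) i * [:1, 1:] ^ (d - 2 * i)) = (\<Sum>j=0..d. monom (h j) j)" .
    moreover have "\<forall>i>d div 2. G i = 0" using g(1) d2 by (auto simp: G_def split: nat.split)
    ultimately show ?thesis by blast
  qed
qed

lemma gamma_expansion_coeff:
  fixes g h :: "nat \<Rightarrow> int"
  assumes "(\<Sum>i=0..d div 2. monom (g i) i * [:1, 1:] ^ (d - 2 * i)) = (\<Sum>j=0..d. monom (h j) j)"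
    and "n \<le> d div 2"
  shows "h n = (\<Sum>i=0..<n. g i * int ((d - 2 * i) choose (n - i))) + g n"
proof -
  have "h n = coeff (\<Sum>j=0..d. monom (h j) j) n"
    using assms(2) by (simp add: coeff_sum coeff_monom sum.delta)
  also have "\<dots> = (\<Sum>i=0..d div 2. if n < i then 0 else g i * int ((d - 2 * i) choose (n - i)))"
    unfolding assms(1)[symmetric]
    by (simp add: coeff_sum coeff_monom_mult coeff_one_plus_x_power cong: if_cong)
  also have "\<dots> = (\<Sum>i\<in>insert n {0..<n}. g i * int ((d - 2 * i) choose (n - i)))"
    by (rule sum.mono_neutral_cong_right) (use assms(2) in auto)
  finally show ?thesis by simp
qed

lemma gamma_vector_unique:
  assumes "is_gamma_vector P g" "is_gamma_vector P g'"
  shows "g = g'"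
proof
  fix i
  show "g i = g' i"
  proof (induction i rule: less_induct)
    case (less i)
    show ?case
    proof (cases "i \<le> poly_dim P div 2")
      case True
      have "h_star P i = (\<Sum>k=0..<i. g k * int ((poly_dim P - 2 * k) choose (i - k))) + g i"
        "h_star P i = (\<Sum>k=0..<i. g' k * int ((poly_dim P - 2 * k) choose (i - k))) + g' i"
        using assms gamma_expansion_coeff[OF _ True] by (simp_all add: is_gamma_vector_def Let_def)
      moreover have "(\<Sum>k=0..<i. g k * int ((poly_dim P - 2 * k) choose (i - k))) =
          (\<Sum>k=0..<i. g' k * int ((poly_dim P - 2 * k) choose (i - k)))"
        by (rule sum.cong) (use less.IH in auto)
      ultimately show ?thesis by simp
    qed (use assms in \<open>simp add: is_gamma_vector_def Let_def\<close>)
  qed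
qed

text \<open>For \<open>d \<ge> 4\<close> the equations for \<open>h 1\<close> and \<open>h 2\<close>
  are solved. For smaller \<open>d\<close> the entry is zero by convention, and palindromicity makes
  the right-hand side zero too, so one formula serves all dimensions.\<close>

lemma gamma_2_eq_h_star:
  assumes h: "is_h_star_vector P h" and pal: "\<And>j. j \<le> poly_dim P \<Longrightarrow> h (poly_dim P - j) = h j"
    and h0: "h 0 = 1"
  shows "gamma P 2 = h 2 - (int (poly_dim P) - 2) * (h 1 - int (poly_dim P)) - int (poly_dim P choose 2)"
proof -
  define d where "d = poly_dim P"
  have star: "h_star P = h" unfolding h_star_def using h h_star_unique by blast
  obtain g where "is_gamma_vector P g"
    using gamma_expansion_exists[of d h] pal by (auto simp: is_gamma_vector_def Let_def star d_def)
  then have "is_gamma_vector P (gamma P)" unfolding gamma_def by (metis theI gamma_vector_unique)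
  then have g: "\<forall>i>d div 2. gamma P i = 0"
    "(\<Sum>i=0..d div 2. monom (gamma P i) i * [:1, 1:] ^ (d - 2 * i)) = (\<Sum>j=0..d. monom (h j) j)"
    by (simp_all add: is_gamma_vector_def Let_def star d_def)
  note coeff = gamma_expansion_coeff[OF g(2)]
  have zero: "h j = 0" if "j > d" for j using h that by (simp add: is_h_star_vector_def Let_def d_def)
  consider "d \<ge> 4" | "d = 0" | "d = 1" | "d = 2" | "d = 3" by linarith
  then show ?thesis unfolding d_def[symmetric]
  proof cases
    case 1
    have "0 \<le> d div 2" "1 \<le> d div 2" "2 \<le> d div 2" using 1 by linarith+
    then have "h 1 = h 0 * int d + gamma P 1" "h 2 = h 0 * int (d choose 2) + gamma P 1 * int (d - 2) + gamma P 2"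
      using coeff[of 0] coeff[of 1] coeff[of 2] by (simp_all add: eval_nat_numeral)
    with 1 h0 show "gamma P 2 = h 2 - (int d - 2) * (h 1 - int d) - int (d choose 2)"
      by (simp add: algebra_simps of_nat_diff)
  next
    case 2
    with g(1) zero show "gamma P 2 = h 2 - (int d - 2) * (h 1 - int d) - int (d choose 2)" by simp
  next
    case 3
    with g(1) zero[of 2] pal[of 0] h0 show "gamma P 2 = h 2 - (int d - 2) * (h 1 - int d) - int (d choose 2)"
      by (simp add: d_def)
  next
    case 4
    have "gamma P 2 = 0" using coeff[of 0] coeff[of 1] g(1) 4 by simp
    with 4 pal[of 0] h0 show "gamma P 2 = h 2 - (int d - 2) * (h 1 - int d) - int (d choose 2)"
      by (simp add: d_def)
  next
    case 5
    then have "gamma P 2 = 0" "h 2 = h 1" using g(1) pal[of 1] by (simp_all add: d_def)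
    with 5 show "gamma P 2 = h 2 - (int d - 2) * (h 1 - int d) - int (d choose 2)"
      by (simp add: choose_two)
  qed
qed

lemma gamma_2_sym_edge_polytope:
  fixes E :: "'n::finite set set"
  assumes E: "\<forall>e\<in>E. card e = 2"
  defines "d \<equiv> int (dim (arcs E))" and "a \<equiv> int (card (arcs E))"
  shows "gamma (sym_edge_polytope E) 2 =
    int (card (sums2 E)) - (d + 1) * (1 + a) + d - (d - 2) * (a - 2 * d)"
proof -
  let ?P = "sym_edge_polytope E" and ?d = "dim (arcs E)"
  have pd: "poly_dim ?P = ?d" by (rule poly_dim_sym_edge_polytope[OF E])
  obtain h where h: "is_h_star_vector ?P h" "\<And>j. j \<le> ?d \<Longrightarrow> h (?d - j) = h j"
    by (rule h_star_palindromic[OF E]) blast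
  have z: "\<And>j. j > ?d \<Longrightarrow> h j = 0"
    and L: "int (ehrhart_count ?P m) = (\<Sum>j=0..?d. h j * int ((m + ?d - j) choose ?d))" for m
    using h(1) by (simp_all add: is_h_star_vector_def Let_def pd)
  \<comment> \<open>The binomials with index above \<open>m\<close> vanish, and so does
    \<open>h\<close> above the dimension; the sum may be cut at \<open>m\<close> in either
    case.\<close>
  have L': "int (ehrhart_count ?P m) = (\<Sum>j=0..m. h j * int ((m + ?d - j) choose ?d))" for m
    unfolding L by (rule sum.mono_neutral_cong) (use z in \<open>auto simp: binomial_eq_0\<close>)
  have h0: "h 0 = 1" using L'[of 0] ehrhart_count_small(1)[OF E] by simp
  have h1: "h 1 = a - d"
    using L'[of 1] ehrhart_count_small(2)[OF E] h0 by (simp add: a_def d_def)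
  have c2: "int ((?d + 2) choose 2) = int (?d choose 2) + 2 * d + 1"
    by (simp add: numeral_2_eq_2 d_def)
  have "((2 + ?d) choose ?d) = (?d + 2) choose 2"
    using binomial_symmetric[of ?d "2 + ?d"] by (simp add: add.commute)
  then have "int (card (sums2 E)) = h 0 * int ((2 + ?d) choose 2) + h 1 * (d + 1) + h 2"
    using L'[of 2] ehrhart_count_small(3)[OF E] by (simp add: atLeast0_atMost_Suc eval_nat_numeral d_def)
  then have "int (card (sums2 E)) = int ((?d + 2) choose 2) + h 1 * (d + 1) + h 2"
    by (simp add: h0 add.commute)
  then have h2: "h 2 = int (card (sums2 E)) - (int (?d choose 2) + 2 * d + 1) - (a - d) * (d + 1)"
    unfolding c2 h1 by simp
  have "gamma ?P 2 = h 2 - (d - 2) * (h 1 - d) - int (?d choose 2)"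
    using gamma_2_eq_h_star[OF h(1)] h(2) h0 by (simp add: pd d_def)
  moreover have "2 * int (n choose 2) = int n * (int n - 1)" for n
    by (induction n) (simp_all add: numeral_2_eq_2 algebra_simps)
  ultimately show ?thesis unfolding h2 h1 d_def
    by (simp add: algebra_simps)
qed

section \<open>Deleting an edge\<close>

definition nbrs :: "'a set set \<Rightarrow> 'a \<Rightarrow> 'a set" where
  "nbrs F u = {w. {u, w} \<in> F}"

abbreviation unit_vec :: "'n::finite \<Rightarrow> real ^ 'n" where
  "unit_vec i \<equiv> axis i 1"

lemma sum_mset_axis_nth: "(\<Sum>x\<in>#M. unit_vec x) $ w = real (count M w)"
  by (induction M) (auto simp: axis_def)

text \<open>Once all minus signs are moved across, an identity between sums of arcs becomes an
  equality of multisets of vertices, which is settled by cases.\<close>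

lemma sum_mset_axis_eq_iff: "(\<Sum>x\<in>#M. unit_vec x) = (\<Sum>x\<in>#N. unit_vec x) \<longleftrightarrow> M = N"
  by (auto simp: vec_eq_iff sum_mset_axis_nth multiset_eq_iff)

lemma axis_diff_eq_iff:
  assumes "i \<noteq> j"
  shows "unit_vec i - unit_vec j = unit_vec k - unit_vec l \<longleftrightarrow> i = k \<and> j = l"
proof -
  have "unit_vec i - unit_vec j = unit_vec k - unit_vec l \<longleftrightarrow>
      (\<Sum>x\<in>#{#i, l#}. unit_vec x) = (\<Sum>x\<in>#{#k, j#}. unit_vec x)"
    by (auto simp: algebra_simps)
  also have "\<dots> \<longleftrightarrow> i = k \<and> j = l"
    unfolding sum_mset_axis_eq_iff using assms by (auto simp: add_eq_conv_ex)
  finally show ?thesis .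
qed

text \<open>A zero summand is written with two equal indices, so sums of fewer than two arcs need no
  separate treatment.\<close>

lemma sums2_iff:
  fixes x :: "real ^ 'n::finite"
  shows "x \<in> sums2 H \<longleftrightarrow> (\<exists>i j i' j'. (i = j \<or> {i, j} \<in> H) \<and> (i' = j' \<or> {i', j'} \<in> H) \<and>
    x = unit_vec i - unit_vec j + (unit_vec i' - unit_vec j'))"
proof -
  have z: "a \<in> insert 0 (arcs H) \<longleftrightarrow> (\<exists>i j. (i = j \<or> {i, j} \<in> H) \<and> a = unit_vec i - unit_vec j)"
    for a :: "real ^ 'n"
    by (cases "a = 0") (auto simp: arcs_def)
  show ?thesis unfolding sums2_def mem_Collect_eq z by blast
qed

lemma sums2_arc_iff:
  assumes "u \<noteq> v"
  shows "unit_vec u - unit_vec v \<in> sums2 H \<longleftrightarrow> {u, v} \<in> H \<or> nbrs H u \<inter> nbrs H v \<noteq> {}"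
proof
  assume "unit_vec u - unit_vec v \<in> sums2 H"
  then obtain i j i' j' where ij: "i = j \<or> {i, j} \<in> H" "i' = j' \<or> {i', j'} \<in> H"
    "unit_vec u - unit_vec v = unit_vec i - unit_vec j + (unit_vec i' - unit_vec j')"
    unfolding sums2_iff by blast
  then have "(\<Sum>x\<in>#{#u, j, j'#}. unit_vec x) = (\<Sum>x\<in>#{#v, i, i'#}. unit_vec x)"
    by (simp add: algebra_simps)
  then have "{#u, j, j'#} = {#v, i, i'#}" by (simp only: sum_mset_axis_eq_iff)
  with assms ij(1,2) show "{u, v} \<in> H \<or> nbrs H u \<inter> nbrs H v \<noteq> {}"
    by (auto simp: add_eq_conv_ex nbrs_def insert_commute)
next
  assume "{u, v} \<in> H \<or> nbrs H u \<inter> nbrs H v \<noteq> {}"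
  then show "unit_vec u - unit_vec v \<in> sums2 H"
  proof
    assume "{u, v} \<in> H"
    then show ?thesis unfolding sums2_iff by (intro exI[of _ u] exI[of _ v] exI[of _ u]) auto
  next
    assume "nbrs H u \<inter> nbrs H v \<noteq> {}"
    then obtain w where "{u, w} \<in> H" "{w, v} \<in> H" by (auto simp: nbrs_def insert_commute)
    then show ?thesis
      unfolding sums2_iff by (intro exI[of _ u] exI[of _ w] exI[of _ w] exI[of _ v]) auto
  qed
qed

text \<open>No plus end equals a minus end, so nothing cancels: \<open>u\<close>, \<open>k\<close>
  are the plus ends and \<open>v\<close>, \<open>l\<close> the minus ends of the two arcs, and only
  their matching is open.\<close>

lemma sums2_disjoint_iff:
  assumes "u \<noteq> v" "k \<noteq> l" "k \<noteq> v" "l \<noteq> u"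
  shows "unit_vec u - unit_vec v + (unit_vec k - unit_vec l) \<in> sums2 H \<longleftrightarrow>
    {u, v} \<in> H \<and> {k, l} \<in> H \<or> {u, l} \<in> H \<and> {k, v} \<in> H"
proof
  assume "unit_vec u - unit_vec v + (unit_vec k - unit_vec l) \<in> sums2 H"
  then obtain i j i' j' where ij: "i = j \<or> {i, j} \<in> H" "i' = j' \<or> {i', j'} \<in> H"
    "unit_vec u - unit_vec v + (unit_vec k - unit_vec l) = unit_vec i - unit_vec j + (unit_vec i' - unit_vec j')"
    unfolding sums2_iff by blast
  then have "(\<Sum>x\<in>#{#u, k, j, j'#}. unit_vec x) = (\<Sum>x\<in>#{#v, l, i, i'#}. unit_vec x)"
    by (simp add: algebra_simps)
  then have eq: "{#u, k#} + {#j, j'#} = {#v, l#} + {#i, i'#}" 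
    by (simp only: sum_mset_axis_eq_iff union_mset_add_mset_left empty_neutral)
  have "{#u, k#} = {#i, i'#} \<and> {#j, j'#} = {#v, l#}"
  proof -
    have "{#u, k#} \<subseteq># {#i, i'#}"
    proof (rule mset_subset_eqI)
      fix x
      have "count ({#u, k#} + {#j, j'#}) x = count ({#v, l#} + {#i, i'#}) x" using eq by simp
      then show "count {#u, k#} x \<le> count {#i, i'#} x"
        using assms by (cases "x = u \<or> x = k") (auto split: if_splits)
    qed
    then obtain R where R: "{#i, i'#} = {#u, k#} + R" by (metis mset_subset_eq_exists_conv)
    then have "size {#i, i'#} = size {#u, k#} + size R" by (metis size_union)
    then have "R = {#}" by simp
    with R have "{#u, k#} = {#i, i'#}" by simp
    with eq show ?thesis by (simp add: add.commute)
  qed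
  with ij(1,2) assms show "{u, v} \<in> H \<and> {k, l} \<in> H \<or> {u, l} \<in> H \<and> {k, v} \<in> H"
    by (auto simp: add_eq_conv_ex)
next
  assume "{u, v} \<in> H \<and> {k, l} \<in> H \<or> {u, l} \<in> H \<and> {k, v} \<in> H"
  then show "unit_vec u - unit_vec v + (unit_vec k - unit_vec l) \<in> sums2 H"
  proof
    assume "{u, v} \<in> H \<and> {k, l} \<in> H"
    then show ?thesis
      unfolding sums2_iff by (intro exI[of _ u] exI[of _ v] exI[of _ k] exI[of _ l]) auto
  next
    assume "{u, l} \<in> H \<and> {k, v} \<in> H"
    then show ?thesis
      unfolding sums2_iff by (intro exI[of _ u] exI[of _ l] exI[of _ k] exI[of _ v]) auto
  qed
qed

section \<open>The effect of one edge on the set of sums of two arcs\<close>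

lemma card_joins:
  assumes "\<forall>e\<in>E. card e = 2"
  shows "card (joins E) = 2 * card (E :: 'n::finite set set)"
proof -
  have "card (joins E) = card (\<Union>e\<in>E. {(i, j). {i, j} = e})"
    by (rule arg_cong[where f = card]) auto
  also have "\<dots> = (\<Sum>e\<in>E. card {(i, j). {i, j} = e})"
    by (rule card_UN_disjoint) auto
  also have "\<dots> = (\<Sum>e\<in>E. 2)"
  proof (rule sum.cong[OF refl])
    fix e assume "e \<in> E"
    then obtain a b where ab: "e = {a, b}" "a \<noteq> b" using assms by (metis card_2_iff)
    then have "{(i, j). {i, j} = e} = {(a, b), (b, a)}" by (auto simp: doubleton_eq_iff)
    with ab show "card {(i, j). {i, j} = e} = 2" by simp
  qed
  finally show ?thesis by simp
qed

lemma card_arcs: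
  assumes E: "\<forall>e\<in>E. card e = 2"
  shows "card (arcs (E :: 'n::finite set set)) = 2 * card E"
proof -
  have ne: "i \<noteq> j" if "{i, j} \<in> E" for i j using E that by force
  have "arcs E = (\<lambda>(i, j). unit_vec i - unit_vec j) ` joins E" by (auto simp: arcs_def)
  moreover have "inj_on (\<lambda>(i, j). unit_vec i - unit_vec j) (joins E)"
    using ne by (auto simp: inj_on_def axis_diff_eq_iff)
  ultimately have "card (arcs E) = card (joins E)" by (simp add: card_image)
  then show ?thesis using card_joins[OF E] by simp
qed

text \<open>
  Counts the vectors \<open>a\<close>, zero or an arc other than \<open>vu\<close>, for which the arc \<open>uv\<close> plus \<open>a\<close> is already
  a sum of at most two arcs not using the edge \<open>uv\<close>: vectors \<open>a\<close> starting at \<open>v\<close> or ending at \<open>u\<close>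
  (first and last two terms), zero (second term), and \<open>a\<close> disjoint from \<open>uv\<close> (third term).
\<close>

definition overlap :: "'a set set \<Rightarrow> 'a \<Rightarrow> 'a \<Rightarrow> nat" where
  "overlap E u v = (let H = E - {{u, v}}; A = nbrs H u; B = nbrs H v in
     2 * card (A \<inter> B) + (if A \<inter> B = {} then 0 else 1) + card {(a, b). a \<in> A \<and> b \<in> B \<and> {a, b} \<in> H}
     + card {b \<in> B - A. nbrs H b \<inter> A \<noteq> {}} + card {a \<in> A - B. nbrs H a \<inter> B \<noteq> {}})"

lemma sums2_uminus: "x \<in> sums2 H \<longleftrightarrow> - x \<in> sums2 H"
proof -
  have "- x \<in> sums2 H" if "x \<in> sums2 H" for x :: "real ^ 'a"
  proof -
    obtain a b where ab: "x = a + b" "a \<in> insert 0 (arcs H)" "b \<in> insert 0 (arcs H)"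
      using \<open>x \<in> sums2 H\<close> by (auto simp: sums2_def)
    then have "- a \<in> insert 0 (arcs H)" "- b \<in> insert 0 (arcs H)" "- x = - a + - b"
      using arcs_uminus by auto
    then show ?thesis unfolding sums2_def by blast
  qed
  from this[of x] this[of "- x"] show ?thesis by auto
qed

lemma finite_sums2: "finite (sums2 E)"
proof -
  have "finite (insert 0 (arcs E))" using finite_arcs by blast
  then show ?thesis unfolding sums2_def
    by (intro finite_image_set2) auto
qed

text \<open>The summand 1 stands for \<open>- \<delta>\<close>, whose shift is the zero vector. Zero
  itself, the set \<open>Z\<close>, needs a common neighbour of \<open>u\<close> and
  \<open>v\<close>. Such a neighbour gives one arc from \<open>v\<close> (set \<open>b\<close>) and
  one arc to \<open>u\<close> (set \<open>a\<close>), hence the factor two in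
  \<open>overlap\<close>; \<open>c\<close> holds the arcs that close a 4-cycle with
  \<open>uv\<close> or run between two common neighbours.\<close>

lemma card_sums2_shift:
  assumes E: "\<forall>e\<in>E. card e = 2" and uv: "{u, v} \<in> E"
  defines "H \<equiv> E - {{u, v}}" and "\<delta> \<equiv> unit_vec u - unit_vec v"
  shows "card {a \<in> insert 0 (arcs E). \<delta> + a \<in> sums2 H} = 1 + overlap E u v"
proof -
  let ?A = "nbrs H u" and ?B = "nbrs H v"
  have ne: "i \<noteq> j" if "{i, j} \<in> E" for i j using E that by force
  have uv': "u \<noteq> v" "{u, v} \<notin> H" using ne uv by (auto simp: H_def)
  have HE: "H \<subseteq> E" by (auto simp: H_def)
  have EH: "{k, l} \<in> H \<longleftrightarrow> {k, l} \<in> E \<and> \<not> (k = u \<and> l = v) \<and> \<not> (k = v \<and> l = u)" for k l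
    by (auto simp: H_def doubleton_eq_iff)
  define Z where "Z = (if ?A \<inter> ?B = {} then {} else {0 :: real ^ 'a})"
  define b where "b = (\<lambda>l. unit_vec v - unit_vec l) ` (?A \<inter> ?B \<union> {b \<in> ?B - ?A. nbrs H b \<inter> ?A \<noteq> {}})"
  define a where "a = (\<lambda>k. unit_vec k - unit_vec u) ` (?A \<inter> ?B \<union> {a \<in> ?A - ?B. nbrs H a \<inter> ?B \<noteq> {}})"
  define c where "c = (\<lambda>(l, k). unit_vec k - unit_vec l) ` {(l, k). l \<in> ?A \<and> k \<in> ?B \<and> {l, k} \<in> H}"
  have "x \<in> {a \<in> insert 0 (arcs E). \<delta> + a \<in> sums2 H} \<longleftrightarrow> x \<in> {- \<delta>} \<union> Z \<union> b \<union> a \<union> c" for x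
  proof (cases "x \<in> insert 0 (arcs E)")
    case False
    have "- \<delta> \<in> arcs E" using uv unfolding arcs_def \<delta>_def
      unfolding minus_diff_eq mem_Collect_eq
      by (intro exI[of _ v] exI[of _ u]) (simp add: insert_commute)
    moreover have "b \<subseteq> arcs E" using HE unfolding arcs_def b_def nbrs_def by auto
    moreover have "a \<subseteq> arcs E" using HE unfolding arcs_def a_def nbrs_def
      by (auto simp: insert_commute)
    moreover have "c \<subseteq> arcs E" using HE unfolding arcs_def c_def
      by (force simp: insert_commute)
    moreover have "Z \<subseteq> {0}" by (auto simp: Z_def)
    ultimately show ?thesis using False by blast
  next
    case True
    show ?thesis
    proof (cases "x = 0")
      case True
      have "0 \<notin> {- \<delta>} \<union> b \<union> a \<union> c"
      proof -
        have n: "unit_vec i - unit_vec j \<noteq> 0" if "{i, j} \<in> E" for i j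
          using ne[OF that] by (simp add: axis_eq_axis)
        have "0 \<notin> b" using n[of v] HE by (force simp: b_def nbrs_def)
        moreover have "0 \<notin> a" using n[of _ u] HE by (force simp: a_def nbrs_def insert_commute)
        moreover have "0 \<notin> c" using n HE by (force simp: c_def insert_commute)
        ultimately show ?thesis using uv' by (simp add: \<delta>_def axis_eq_axis)
      qed
      then have "x \<in> {- \<delta>} \<union> Z \<union> b \<union> a \<union> c \<longleftrightarrow> ?A \<inter> ?B \<noteq> {}"
        using True by (auto simp: Z_def)
      moreover have "\<delta> \<in> sums2 H \<longleftrightarrow> ?A \<inter> ?B \<noteq> {}"
        unfolding \<delta>_def sums2_arc_iff[OF uv'(1)] using uv'(2) by simp
      ultimately show ?thesis using True by simp
    next
      case nz: False
      with True obtain k l where kl: "{k, l} \<in> E" "x = unit_vec k - unit_vec l" by (auto simp: arcs_def)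
      have kl': "k \<noteq> l" using ne kl by blast
      have xZ: "x \<notin> Z" using nz by (auto simp: Z_def)
      have x\<delta>: "x = - \<delta> \<longleftrightarrow> k = v \<and> l = u"
        unfolding kl(2) \<delta>_def minus_diff_eq axis_diff_eq_iff[OF kl'] by blast
      have xb: "x \<in> b \<longleftrightarrow> k = v \<and> l \<in> ?B \<and> (l \<in> ?A \<or> nbrs H l \<inter> ?A \<noteq> {})"
        unfolding b_def image_iff kl(2) axis_diff_eq_iff[OF kl'] by auto
      have xa: "x \<in> a \<longleftrightarrow> l = u \<and> k \<in> ?A \<and> (k \<in> ?B \<or> nbrs H k \<inter> ?B \<noteq> {})"
        unfolding a_def image_iff kl(2) axis_diff_eq_iff[OF kl'] by auto
      have xc: "x \<in> c \<longleftrightarrow> l \<in> ?A \<and> k \<in> ?B \<and> {l, k} \<in> H"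
        unfolding c_def image_iff kl(2) by (auto simp: axis_diff_eq_iff[OF kl'])
      have uA: "u \<notin> ?A" "v \<notin> ?B" "v \<notin> ?A" "u \<notin> ?B"
        using ne[of u u] ne[of v v] HE uv' by (auto simp: nbrs_def insert_commute)
      have "\<delta> + x \<in> sums2 H \<longleftrightarrow> x \<in> {- \<delta>} \<union> Z \<union> b \<union> a \<union> c"
      proof (cases "k = v")
        case kv: True
        show ?thesis
        proof (cases "l = u")
          case True
          have "0 \<in> sums2 H" unfolding sums2_iff by (intro exI[of _ u]) simp
          then show ?thesis using x\<delta> kv True by (simp add: kl(2) \<delta>_def)
        next
          case False
          have e: "\<delta> + x = unit_vec u - unit_vec l" by (simp add: kl(2) kv \<delta>_def)
          have lB: "l \<in> ?B" using EH[of v l] kl(1) kv False by (auto simp: nbrs_def)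
          show ?thesis unfolding e sums2_arc_iff[OF False[symmetric]]
            using x\<delta> xb xa xc xZ kv False lB uA by (auto simp: nbrs_def)
        qed
      next
        case kv: False
        show ?thesis
        proof (cases "l = u")
          case True
          have e: "\<delta> + x = unit_vec k - unit_vec v" by (simp add: kl(2) True \<delta>_def)
          have kA: "k \<in> ?A" using EH[of u k] kl(1) kv True by (auto simp: nbrs_def insert_commute)
          show ?thesis unfolding e sums2_arc_iff[OF kv]
            using x\<delta> xb xa xc xZ kv True kA uA by (auto simp: nbrs_def insert_commute)
        next
          case False
          have "\<delta> + x \<in> sums2 H \<longleftrightarrow> {u, l} \<in> H \<and> {k, v} \<in> H"
            unfolding kl(2) \<delta>_def sums2_disjoint_iff[OF uv'(1) kl' kv False] using uv'(2) by simp
          moreover have "{u, l} \<in> H \<and> {k, v} \<in> H \<Longrightarrow> {l, k} \<in> H"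
            using EH[of l k] kl(1) False kv uv'(2) by (auto simp: insert_commute)
          ultimately show ?thesis
            using x\<delta> xb xa xc xZ kv False by (auto simp: nbrs_def insert_commute)
        qed
      qed
      then show ?thesis using True by simp
    qed
  qed
  then have eq: "{a \<in> insert 0 (arcs E). \<delta> + a \<in> sums2 H} = {- \<delta>} \<union> (Z \<union> (b \<union> (a \<union> c)))" by blast
  have uA: "u \<notin> ?A" "v \<notin> ?B" "v \<notin> ?A" "u \<notin> ?B"
    using ne[of u u] ne[of v v] HE uv' by (auto simp: nbrs_def insert_commute)
  have n: "unit_vec i - unit_vec j \<noteq> 0" if "i \<noteq> j" for i j :: 'a
    using that by (simp add: axis_eq_axis)
  have d1: "- \<delta> \<notin> Z \<union> (b \<union> (a \<union> c))"
  proof -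
    have s: "- \<delta> = unit_vec v - unit_vec u" by (simp add: \<delta>_def)
    have "- \<delta> \<notin> Z" using n[of v u] uv' by (auto simp: Z_def s)
    moreover have "- \<delta> \<notin> b" "- \<delta> \<notin> a" "- \<delta> \<notin> c"
      unfolding s b_def a_def c_def image_iff using uv' uA
      by (auto simp: axis_diff_eq_iff[of v u])
    ultimately show ?thesis by simp
  qed
  have d2: "Z \<inter> (b \<union> (a \<union> c)) = {}"
  proof -
    have "0 \<notin> b" using n uA by (force simp: b_def)
    moreover have "0 \<notin> a" using n uA by (force simp: a_def)
    moreover have "0 \<notin> c" using n ne HE by (force simp: c_def)
    ultimately show ?thesis by (auto simp: Z_def)
  qed
  have d3: "b \<inter> (a \<union> c) = {}"
  proof -
    have "x \<notin> a \<union> c" if "x \<in> b" for x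
    proof -
      from that obtain l where l: "x = unit_vec v - unit_vec l" "l \<in> ?B" by (auto simp: b_def)
      then have "v \<noteq> l" using uA by auto
      then show ?thesis unfolding l(1) a_def c_def image_iff Un_iff
        using uA l(2) by (auto simp: axis_diff_eq_iff[of v l])
    qed
    then show ?thesis by blast
  qed
  have d4: "a \<inter> c = {}"
  proof -
    have "x \<notin> c" if "x \<in> a" for x
    proof -
      from that obtain k where k: "x = unit_vec k - unit_vec u" "k \<in> ?A" by (auto simp: a_def)
      then have "k \<noteq> u" using uA by auto
      then show ?thesis unfolding k(1) c_def image_iff
        using uA by (auto simp: axis_diff_eq_iff[of k u])
    qed
    then show ?thesis by blast
  qed
  have finZ: "finite Z" "finite a" "finite b" "finite c" by (auto simp: Z_def a_def b_def c_def)
  have cZ: "card Z = (if ?A \<inter> ?B = {} then 0 else 1)" by (simp add: Z_def)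
  have cb: "card b = card (?A \<inter> ?B) + card {b \<in> ?B - ?A. nbrs H b \<inter> ?A \<noteq> {}}"
    unfolding b_def by (subst card_image) (auto simp: inj_on_def axis_eq_axis intro!: card_Un_disjoint)
  have ca: "card a = card (?A \<inter> ?B) + card {a \<in> ?A - ?B. nbrs H a \<inter> ?B \<noteq> {}}"
    unfolding a_def by (subst card_image) (auto simp: inj_on_def axis_eq_axis intro!: card_Un_disjoint)
  have cc: "card c = card {(a, b). a \<in> ?A \<and> b \<in> ?B \<and> {a, b} \<in> H}"
  proof -
    have "l = l' \<and> k = k'" if "{l, k} \<in> H" "unit_vec k - unit_vec l = unit_vec k' - unit_vec l'" for k l k' l' :: 'a
    proof -
      have "k \<noteq> l" using ne that(1) HE by auto
      with that(2) show ?thesis using axis_diff_eq_iff[of k l k' l'] by simp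
    qed
    then show ?thesis unfolding c_def by (intro card_image) (force simp: inj_on_def)
  qed
  have "card ({- \<delta>} \<union> (Z \<union> (b \<union> (a \<union> c)))) = 1 + (card Z + (card b + (card a + card c)))"
    using d1 d2 d3 d4 finZ by (simp add: card_Un_disjoint)
  then show ?thesis unfolding eq cZ cb ca cc overlap_def Let_def H_def[symmetric] by simp
qed

text \<open>Every sum that uses the deleted edge lies in \<open>X\<close> or in its negative, and
  the two new parts are disjoint. \<open>X\<close> has \<open>1 + 2 * card E\<close> elements, of
  which \<open>1 + overlap E u v\<close> were already present.\<close>

lemma card_sums2_delete_edge:
  assumes E: "\<forall>e\<in>E. card e = 2" and uv: "{u, v} \<in> (E :: 'n::finite set set)"
  shows "card (sums2 E) + 2 * overlap E u v = card (sums2 (E - {{u, v}})) + 4 * card E"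
proof -
  define H where "H = E - {{u, v}}"
  define \<delta> where "\<delta> = unit_vec u - unit_vec v"
  have uv': "u \<noteq> v" using E uv by force
  have E_H: "E = insert {u, v} H" using uv by (auto simp: H_def)
  have arcs_E: "arcs E = {\<delta>, - \<delta>} \<union> arcs H"
  proof (intro equalityI subsetI)
    fix x assume "x \<in> arcs E"
    then obtain i j where "{i, j} \<in> E" "x = unit_vec i - unit_vec j" by (auto simp: arcs_def)
    then show "x \<in> {\<delta>, - \<delta>} \<union> arcs H"
      unfolding E_H by (auto simp: arcs_def \<delta>_def doubleton_eq_iff)
  next
    fix x assume x: "x \<in> {\<delta>, - \<delta>} \<union> arcs H"
    have "\<delta> \<in> arcs E" using uv unfolding \<delta>_def arcs_def by blast
    with x arcs_uminus[of \<delta> E] arcs_mono[of H E] show "x \<in> arcs E" by (auto simp: H_def)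
  qed
  define X where "X = (\<lambda>a. \<delta> + a) ` insert 0 (arcs E)"
  have mem: "x \<in> insert 0 (arcs E) \<longleftrightarrow> - x \<in> insert 0 (arcs E)" for x
    using arcs_uminus[of x E] arcs_uminus[of "- x" E] by auto
  have "sums2 E = sums2 H \<union> (X \<union> uminus ` X)"
  proof (intro equalityI subsetI)
    fix x assume "x \<in> sums2 E"
    then obtain a b where ab: "x = a + b" "a \<in> insert 0 (arcs E)" "b \<in> insert 0 (arcs E)"
      by (auto simp: sums2_def)
    have *: "\<delta> + c \<in> X" "- \<delta> + c \<in> uminus ` X" if "c \<in> insert 0 (arcs E)" for c
    proof -
      show "\<delta> + c \<in> X" using that by (auto simp: X_def)
      have "- \<delta> + c = - (\<delta> + - c)" by simp
      moreover have "\<delta> + - c \<in> X" using that mem[of c] unfolding X_def by blast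
      ultimately show "- \<delta> + c \<in> uminus ` X" by blast
    qed
    consider "a = \<delta>" | "a = - \<delta>" | "b = \<delta>" | "b = - \<delta>"
      | "a \<in> insert 0 (arcs H)" "b \<in> insert 0 (arcs H)"
      using ab(2,3) arcs_E by blast
    then show "x \<in> sums2 H \<union> (X \<union> uminus ` X)"
    proof cases
      case 5
      then show ?thesis unfolding ab(1) sums2_def by blast
    qed (use *[OF ab(3)] *[OF ab(2)] ab(1) in \<open>auto simp: add.commute\<close>)
  next
    have d: "\<delta> \<in> insert 0 (arcs E)" "- \<delta> \<in> insert 0 (arcs E)" using arcs_E by auto
    have X: "X \<subseteq> sums2 E" using d unfolding X_def sums2_def by blast
    moreover have "uminus ` X \<subseteq> sums2 E" using X sums2_uminus by blast
    moreover have "sums2 H \<subseteq> sums2 E" using arcs_E unfolding sums2_def by blast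
    ultimately show "x \<in> sums2 E" if "x \<in> sums2 H \<union> (X \<union> uminus ` X)" for x using that by blast
  qed
  then have S: "sums2 E = sums2 H \<union> ((X - sums2 H) \<union> (uminus ` X - sums2 H))" by blast
  have fin: "finite X" unfolding X_def using finite_arcs[of E] by blast
  have m: "uminus ` X - sums2 H = uminus ` (X - sums2 H)" using sums2_uminus by auto
  have disj: "(X - sums2 H) \<inter> (uminus ` X - sums2 H) = {}"
  proof (rule ccontr)
    assume "\<not> ?thesis"
    then obtain a b where ab: "a \<in> insert 0 (arcs E)" "b \<in> insert 0 (arcs E)"
      "\<delta> + a = - (\<delta> + b)" "\<delta> + a \<notin> sums2 H" unfolding X_def by blast
    obtain i j where i: "a = unit_vec i - unit_vec j" using ab(1) by (auto simp: arcs_def)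
    obtain k l where k: "b = unit_vec k - unit_vec l" using ab(2) by (auto simp: arcs_def)
    \<comment> \<open>A coincidence means \<open>2 \<delta> + a + b = 0\<close>. Comparing multisets
      forces \<open>a = - \<delta>\<close>, and then the vector is zero, which is an old
      sum.\<close>
    have "(\<Sum>x\<in>#{#u, u, i, k#}. unit_vec x) = (\<Sum>x\<in>#{#v, v, j, l#}. unit_vec x)"
      using ab(3) unfolding i k \<delta>_def by (simp add: algebra_simps)
    then have "{#u, u, i, k#} = {#v, v, j, l#}" by (simp only: sum_mset_axis_eq_iff)
    then have "i = v \<and> j = u" using uv' by (auto simp: add_eq_conv_ex)
    then have "\<delta> + a = 0" by (simp add: i \<delta>_def)
    moreover have "0 \<in> sums2 H" unfolding sums2_iff by (intro exI[of _ u]) simp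
    ultimately show False using ab(4) by simp
  qed
  have "card (sums2 E) = card (sums2 H) + (card (X - sums2 H) + card (uminus ` X - sums2 H))"
    unfolding S using disj fin finite_sums2[of H] by (simp add: card_Un_disjoint Int_Un_distrib)
  also have "card (uminus ` X - sums2 H) = card (X - sums2 H)" unfolding m by (simp add: card_image)
  finally have 1: "card (sums2 E) = card (sums2 H) + 2 * card (X - sums2 H)" by simp
  have "X \<inter> sums2 H = (\<lambda>a. \<delta> + a) ` {a \<in> insert 0 (arcs E). \<delta> + a \<in> sums2 H}"
    unfolding X_def by blast
  then have "card (X \<inter> sums2 H) = 1 + overlap E u v"
    using card_sums2_shift[OF E uv] by (simp add: card_image H_def \<delta>_def)
  moreover have "card X = 1 + 2 * card E"
    unfolding X_def using zero_notin_arcs[OF E] finite_arcs[of E] card_arcs[OF E]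
    by (subst card_image) (auto simp: inj_on_def)
  moreover have "card X = card (X - sums2 H) + card (X \<inter> sums2 H)"
    using card_Int_Diff[OF fin, of "sums2 H"] by simp
  ultimately show ?thesis using 1 unfolding H_def by linarith
qed

section \<open>The cyclomatic number\<close>

text \<open>The rank of the arcs is the number of vertices minus the number of components, so this
  is the cyclomatic number, obtained without counting components.\<close>

definition cyc :: "'n::finite set set \<Rightarrow> int" where
  "cyc E = int (card E) - int (dim (arcs E))"

lemma arcs_empty: "arcs {} = {}"
  by (simp add: arcs_def)

lemma cyc_empty: "cyc {} = 0"
  by (simp add: cyc_def arcs_empty)

text \<open>The rank grows exactly if the new arc lies outside the span of the old ones, that is, if
  its ends were not yet connected.\<close>

lemma cyc_insert:
  assumes "{u, v} \<notin> F"
  shows "cyc (insert {u, v} F) = cyc F + (if (u, v) \<in> (joins F)\<^sup>* then 1 else 0)"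
proof -
  let ?\<delta> = "unit_vec u - unit_vec v"
  have "arcs (insert {u, v} F) \<subseteq> span (insert ?\<delta> (arcs F))"
  proof
    fix x assume "x \<in> arcs (insert {u, v} F)"
    then have "x = ?\<delta> \<or> x = - ?\<delta> \<or> x \<in> arcs F" by (auto simp: arcs_def doubleton_eq_iff)
    then show "x \<in> span (insert ?\<delta> (arcs F))"
      by (metis insertI1 insertI2 span_base span_neg)
  qed
  moreover have "insert ?\<delta> (arcs F) \<subseteq> arcs (insert {u, v} F)"
    by (auto simp: arcs_def)
  ultimately have "span (arcs (insert {u, v} F)) = span (insert ?\<delta> (arcs F))"
    by (metis span_minimal span_mono subspace_span subset_antisym)
  then have "dim (arcs (insert {u, v} F)) = dim (insert ?\<delta> (arcs F))" by (metis dim_span)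
  moreover have "card (insert {u, v} F) = Suc (card F)" using assms by simp
  ultimately show ?thesis by (simp add: cyc_def dim_insert span_arcs_iff)
qed

lemma cyc_delete:
  assumes "{u, v} \<in> E"
  shows "cyc E = cyc (E - {{u, v}}) + (if (u, v) \<in> (joins (E - {{u, v}}))\<^sup>* then 1 else 0)"
  using cyc_insert[of u v "E - {{u, v}}"] assms by (simp add: insert_absorb)

lemma cyc_mono:
  assumes "F \<subseteq> E" "\<forall>e\<in>E. card e = 2"
  shows "cyc F \<le> cyc E"
proof -
  have "finite (E - F)" by simp
  have "cyc F \<le> cyc (F \<union> X)" if "X \<subseteq> E - F" for X
    using finite_subset[OF that \<open>finite (E - F)\<close>] that
  proof (induction X rule: finite_induct)
    case (insert e X)
    obtain u v where e: "e = {u, v}" using insert.prems assms(2) by (metis Diff_iff card_2_iff insert_subset)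
    have "cyc (F \<union> X) \<le> cyc (insert e (F \<union> X))"
      unfolding e by (subst cyc_insert) (use insert e in auto)
    then show ?case using insert by simp
  qed simp
  from this[of "E - F"] show ?thesis using assms(1) by (simp add: Un_absorb1)
qed

lemma cyc_nonneg: "\<forall>e\<in>E. card e = 2 \<Longrightarrow> 0 \<le> cyc E"
  using cyc_mono[of "{}" E] by (simp add: cyc_empty)

text \<open>All arcs lie in the span of the differences to a fixed covered vertex \<open>r\<close>,
  so the rank is less than the number of covered vertices.\<close>

lemma cyc_lower_bound:
  assumes "r \<in> \<Union>E"
  shows "cyc E \<ge> int (card E) - int (card (\<Union>E)) + 1"
proof -
  let ?B = "(\<lambda>i. unit_vec i - unit_vec r) ` (\<Union>E - {r})"
  have mem: "unit_vec i - unit_vec r \<in> span ?B" if "i \<in> \<Union>E" for i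
    using that by (cases "i = r") (auto intro: span_base simp: span_zero)
  have "arcs E \<subseteq> span ?B"
  proof
    fix x assume "x \<in> arcs E"
    then obtain i j where "{i, j} \<in> E" "x = unit_vec i - unit_vec j" by (auto simp: arcs_def)
    then have ij: "i \<in> \<Union>E" "j \<in> \<Union>E" "x = unit_vec i - unit_vec j" by auto
    then have "x = (unit_vec i - unit_vec r) - (unit_vec j - unit_vec r)" by simp
    then show "x \<in> span ?B" using span_diff mem ij by metis
  qed
  then have "dim (arcs E) \<le> dim ?B" by (metis dim_subset dim_span)
  also have "\<dots> \<le> card ?B" by (rule dim_le_card') simp
  also have "\<dots> \<le> card (\<Union>E - {r})" by (rule card_image_le) simp
  also have "\<dots> = card (\<Union>E) - 1" using assms by simp
  finally have "dim (arcs E) \<le> card (\<Union>E) - 1" .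
  moreover have "card (\<Union>E) > 0" using assms by (metis card_gt_0_iff empty_iff finite)
  ultimately show ?thesis by (simp add: cyc_def)
qed

section \<open>The second entry of the \<open>\<gamma>\<close>-vector under edge deletion\<close>

text \<open>The expression for gamma_2 after substituting \<open>2 * card E\<close> for the number
  of arcs and \<open>card E - cyc E\<close> for their rank.\<close>

definition gamma2 :: "'n::finite set set \<Rightarrow> int" where
  "gamma2 E = int (card (sums2 E)) - 1 - 2 * int (card E) * (int (card E) + 1) + 2 * cyc E * (cyc E + 2)"

lemma gamma_eq_gamma2:
  assumes "\<forall>e\<in>E. card e = 2"
  shows "gamma (sym_edge_polytope E) 2 = gamma2 E"
  unfolding gamma_2_sym_edge_polytope[OF assms] gamma2_def cyc_def card_arcs[OF assms]
  by (simp add: algebra_simps)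

lemma gamma2_empty: "gamma2 ({} :: 'n::finite set set) = 0"
proof -
  have "sums2 ({} :: 'n set set) = {0}" by (auto simp: sums2_def arcs_empty)
  then show ?thesis by (simp add: gamma2_def cyc_empty)
qed

lemma joins_sym: "(a, b) \<in> (joins F)\<^sup>* \<Longrightarrow> (b, a) \<in> (joins F)\<^sup>*"
proof -
  have "sym (joins F)" by (auto simp: sym_def insert_commute)
  then show "(a, b) \<in> (joins F)\<^sup>* \<Longrightarrow> (b, a) \<in> (joins F)\<^sup>*"
    by (meson sym_rtrancl symD)
qed

text \<open>Each object counted by \<open>overlap\<close> exhibits a path of length two or three
  from \<open>u\<close> to \<open>v\<close> in the remaining graph.\<close>

lemma overlap_bridge:
  assumes "(u, v) \<notin> (joins (E - {{u, v}}))\<^sup>*"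
  shows "overlap E u v = 0"
proof -
  let ?H = "E - {{u, v}}"
  let ?A = "nbrs ?H u" and ?B = "nbrs ?H v"
  have no: "(a, b) \<notin> joins ?H" "a \<noteq> b" if "a \<in> ?A" "b \<in> ?B" for a b
  proof -
    have "(u, a) \<in> joins ?H" "(b, v) \<in> joins ?H" using that by (auto simp: nbrs_def insert_commute)
    then show "(a, b) \<notin> joins ?H" "a \<noteq> b"
      using assms by (meson rtrancl.simps)+
  qed
  have "?A \<inter> ?B = {}" using no(2) by blast
  moreover have "{(a, b). a \<in> ?A \<and> b \<in> ?B \<and> {a, b} \<in> ?H} = {}" using no(1) by blast
  moreover have "nbrs ?H b \<inter> ?A = {}" if "b \<in> ?B" for b
    using no(1)[OF _ that] unfolding nbrs_def[of ?H b] by (auto simp: insert_commute)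
  moreover have "nbrs ?H a \<inter> ?B = {}" if "a \<in> ?A" for a
    using no(1)[OF that] unfolding nbrs_def[of ?H a] by auto
  ultimately have "{b \<in> ?B - ?A. nbrs ?H b \<inter> ?A \<noteq> {}} = {}" "{a \<in> ?A - ?B. nbrs ?H a \<inter> ?B \<noteq> {}} = {}"
    "?A \<inter> ?B = {}" "{(a, b). a \<in> ?A \<and> b \<in> ?B \<and> {a, b} \<in> ?H} = {}"
    by blast+
  then show ?thesis unfolding overlap_def Let_def by (simp only: card.empty) simp
qed

lemma gamma2_delete_bridge:
  assumes E: "\<forall>e\<in>E. card e = 2" and uv: "{u, v} \<in> E" and cyc: "cyc (E - {{u, v}}) = cyc E"
  shows "gamma2 E = gamma2 (E - {{u, v}})"
proof -
  have "(u, v) \<notin> (joins (E - {{u, v}}))\<^sup>*" using cyc_delete[OF uv] cyc by (auto split: if_splits)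
  from overlap_bridge[OF this] have "card (sums2 E) = card (sums2 (E - {{u, v}})) + 4 * card E"
    using card_sums2_delete_edge[OF E uv] by simp
  moreover have "int (card E) = int (card (E - {{u, v}})) + 1"
    using uv card_Suc_Diff1[of E "{u, v}"] by simp
  ultimately show ?thesis unfolding gamma2_def cyc by (simp add: algebra_simps)
qed

text \<open>The factor comes from \<open>2 c (c + 2) - 2 (c - 1) (c + 1) = 2 (2 c + 1)\<close>; the
  terms in \<open>card E\<close> cancel against \<open>4 * card E\<close> in the deletion
  formula.\<close>

lemma gamma2_delete_nonbridge:
  assumes E: "\<forall>e\<in>E. card e = 2" and uv: "{u, v} \<in> E" and cyc: "cyc (E - {{u, v}}) = cyc E - 1"
  shows "gamma2 E = gamma2 (E - {{u, v}}) + 2 * (2 * cyc E + 1 - int (overlap E u v))"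
proof -
  have "int (card (sums2 E)) + 2 * int (overlap E u v) = int (card (sums2 (E - {{u, v}}))) + 4 * int (card E)"
    using card_sums2_delete_edge[OF E uv] by linarith
  moreover have "int (card E) = int (card (E - {{u, v}})) + 1"
    using uv card_Suc_Diff1[of E "{u, v}"] by simp
  ultimately show ?thesis unfolding gamma2_def cyc by (simp add: algebra_simps)
qed

text \<open>Monotonicity squeezes the cyclomatic number of every edge set between \<open>B\<close>
  and \<open>E\<close>, so each edge outside \<open>B\<close> is a bridge at the moment it is
  removed.\<close>

lemma gamma2_subgraph:
  assumes "\<forall>e\<in>E. card e = 2" "B \<subseteq> E" "cyc B = cyc E"
  shows "gamma2 E = gamma2 B"
  using assms
proof (induction "card (E - B)" arbitrary: E)
  case 0
  then show ?case by auto
next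
  case (Suc n)
  then obtain e where e: "e \<in> E" "e \<notin> B" by (metis Diff_iff card_eq_0_iff ex_in_conv nat.distinct(1))
  then obtain u v where uv: "e = {u, v}" using Suc.prems(1) by (metis card_2_iff)
  have E': "\<forall>f\<in>E - {e}. card f = 2" "B \<subseteq> E - {e}" using Suc.prems e by auto
  have c: "cyc (E - {e}) = cyc E"
    using cyc_mono[OF E'(2,1)] cyc_mono[of "E - {e}" E] Suc.prems by auto
  have "E - {e} - B = (E - B) - {e}" by auto
  then have "n = card (E - {e} - B)" using Suc.hyps(2) e by simp
  from Suc.hyps(1)[OF this E'] have "gamma2 (E - {e}) = gamma2 B" using Suc.prems(3) c by simp
  with gamma2_delete_bridge[OF Suc.prems(1), of u v] e(1) c show ?case by (simp add: uv)
qed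

section \<open>The exceptional graphs\<close>

definition biclique :: "'a \<Rightarrow> 'a \<Rightarrow> 'a set \<Rightarrow> 'a set set" where
  "biclique x y W = {{z, w} |z w. z \<in> {x, y} \<and> w \<in> W}"

definition pairs :: "'a set \<Rightarrow> 'a set set" where
  "pairs S = {e. e \<subseteq> S \<and> card e = 2}"

lemma biclique_insert: "biclique x y (insert w W) = insert {y, w} (insert {x, w} (biclique x y W))"
  by (auto simp: biclique_def)

lemma biclique_empty: "biclique x y {} = {}"
  by (simp add: biclique_def)

lemma biclique_iff: "{a, b} \<in> biclique x y W \<longleftrightarrow> a \<in> {x, y} \<and> b \<in> W \<or> b \<in> {x, y} \<and> a \<in> W"
  by (auto simp: biclique_def doubleton_eq_iff)

lemma biclique_simple: "x \<notin> W \<Longrightarrow> y \<notin> W \<Longrightarrow> e \<in> biclique x y W \<Longrightarrow> card e = 2"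
  by (auto simp: biclique_def card_2_iff)

lemma not_joined_isolated:
  assumes "w \<notin> \<Union>F" "x \<noteq> w"
  shows "(x, w) \<notin> (joins F)\<^sup>*"
proof
  assume "(x, w) \<in> (joins F)\<^sup>*"
  then show False
    by (cases rule: rtrancl.cases) (use assms in auto)
qed

text \<open>\<open>w\<close> is a new vertex of degree two. The edge \<open>xw\<close> is a pendant
  bridge; then \<open>yw\<close> closes a cycle, and its overlap is exactly twice the new cyclomatic
  number plus one. \<open>C\<close> records whether the edge \<open>xy\<close> is present, so that
  both families share this step.\<close>

lemma cyc_gamma2_biclique_step:
  assumes F: "F = biclique x y W \<and> C = {} \<or> F = insert {x, y} (biclique x y W) \<and> C = {{x, y}}"
    and xy: "x \<noteq> y" "x \<notin> W" "y \<notin> W" "w \<notin> W" "w \<noteq> x" "w \<noteq> y"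
    and ne: "C = {} \<Longrightarrow> W \<noteq> {}"
    and c: "cyc F = int (card W) - (if C = {} then 1 else 0)"
  shows "cyc (insert {y, w} (insert {x, w} F)) = cyc F + 1"
    "gamma2 (insert {y, w} (insert {x, w} F)) = gamma2 F"
proof -
  let ?H = "insert {x, w} F"
  let ?E = "insert {y, w} ?H"
  have Fiff: "{a, b} \<in> F \<longleftrightarrow> {a, b} \<in> biclique x y W \<or> C \<noteq> {} \<and> {a, b} = {x, y}" for a b
    using F by auto
  have E: "\<forall>e\<in>?E. card e = 2"
  proof -
    have "\<forall>e\<in>F. card e = 2" using F biclique_simple[of x W y] xy by auto
    then show ?thesis using xy by auto
  qed
  have w: "w \<notin> \<Union>F"
    using F xy by (auto simp: biclique_def)
  have xw: "{x, w} \<notin> F" using w by auto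
  have cH: "cyc ?H = cyc F"
    using cyc_insert[OF xw] not_joined_isolated[OF w, of x] xy by simp
  have yw: "{y, w} \<notin> ?H" using w xy by (auto simp: doubleton_eq_iff)
  have "(y, x) \<in> (joins ?H)\<^sup>*"
  proof (cases "C = {}")
    case True
    then obtain z where z: "z \<in> W" using ne by blast
    then have "(y, z) \<in> joins ?H" "(z, x) \<in> joins ?H" using Fiff by (auto simp: biclique_iff)
    then show ?thesis by (meson r_into_rtrancl rtrancl_into_rtrancl)
  next
    case False
    then have "(y, x) \<in> joins ?H" using Fiff by (auto simp: insert_commute)
    then show ?thesis by blast
  qed
  moreover have "(x, w) \<in> joins ?H" by simp
  ultimately have "(y, w) \<in> (joins ?H)\<^sup>*" by (rule rtrancl_into_rtrancl)
  then show cE: "cyc ?E = cyc F + 1" using cyc_insert[OF yw] cH by simp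
  have EH: "?E - {{y, w}} = ?H" using yw by simp
  have A: "nbrs ?H y = W \<union> (if C = {} then {} else {x})"
    using xy by (auto simp: nbrs_def Fiff biclique_iff doubleton_eq_iff)
  have B: "nbrs ?H w = {x}"
    using xy w by (auto simp: nbrs_def doubleton_eq_iff)
  have p: "{(a, b). a \<in> nbrs ?H y \<and> b \<in> nbrs ?H w \<and> {a, b} \<in> ?H} = W \<times> {x}"
    unfolding A B using xy by (auto simp: Fiff biclique_iff doubleton_eq_iff split: if_splits)
  have q: "{b \<in> nbrs ?H w - nbrs ?H y. nbrs ?H b \<inter> nbrs ?H y \<noteq> {}} = (if C = {} then {x} else {})"
    unfolding A B using xy ne by (auto simp: nbrs_def Fiff biclique_iff)
  have r: "{a \<in> nbrs ?H y - nbrs ?H w. nbrs ?H a \<inter> nbrs ?H w \<noteq> {}} = W"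
    unfolding A B using xy by (auto simp: nbrs_def Fiff biclique_iff)
  have AB: "nbrs ?H y \<inter> nbrs ?H w = (if C = {} then {} else {x})"
    unfolding A B using xy by auto
  have "overlap ?E y w = 2 * card W + (if C = {} then 1 else 3)"
    unfolding overlap_def EH Let_def p q r AB by (simp add: card_cartesian_product)
  then show "gamma2 ?E = gamma2 F"
    using gamma2_delete_nonbridge[OF E, of y w] gamma2_delete_bridge[of ?H x w] E cE cH c
    by (simp add: EH xw)
qed

lemma cyc_gamma2_biclique:
  assumes "x \<noteq> y" "x \<notin> W" "y \<notin> W"
  shows "W \<noteq> {} \<Longrightarrow> cyc (biclique x y W) = int (card W) - 1 \<and> gamma2 (biclique x y W) = 0"
    and "cyc (insert {x, y} (biclique x y W)) = int (card W) \<and> gamma2 (insert {x, y} (biclique x y W)) = 0"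
proof -
  have W: "finite W" by simp
  have star: "gamma2 F = 0" if "cyc F = 0" "\<forall>e\<in>F. card e = 2" for F
    using gamma2_subgraph[of F "{}"] that by (simp add: cyc_empty gamma2_empty)
  show "W \<noteq> {} \<Longrightarrow> cyc (biclique x y W) = int (card W) - 1 \<and> gamma2 (biclique x y W) = 0"
    using W assms
  proof (induction W rule: finite_induct)
    case (insert w W)
    then have w: "w \<noteq> x" "w \<noteq> y" "w \<notin> W" "x \<notin> W" "y \<notin> W" "x \<noteq> y" by auto
    show ?case
    proof (cases "W = {}")
      case True
      have "cyc {{x, w}} = 0"
        using cyc_insert[of x w "{}"] w not_joined_isolated[of w "{}" x] by (simp add: cyc_empty)
      moreover have "(y, w) \<notin> (joins {{x, w}})\<^sup>*"
        using not_joined_isolated[of y "{{x, w}}" w] w joins_sym by fastforce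
      ultimately have "cyc (biclique x y (insert w W)) = 0"
        using cyc_insert[of y w "{{x, w}}"] w True by (simp add: biclique_insert biclique_empty doubleton_eq_iff)
      moreover have "\<forall>e\<in>biclique x y (insert w W). card e = 2"
        using biclique_simple[of x "insert w W" y] w by auto
      ultimately show ?thesis using star True by simp
    next
      case False
      then have IH: "cyc (biclique x y W) = int (card W) - 1" "gamma2 (biclique x y W) = 0"
        using insert.IH w by auto
      show ?thesis
        using cyc_gamma2_biclique_step[of "biclique x y W" x y W "{}" w] w IH False insert.hyps
        by (simp add: biclique_insert)
    qed
  qed simp
  show "cyc (insert {x, y} (biclique x y W)) = int (card W) \<and> gamma2 (insert {x, y} (biclique x y W)) = 0"
    using W assms
  proof (induction W rule: finite_induct)
    case empty
    have "cyc {{x, y}} = 0"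
      using cyc_insert[of x y "{}"] empty not_joined_isolated[of y "{}" x] by (simp add: cyc_empty)
    then show ?case using star[of "{{x, y}}"] empty by (simp add: biclique_empty)
  next
    case (insert w W)
    then have w: "w \<noteq> x" "w \<noteq> y" "w \<notin> W" "x \<notin> W" "y \<notin> W" "x \<noteq> y" by auto
    have eq: "insert {x, y} (biclique x y (insert w W)) =
        insert {y, w} (insert {x, w} (insert {x, y} (biclique x y W)))"
      by (auto simp: biclique_insert)
    show ?case
      unfolding eq
      using cyc_gamma2_biclique_step[of "insert {x, y} (biclique x y W)" x y W "{{x, y}}" w] w insert
      by simp
  qed
qed

lemma pairs_4:
  assumes "distinct [x, y, v, w]"
  shows "pairs {x, y, v, w} = insert {v, w} (insert {x, y} (biclique x y {v, w}))"
proof -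
  have "e \<in> pairs {x, y, v, w} \<longleftrightarrow> e \<in> insert {v, w} (insert {x, y} (biclique x y {v, w}))" for e
  proof
    assume "e \<in> pairs {x, y, v, w}"
    then obtain a b where "e = {a, b}" "a \<noteq> b" "{a, b} \<subseteq> {x, y, v, w}"
      unfolding pairs_def by (auto simp: card_2_iff)
    then show "e \<in> insert {v, w} (insert {x, y} (biclique x y {v, w}))"
      by (auto simp: biclique_iff insert_commute)
  next
    assume "e \<in> insert {v, w} (insert {x, y} (biclique x y {v, w}))"
    then show "e \<in> pairs {x, y, v, w}"
      using assms unfolding pairs_def biclique_def by auto
  qed
  then show ?thesis by blast
qed

text \<open>\<open>K_4\<close> is a triangle book with two pages plus the edge \<open>vw\<close>
  between the pages, whose overlap \<open>2 * 2 + 1 + 2 = 7\<close> equals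
  \<open>2 * 3 + 1\<close>.\<close>

lemma cyc_gamma2_pairs:
  assumes "card S = 4"
  shows "cyc (pairs S) = 3 \<and> gamma2 (pairs S) = 0"
proof -
  obtain x S1 where S1: "S = insert x S1" "x \<notin> S1" "card S1 = 3"
    using assms card_Suc_eq[of S 3] by auto
  then obtain y v w where S: "S1 = {y, v, w}" "y \<noteq> v" "y \<noteq> w" "v \<noteq> w"
    by (auto simp: card_3_iff)
  then have d: "distinct [x, y, v, w]" using S1 by auto
  let ?H = "insert {x, y} (biclique x y {v, w})"
  have P: "pairs S = insert {v, w} ?H" using pairs_4[OF d] S1 S by simp
  have E: "\<forall>e\<in>pairs S. card e = 2" by (simp add: pairs_def)
  have vw: "{v, w} \<notin> ?H" using d by (auto simp: biclique_iff doubleton_eq_iff)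
  have H: "cyc ?H = 2" "gamma2 ?H = 0" using cyc_gamma2_biclique(2)[of x y "{v, w}"] d by auto
  have "(v, x) \<in> joins ?H" "(x, w) \<in> joins ?H" by (auto simp: biclique_iff)
  then have "(v, w) \<in> (joins ?H)\<^sup>*" by (meson r_into_rtrancl rtrancl_into_rtrancl)
  then have c: "cyc (pairs S) = 3" using cyc_insert[OF vw] H P by simp
  have PH: "pairs S - {{v, w}} = ?H" using P vw by simp
  have A: "nbrs ?H v = {x, y}" using d by (auto simp: nbrs_def biclique_iff doubleton_eq_iff)
  have B: "nbrs ?H w = {x, y}" using d by (auto simp: nbrs_def biclique_iff doubleton_eq_iff)
  have p: "{(a, b). a \<in> {x, y} \<and> b \<in> {x, y} \<and> {a, b} \<in> ?H} = {(x, y), (y, x)}"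
    using d by (auto simp: biclique_iff insert_commute doubleton_eq_iff)
  have "overlap (pairs S) v w = 7"
    unfolding overlap_def PH Let_def A B p using d by simp
  moreover have "{v, w} \<in> pairs S" using P by simp
  ultimately have "gamma2 (pairs S) = 0"
    using gamma2_delete_nonbridge[OF E, of v w] c H unfolding PH by simp
  then show ?thesis using c by simp
qed

text \<open>The edge sets of \<open>K_{2,l}\<close>, of \<open>G_l\<close> with
  \<open>l = card W + 2\<close>, and of \<open>K_4\<close>, on arbitrary vertices. Unlike graphs,
  edge sets can be compared directly with subsets of \<open>E\<close>; the bounds on
  \<open>card W\<close> exclude acyclic members.\<close>

definition exceptional :: "'a set set \<Rightarrow> bool" where
  "exceptional B \<longleftrightarrow>
     (\<exists>x y W. x \<noteq> y \<and> x \<notin> W \<and> y \<notin> W \<and> card W \<ge> 2 \<and> B = biclique x y W) \<or>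
     (\<exists>x y W. x \<noteq> y \<and> x \<notin> W \<and> y \<notin> W \<and> card W \<ge> 1 \<and> B = insert {x, y} (biclique x y W)) \<or>
     (\<exists>S. card S = 4 \<and> B = pairs S)"

lemma exceptional_cases:
  assumes "exceptional B"
  obtains (bic) x y W where "x \<noteq> y" "x \<notin> W" "y \<notin> W" "card W \<ge> 2" "B = biclique x y W"
    | (tri) x y W where "x \<noteq> y" "x \<notin> W" "y \<notin> W" "card W \<ge> 1" "B = insert {x, y} (biclique x y W)"
    | (K4) S where "card S = 4" "B = pairs S"
  using assms unfolding exceptional_def
  by (elim disjE exE conjE)
    ((rule that(1); assumption) | (rule that(2); assumption) | (rule that(3); assumption))+

lemma gamma2_exceptional:
  assumes "exceptional B"
  shows "gamma2 B = 0" "cyc B > 0"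
  using assms cyc_gamma2_biclique cyc_gamma2_pairs unfolding exceptional_def
  by (fastforce)+

section \<open>Degrees\<close>

abbreviation deg :: "'n::finite set set \<Rightarrow> 'n \<Rightarrow> nat" where
  "deg E z \<equiv> card (nbrs E z)"

lemma nbrs_vertex: "w \<in> nbrs E z \<Longrightarrow> z \<in> \<Union>E" "w \<in> nbrs E z \<Longrightarrow> w \<in> \<Union>E"
  by (auto simp: nbrs_def)

lemma sum_deg:
  assumes E: "\<forall>e\<in>E. card e = 2"
  shows "(\<Sum>z\<in>\<Union>E. deg E z) = 2 * card (E :: 'n::finite set set)"
proof -
  have "(\<Sum>z\<in>\<Union>E. deg E z) = card (SIGMA z:\<Union>E. nbrs E z)"
    by (subst card_SigmaI) auto
  also have "(SIGMA z:\<Union>E. nbrs E z) = joins E"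
    by (auto simp: nbrs_def)
  finally show ?thesis using card_joins[OF E] by simp
qed

text \<open>The handshake lemma combined with \<open>cyc_lower_bound\<close>; the degree condition
  makes the truncated differences exact.\<close>

lemma cyc_ge_sum_deg:
  assumes E: "\<forall>e\<in>E. card e = 2" and ne: "E \<noteq> {}" and deg: "\<forall>z\<in>\<Union>E. deg E z \<ge> 2"
  shows "2 * cyc E \<ge> 2 + int (\<Sum>z\<in>\<Union>E. deg E z - 2)"
proof -
  have "(\<Sum>z\<in>\<Union>E. deg E z) = (\<Sum>z\<in>\<Union>E. (deg E z - 2) + 2)"
  proof (rule sum.cong[OF refl])
    fix z assume "z \<in> \<Union>E"
    then have "deg E z \<ge> 2" using deg by blast
    then show "deg E z = deg E z - 2 + 2" by simp
  qed
  also have "\<dots> = (\<Sum>z\<in>\<Union>E. deg E z - 2) + 2 * card (\<Union>E)"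
    by (simp only: sum.distrib) simp
  finally have 1: "2 * card E = (\<Sum>z\<in>\<Union>E. deg E z - 2) + 2 * card (\<Union>E)"
    using sum_deg[OF E] by simp
  obtain e where "e \<in> E" using ne by blast
  then obtain r where "r \<in> \<Union>E" using E by (metis UnionI all_not_in_conv card.empty zero_neq_numeral)
  from cyc_lower_bound[OF this] 1 show ?thesis by linarith
qed

text \<open>
  Each edge between the two neighbourhoods is charged in halves to its ends; a vertex adjacent to
  only one of \<open>u\<close>, \<open>v\<close> can pay because its degree is at least three.
\<close>

lemma overlap_le_sum_deg:
  assumes E: "\<forall>e\<in>E. card e = 2" and deg: "\<forall>z\<in>\<Union>E. deg E z \<ge> 3" and uv: "{u, v} \<in> E"
  shows "overlap E u v \<le> 3 + (\<Sum>z\<in>\<Union>E. deg E z - 2)"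
proof -
  define H where "H = E - {{u, v}}"
  define A where "A = nbrs H u"
  define B where "B = nbrs H v"
  have ne: "i \<noteq> j" if "{i, j} \<in> E" for i j using E that by force
  have u_v: "u \<noteq> v" using ne uv by blast
  have noloop: "{i} \<notin> E" for i using ne[of i i] by auto
  have EH: "{k, l} \<in> H \<longleftrightarrow> {k, l} \<in> E \<and> \<not> (k = u \<and> l = v) \<and> \<not> (k = v \<and> l = u)" for k l
    by (auto simp: H_def doubleton_eq_iff)
  have nu: "nbrs E u = insert v A" "v \<notin> A"
    using uv u_v by (auto simp: A_def nbrs_def EH)
  have nv: "nbrs E v = insert u B" "u \<notin> B"
    using uv u_v by (auto simp: B_def nbrs_def EH insert_commute)
  have uA: "u \<notin> A" "v \<notin> B" using noloop by (auto simp: A_def B_def nbrs_def H_def)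
  have du: "deg E u = card A + 1" and dv: "deg E v = card B + 1" using nu nv by simp_all
  have fin: "finite A" "finite B" by simp_all
  define f where "f = (\<lambda>z. card (nbrs H z \<inter> B))"
  define g where "g = (\<lambda>z. card (nbrs H z \<inter> A))"
  define p where "p = card {(a, b). a \<in> A \<and> b \<in> B \<and> {a, b} \<in> H}"
  have pf: "p = (\<Sum>a\<in>A. f a)"
  proof -
    have "{(a, b). a \<in> A \<and> b \<in> B \<and> {a, b} \<in> H} = (SIGMA a:A. nbrs H a \<inter> B)" by (auto simp: nbrs_def)
    then show ?thesis unfolding p_def f_def by (simp add: card_SigmaI)
  qed
  have pg: "p = (\<Sum>b\<in>B. g b)"
  proof -
    have "{(a, b). a \<in> A \<and> b \<in> B \<and> {a, b} \<in> H} = prod.swap ` (SIGMA b:B. nbrs H b \<inter> A)"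
      by (force simp: nbrs_def insert_commute)
    then have "p = card (SIGMA b:B. nbrs H b \<inter> A)" unfolding p_def by (simp add: card_image)
    then show ?thesis unfolding g_def by (simp add: card_SigmaI)
  qed
  have AB: "A \<union> B \<subseteq> \<Union>E - {u, v}" using nu nv uA nbrs_vertex(2)[of _ E u] nbrs_vertex(2)[of _ E v] by blast
  have nz: "nbrs H z \<subseteq> nbrs E z" for z by (auto simp: nbrs_def H_def)
  have "2 * p = (\<Sum>z\<in>A \<union> B. (if z \<in> A then f z else 0) + (if z \<in> B then g z else 0))"
  proof -
    have "(\<Sum>z\<in>A \<union> B. if z \<in> A then f z else 0) = (\<Sum>z\<in>A. f z)"
      by (rule sum.mono_neutral_cong_right) auto
    moreover have "(\<Sum>z\<in>A \<union> B. if z \<in> B then g z else 0) = (\<Sum>z\<in>B. g z)"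
      by (rule sum.mono_neutral_cong_right) auto
    ultimately show ?thesis using pf pg by (simp add: sum.distrib)
  qed
  also have "\<dots> \<le> (\<Sum>z\<in>A \<union> B. 2 * (deg E z - 2))"
  proof (rule sum_mono)
    fix z assume z: "z \<in> A \<union> B"
    then have d3: "deg E z \<ge> 3" using AB deg by blast
    have uz: "u \<in> nbrs E z" if "z \<in> A"
      using that nu by (auto simp: nbrs_def insert_commute)
    have vz: "v \<in> nbrs E z" if "z \<in> B"
      using that nv by (auto simp: nbrs_def insert_commute)
    \<comment> \<open>Neither \<open>u\<close> nor \<open>v\<close> lies in \<open>A\<close> or
      \<open>B\<close> here, so both counts of a common neighbour are at most
      \<open>deg E z - 2\<close>. Any other vertex has a single count, at most
      \<open>deg E z - 1\<close>, and from degree three on this is at most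
      \<open>2 * (deg E z - 2)\<close>.\<close>
    show "(if z \<in> A then f z else 0) + (if z \<in> B then g z else 0) \<le> 2 * (deg E z - 2)"
    proof (cases "z \<in> A \<and> z \<in> B")
      case True
      have c: "card (nbrs E z - {u, v}) = deg E z - 2"
        using True uz vz u_v by (subst card_Diff_subset) auto
      have "f z \<le> card (nbrs E z - {u, v})" "g z \<le> card (nbrs E z - {u, v})"
        unfolding f_def g_def using nz[of z] uA nu nv by (auto intro!: card_mono)
      then show ?thesis using c True by simp
    next
      case False
      have "f z \<le> deg E z - 1" if "z \<in> A"
      proof -
        have "f z \<le> card (nbrs E z - {u})" unfolding f_def using nz[of z] nv by (auto intro!: card_mono)
        then show ?thesis using uz[OF that] by simp
      qed
      moreover have "g z \<le> deg E z - 1" if "z \<in> B"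
      proof -
        have "g z \<le> card (nbrs E z - {v})" unfolding g_def using nz[of z] nu by (auto intro!: card_mono)
        then show ?thesis using vz[OF that] by simp
      qed
      ultimately show ?thesis using False d3 z by auto
    qed
  qed
  also have "\<dots> = 2 * (\<Sum>z\<in>A \<union> B. deg E z - 2)" by (simp add: sum_distrib_left)
  finally have p: "p \<le> (\<Sum>z\<in>A \<union> B. deg E z - 2)" by simp
  have u: "u \<in> \<Union>E" "v \<in> \<Union>E" using uv by auto
  have "(\<Sum>z\<in>\<Union>E. deg E z - 2) = (\<Sum>z\<in>\<Union>E - {u, v}. deg E z - 2) + (\<Sum>z\<in>{u, v}. deg E z - 2)"
    by (rule sum.subset_diff) (use u in auto)
  moreover have "(\<Sum>z\<in>A \<union> B. deg E z - 2) \<le> (\<Sum>z\<in>\<Union>E - {u, v}. deg E z - 2)"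
    by (rule sum_mono2) (use AB in auto)
  moreover have "(\<Sum>z\<in>{u, v}. deg E z - 2) = (card A - 1) + (card B - 1)"
    using u_v du dv by simp
  ultimately have "p + (card A - 1) + (card B - 1) \<le> (\<Sum>z\<in>\<Union>E. deg E z - 2)" using p by linarith
  moreover have "card A \<ge> 2" "card B \<ge> 2" using deg u du dv by force+
  \<comment> \<open>The bound equals \<open>card A + card B + 1 + p\<close>. The degrees of
    \<open>u\<close> and \<open>v\<close> pay for \<open>card A - 1\<close> and
    \<open>card B - 1\<close>, which leaves the constant 3.\<close>
  moreover have "overlap E u v \<le> 2 * card (A \<inter> B) + 1 + p + card (B - A) + card (A - B)"
  proof -
    have "card {b \<in> B - A. nbrs H b \<inter> A \<noteq> {}} \<le> card (B - A)"
      "card {a \<in> A - B. nbrs H a \<inter> B \<noteq> {}} \<le> card (A - B)"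
      by (auto intro!: card_mono)
    then show ?thesis unfolding overlap_def Let_def H_def[symmetric] A_def[symmetric] B_def[symmetric] p_def
      by simp
  qed
  moreover have "card A = card (A \<inter> B) + card (A - B)" "card B = card (A \<inter> B) + card (B - A)"
    using card_Int_Diff[OF fin(1), of B] card_Int_Diff[OF fin(2), of A] by (simp_all add: Int_commute)
  ultimately show ?thesis by linarith
qed

section \<open>Nonnegativity and the equality case\<close>

text \<open>Without the edge \<open>vx\<close> the only neighbour of \<open>v\<close> is
  \<open>y\<close>, so short cycles through \<open>vx\<close> pass through \<open>y\<close>. The
  nonzero values are \<open>2 c + 1\<close>, where \<open>c\<close> is the cyclomatic number of the
  book or complete bipartite graph on \<open>x\<close>, \<open>y\<close> and
  \<open>insert v S\<close>.\<close>

lemma overlap_degree_2: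
  assumes E: "\<forall>e\<in>E. card e = 2" and v: "nbrs E v = {x, y}" "x \<noteq> y"
  defines "S \<equiv> nbrs E x \<inter> nbrs E y - {v}"
  shows "overlap E v x = (if {x, y} \<in> E then 3 + 2 * card S else if S = {} then 0 else 2 * card S + 1)"
    and "x \<notin> insert v S" "y \<notin> insert v S" "v \<notin> S" "biclique x y (insert v S) \<subseteq> E"
proof -
  have ne: "i \<noteq> j" if "{i, j} \<in> E" for i j using E that by force
  have noloop: "{i} \<notin> E" for i using ne[of i i] by auto
  have vE: "{v, w} \<in> E \<longleftrightarrow> w = x \<or> w = y" for w using v by (auto simp: nbrs_def)
  have vE': "{w, v} \<in> E \<longleftrightarrow> w = x \<or> w = y" for w using vE[of w] by (simp add: insert_commute)
  have vxy: "v \<noteq> x" "v \<noteq> y" using vE ne by blast+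
  show "x \<notin> insert v S" "y \<notin> insert v S" "v \<notin> S" using vxy noloop by (auto simp: S_def nbrs_def)
  show "biclique x y (insert v S) \<subseteq> E"
    using vE' by (auto simp: biclique_def S_def nbrs_def)
  let ?H = "E - {{v, x}}"
  have HE: "{k, l} \<in> ?H \<longleftrightarrow> {k, l} \<in> E \<and> \<not> (k = v \<and> l = x) \<and> \<not> (k = x \<and> l = v)" for k l
    by (auto simp: doubleton_eq_iff)
  have A: "nbrs ?H v = {y}" using vxy v(2) by (auto simp: nbrs_def HE vE)
  have B: "nbrs ?H x = nbrs E x - {v}" using vxy by (auto simp: nbrs_def HE)
  have yB: "y \<in> nbrs ?H x \<longleftrightarrow> {x, y} \<in> E" using vxy by (auto simp: B nbrs_def)
  have AB: "nbrs ?H v \<inter> nbrs ?H x = (if {x, y} \<in> E then {y} else {})" unfolding A using yB by auto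
  have Sy: "{y, b} \<in> ?H \<longleftrightarrow> {y, b} \<in> E" for b using vxy v(2) by (auto simp: HE)
  have p: "{(a, b). a \<in> nbrs ?H v \<and> b \<in> nbrs ?H x \<and> {a, b} \<in> ?H} = {y} \<times> S"
    unfolding A B using Sy by (auto simp: S_def nbrs_def)
  have q: "{b \<in> nbrs ?H x - nbrs ?H v. nbrs ?H b \<inter> nbrs ?H v \<noteq> {}} = S"
    unfolding A B using Sy noloop by (auto simp: S_def nbrs_def insert_commute)
  have r: "{a \<in> nbrs ?H v - nbrs ?H x. nbrs ?H a \<inter> nbrs ?H x \<noteq> {}} =
      (if {x, y} \<in> E \<or> S = {} then {} else {y})"
    unfolding A using yB Sy unfolding B by (auto simp: S_def nbrs_def)
  show "overlap E v x = (if {x, y} \<in> E then 3 + 2 * card S else if S = {} then 0 else 2 * card S + 1)"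
    unfolding overlap_def Let_def p q r AB by (simp add: card_cartesian_product)
qed

lemma nbrs_subset: "B \<subseteq> E \<Longrightarrow> nbrs B z \<subseteq> nbrs E z"
  by (auto simp: nbrs_def)

lemma deg_sum_ge:
  assumes "X \<subseteq> \<Union>E" "\<And>z. z \<in> X \<Longrightarrow> deg E z - 2 \<ge> k z"
  shows "(\<Sum>z\<in>\<Union>E. deg E z - 2) \<ge> (\<Sum>z\<in>X. k z)"
proof -
  have "(\<Sum>z\<in>X. k z) \<le> (\<Sum>z\<in>X. deg E z - 2)" by (rule sum_mono) (use assms in auto)
  also have "\<dots> \<le> (\<Sum>z\<in>\<Union>E. deg E z - 2)" by (rule sum_mono2) (use assms in auto)
  finally show ?thesis .
qed

text \<open>Minimum degree three leaves no room around a graph of one cycle less, except in \<open>K\<^sub>4\<close>.\<close>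

lemma min_degree_3_exceptional:
  assumes E: "\<forall>e\<in>E. card e = 2" and deg: "\<forall>z\<in>\<Union>E. deg E z \<ge> 3"
    and B: "exceptional B" "B \<subseteq> E - {e}" "e \<in> E" "cyc B = cyc E - 1"
  shows "exceptional E"
proof -
  have ne: "i \<noteq> j" if "{i, j} \<in> E" for i j using E that by force
  have noloop: "{i} \<notin> E" for i using ne[of i i] by auto
  have BE: "B \<subseteq> E" using B by blast
  have "E \<noteq> {}" "\<forall>z\<in>\<Union>E. deg E z \<ge> 2" using B(3) deg by force+
  \<comment> \<open>As \<open>cyc E = cyc B + 1\<close>, the total degree excess over two is at most
    \<open>2 * cyc B\<close>; each case compares this with the excess that is forced.\<close>
  from cyc_ge_sum_deg[OF E this] B(4)
  have tot: "int (\<Sum>z\<in>\<Union>E. deg E z - 2) \<le> 2 * cyc B" by linarith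
  have d1: "deg E z - 2 \<ge> 1" if "z \<in> \<Union>E" for z using deg that by force
  from B(1) show ?thesis
  proof (cases rule: exceptional_cases)
    case (bic x y W)
    have W: "W \<noteq> {}" using bic by auto
    have c: "cyc B = int (card W) - 1" using cyc_gamma2_biclique(1)[OF bic(1-3) W] bic by simp
    have X: "{x, y} \<union> W \<subseteq> \<Union>E"
    proof -
      have "{x, w} \<in> E" "{y, w} \<in> E" if "w \<in> W" for w
        using that BE bic(5) by (auto simp: biclique_iff)
      then show ?thesis using W by blast
    qed
    have "deg E z \<ge> card W" if "z \<in> {x, y}" for z
    proof -
      have "W \<subseteq> nbrs E z" using that nbrs_subset[OF BE] bic(5) by (auto simp: nbrs_def biclique_iff)
      then show ?thesis by (simp add: card_mono)
    qed
    then have "deg E z - 2 \<ge> (if z \<in> W then 1 else max (card W - 2) 1)" if "z \<in> {x, y} \<union> W" for z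
      using that d1[of z] X by (auto simp: diff_le_mono)
    from deg_sum_ge[OF X this]
    have "(\<Sum>z\<in>{x, y} \<union> W. if z \<in> W then 1 else max (card W - 2) 1) \<le> (\<Sum>z\<in>\<Union>E. deg E z - 2)" .
    moreover have "(\<Sum>z\<in>{x, y} \<union> W. if z \<in> W then 1 else max (card W - 2) 1) = 2 * max (card W - 2) 1 + card W"
      using bic by (subst sum.union_disjoint) auto
    \<comment> \<open>An excess of \<open>2 * max (card W - 2) 1 + card W\<close> is forced, but
      only \<open>2 * card W - 2\<close> is available, which is always less.\<close>
    ultimately show ?thesis using tot c bic(4) by linarith
  next
    case (tri x y W)
    have W: "W \<noteq> {}" using tri by auto
    have c: "cyc B = int (card W)" using cyc_gamma2_biclique(2)[OF tri(1-3)] tri by simp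
    have X: "{x, y} \<union> W \<subseteq> \<Union>E"
    proof -
      have "{x, w} \<in> E" "{y, w} \<in> E" if "w \<in> W" for w
        using that BE tri(5) by (auto simp: biclique_iff)
      then show ?thesis using W by blast
    qed
    have "deg E z \<ge> card W + 1" if "z \<in> {x, y}" for z
    proof -
      have "insert (if z = x then y else x) W \<subseteq> nbrs E z"
        using that nbrs_subset[OF BE] tri(1,5) by (auto simp: nbrs_def biclique_iff insert_commute)
      from card_mono[OF _ this] show ?thesis using tri by (simp split: if_splits)
    qed
    then have dW: "deg E z - 2 \<ge> card W - 1" if "z \<in> {x, y}" for z
      using that by fastforce
    have k: "deg E z - 2 \<ge> (if z \<in> W then 1 else max (card W - 1) 1)" if "z \<in> {x, y} \<union> W" for z
      using that d1[of z] dW[of z] X by (cases "z \<in> W") (simp, auto)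
    have s: "(\<Sum>z\<in>{x, y} \<union> W. if z \<in> W then 1 else max (card W - 1) 1) = 2 * max (card W - 1) 1 + card W"
      using tri by (subst sum.union_disjoint) auto
    with deg_sum_ge[OF X k] have le: "2 * max (card W - 1) 1 + card W \<le> (\<Sum>z\<in>\<Union>E. deg E z - 2)" by simp
    \<comment> \<open>Now \<open>2 * card W\<close> is available. This suffices only for two pages,
      and then exactly, so there is no room for a fifth vertex.\<close>
    with tot c tri(4) have W2: "card W = 2" by linarith
    have V: "\<Union>E = {x, y} \<union> W"
    proof (rule ccontr)
      assume "\<Union>E \<noteq> {x, y} \<union> W"
      then obtain z where z: "z \<in> \<Union>E" "z \<notin> {x, y} \<union> W" using X by blast
      have X': "insert z ({x, y} \<union> W) \<subseteq> \<Union>E" using X z by blast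
      have k': "deg E t - 2 \<ge> (if t \<in> W then 1 else max (card W - 1) 1)" if "t \<in> insert z ({x, y} \<union> W)" for t
      proof -
        have "t \<in> \<Union>E" using X' that by (rule subsetD)
        then show ?thesis using d1[of t] W2 by simp
      qed
      have "(\<Sum>t\<in>insert z ({x, y} \<union> W). if t \<in> W then 1 else max (card W - 1) 1) \<le> (\<Sum>z\<in>\<Union>E. deg E z - 2)"
        by (rule deg_sum_ge[OF X']) (rule k')
      with z have "1 + (\<Sum>z\<in>{x, y} \<union> W. if z \<in> W then 1 else max (card W - 1) 1) \<le> (\<Sum>z\<in>\<Union>E. deg E z - 2)"
        using W2 by (subst (asm) sum.insert) auto
      with s tot c W2 show False by linarith
    qed
    obtain v w where vw: "W = {v, w}" "v \<noteq> w" using W2 by (meson card_2_iff)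
    let ?S = "{x, y, v, w}"
    have S4: "card ?S = 4" using tri vw by auto
    have nz: "nbrs E z = ?S - {z}" if "z \<in> ?S" for z
    proof (rule card_seteq)
      show "nbrs E z \<subseteq> ?S - {z}"
        using nbrs_vertex(2)[of _ E z] noloop V vw by (auto simp: nbrs_def)
      show "card (?S - {z}) \<le> deg E z" using deg that V vw S4 by auto
    qed simp
    have "E = pairs ?S"
    proof (intro equalityI subsetI)
      fix f assume "f \<in> E"
      then show "f \<in> pairs ?S" using E V vw by (auto simp: pairs_def)
    next
      fix f assume "f \<in> pairs ?S"
      then obtain a b where ab: "f = {a, b}" "a \<noteq> b" "a \<in> ?S" "b \<in> ?S"
        unfolding pairs_def by (auto simp: card_2_iff)
      then have "b \<in> nbrs E a" using nz by auto
      then show "f \<in> E" using ab by (simp add: nbrs_def)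
    qed
    then show ?thesis using S4 unfolding exceptional_def by blast
  next
    case (K4 S)
    have c: "cyc B = 3" using cyc_gamma2_pairs[OF K4(1)] K4(2) by simp
    have nb: "S - {z} \<subseteq> nbrs E z" if "z \<in> S" for z
    proof
      fix w assume "w \<in> S - {z}"
      then have "{z, w} \<in> B" using K4 that by (auto simp: pairs_def)
      then show "w \<in> nbrs E z" using BE by (auto simp: nbrs_def)
    qed
    have S: "finite S" "S \<noteq> {}" using K4 by auto
    have SE: "S \<subseteq> \<Union>E"
    proof
      fix z assume z: "z \<in> S"
      have "card (S - {z}) = 3" using z K4(1) by simp
      then have "S - {z} \<noteq> {}" by (metis card.empty zero_neq_numeral)
      then obtain w where "w \<in> nbrs E z" using nb[OF z] by blast
      then show "z \<in> \<Union>E" by (rule nbrs_vertex(1))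
    qed
    \<comment> \<open>\<open>B\<close> already contains all pairs inside \<open>S\<close>, so the
      extra edge has an end \<open>z\<close> outside. Its neighbours are new vertices
      \<open>Q\<close> or vertices \<open>P\<close> of \<open>S\<close> with raised degree; as there
      are at least three, the excess is at least 8, while 6 is available.\<close>
    have "\<not> e \<subseteq> S" using B(2,3) E K4(2) by (auto simp: pairs_def)
    then obtain z where z: "z \<in> e" "z \<notin> S" by blast
    then have zE: "z \<in> \<Union>E" using B(3) by blast
    define P where "P = nbrs E z \<inter> S"
    define Q where "Q = nbrs E z - S"
    have X: "S \<union> insert z Q \<subseteq> \<Union>E" using SE zE nbrs_vertex(2)[of _ E z] by (auto simp: Q_def)
    have zQ: "z \<notin> Q" using noloop by (auto simp: Q_def nbrs_def)
    have k: "deg E t - 2 \<ge> (if t \<in> P then 2 else 1)" if "t \<in> S \<union> insert z Q" for t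
    proof (cases "t \<in> P")
      case True
      then have t: "t \<in> S" "z \<in> nbrs E t" by (auto simp: P_def nbrs_def insert_commute)
      then have "insert z (S - {t}) \<subseteq> nbrs E t" using nb by blast
      from card_mono[OF _ this] have "4 \<le> deg E t" using t z K4(1) S by simp
      then show ?thesis using True by simp
    next
      case False
      then show ?thesis using d1[OF subsetD[OF X that]] by simp
    qed
    have "(\<Sum>t\<in>S \<union> insert z Q. if t \<in> P then 2 else 1) = (\<Sum>t\<in>S \<union> insert z Q. 1 + (if t \<in> P then 1 else 0 :: nat))"
      by (rule sum.cong) auto
    also have "\<dots> = card (S \<union> insert z Q) + card P"
    proof -
      have "(\<Sum>t\<in>S \<union> insert z Q. if t \<in> P then 1 else 0 :: nat) = card P"
        by (subst sum.If_cases) (auto simp: P_def intro!: arg_cong[where f = card])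
      then show ?thesis by (simp only: sum.distrib) simp
    qed
    also have "card (S \<union> insert z Q) = 4 + (1 + card Q)"
      using z zQ K4(1) S by (subst card_Un_disjoint) (auto simp: Q_def)
    finally have "5 + card Q + card P \<le> (\<Sum>z\<in>\<Union>E. deg E z - 2)" using deg_sum_ge[OF X k] by simp
    moreover have "card P + card Q \<ge> 3"
    proof -
      have "deg E z \<ge> 3" using deg zE by blast
      then show ?thesis using card_Int_Diff[of "nbrs E z" S] by (simp add: P_def Q_def)
    qed
    ultimately show ?thesis using tot c by linarith
  qed
qed

text \<open>Both claims share one induction, because equality for \<open>E\<close> can pass to the
  graph with one edge less, whose classification is then used. At a vertex of degree two only the
  inequality for the smaller graph is needed.\<close>

lemma gamma2_nonneg_and_equality:
  assumes "\<forall>e\<in>E. card e = 2"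
  shows "gamma2 E \<ge> 0 \<and> (gamma2 E = 0 \<longrightarrow> cyc E = 0 \<or> (\<exists>B\<subseteq>E. exceptional B \<and> cyc B = cyc E))"
  using assms
proof (induction "card E" arbitrary: E rule: less_induct)
  case less
  note E = less.prems
  have del: "card (E - {e}) < card E" "\<forall>f\<in>E - {e}. card f = 2" if "e \<in> E" for e
    using card_Diff1_less[of E e] that E by simp_all
  have IH: "gamma2 (E - {e}) \<ge> 0 \<and> (gamma2 (E - {e}) = 0 \<longrightarrow> cyc (E - {e}) = 0 \<or>
      (\<exists>B\<subseteq>E - {e}. exceptional B \<and> cyc B = cyc (E - {e})))" if "e \<in> E" for e
    using less.hyps[OF del(1)[OF that]] del(2)[OF that] by blast
  have ne: "i \<noteq> j" if "{i, j} \<in> E" for i j using E that by force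
  have "cyc (E - {{u, v}}) = cyc E \<or> (u, v) \<in> (joins (E - {{u, v}}))\<^sup>*" if "{u, v} \<in> E" for u v
    using cyc_delete[OF that] by (auto split: if_splits)
  then consider (empty) "E = {}" | (bridge) u v where "{u, v} \<in> E" "cyc (E - {{u, v}}) = cyc E"
    | (cyclic) "E \<noteq> {}" "\<And>u v. {u, v} \<in> E \<Longrightarrow> (u, v) \<in> (joins (E - {{u, v}}))\<^sup>*"
    by blast
  then show ?case
  proof cases
    case empty
    then show ?thesis by (simp add: gamma2_empty cyc_empty)
  next
    case bridge
    from IH[OF bridge(1)] gamma2_delete_bridge[OF E bridge] bridge(2) show ?thesis by auto
  next
    case cyclic
    have c1: "cyc (E - {{u, v}}) = cyc E - 1" if "{u, v} \<in> E" for u v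
      using cyc_delete[OF that] cyclic(2)[OF that] by simp
    have g: "gamma2 E = gamma2 (E - {{u, v}}) + 2 * (2 * cyc E + 1 - int (overlap E u v))"
      if "{u, v} \<in> E" for u v using gamma2_delete_nonbridge[OF E that c1[OF that]] .
    \<comment> \<open>The edge \<open>zw\<close> is not a bridge, so the detour from
      \<open>z\<close> to \<open>w\<close> leaves \<open>z\<close> through a second
      neighbour.\<close>
    have deg2: "deg E z \<ge> 2" if "z \<in> \<Union>E" for z
    proof -
      from that obtain e where e: "e \<in> E" "z \<in> e" by blast
      with E obtain a b where "e = {a, b}" by (metis card_2_iff)
      with e have "{z, b} \<in> E \<or> {z, a} \<in> E" by (auto simp: insert_commute)
      then obtain w where zw: "{z, w} \<in> E" by blast
      have "(z, w) \<in> (joins (E - {{z, w}}))\<^sup>*" using cyclic(2)[OF zw] .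
      then obtain w' where "(z, w') \<in> joins (E - {{z, w}})"
        using ne[OF zw] by (metis converse_rtranclE)
      then have "{w, w'} \<subseteq> nbrs E z" "w \<noteq> w'" using zw by (auto simp: nbrs_def)
      with card_mono[OF _ this(1)] show ?thesis by simp
    qed
    show ?thesis
    proof (cases "\<exists>v\<in>\<Union>E. deg E v = 2")
      case True
      then obtain v x y where v: "nbrs E v = {x, y}" "x \<noteq> y" by (metis card_2_iff)
      define S where "S = nbrs E x \<inter> nbrs E y - {v}"
      note o = overlap_degree_2[OF E v, folded S_def]
      have vx: "{v, x} \<in> E" using v by (auto simp: nbrs_def)
      have H: "gamma2 (E - {{v, x}}) \<ge> 0" using IH[OF vx] by blast
      have cW: "card (insert v S) = card S + 1" using o(4) by simp
      show ?thesis
      proof (cases "{x, y} \<in> E")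
        case True
        let ?B = "insert {x, y} (biclique x y (insert v S))"
        have B: "?B \<subseteq> E" "cyc ?B = int (card S) + 1"
          using True o(5) cyc_gamma2_biclique(2)[OF v(2) o(2,3)] cW by simp_all
        have ex: "exceptional ?B" unfolding exceptional_def using v(2) o(2,3) cW by (metis le_add2)
        \<comment> \<open>The overlap is \<open>2 * cyc ?B + 1\<close>, so the change of gamma_2 is
          \<open>4 * (cyc E - cyc ?B)\<close> and vanishes only if \<open>?B\<close> carries all
          cycles.\<close>
        have "cyc ?B \<le> cyc E" using cyc_mono[OF B(1) E] .
        with g[OF vx] H o(1) True B(2) have "gamma2 E \<ge> 0 \<and> (gamma2 E = 0 \<longrightarrow> cyc ?B = cyc E)" by simp
        with B(1) ex show ?thesis by blast
      next
        case nxy: False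
        show ?thesis
        proof (cases "S = {}")
          case True
          then have "gamma2 E > 0" using g[OF vx] H o(1) nxy cyc_nonneg[OF E] by simp
          then show ?thesis by simp
        next
          case False
          let ?B = "biclique x y (insert v S)"
          have B: "?B \<subseteq> E" "cyc ?B = int (card S)"
            using o(5) cyc_gamma2_biclique(1)[OF v(2) o(2,3)] cW by simp_all
          have "card S > 0" using False by (simp add: card_gt_0_iff)
          then have "card (insert v S) \<ge> 2" using cW by simp
          with v(2) o(2,3) have ex: "exceptional ?B"
            unfolding exceptional_def by (intro disjI1 exI[of _ x] exI[of _ y] exI[of _ "insert v S"]) simp
          have "cyc ?B \<le> cyc E" using cyc_mono[OF B(1) E] .
          with g[OF vx] H o(1) nxy False B(2) have "gamma2 E \<ge> 0 \<and> (gamma2 E = 0 \<longrightarrow> cyc ?B = cyc E)" by simp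
          with B(1) ex show ?thesis by blast
        qed
      qed
    next
      case False
      then have deg3: "\<forall>z\<in>\<Union>E. deg E z \<ge> 3" using deg2 by force
      obtain u v where uv: "{u, v} \<in> E" using cyclic(1) E by (metis all_not_in_conv card_2_iff)
      define M where "M = (\<Sum>z\<in>\<Union>E. deg E z - 2)"
      have lb: "2 * cyc E \<ge> 2 + int M"
        using cyc_ge_sum_deg[OF E cyclic(1)] deg2 unfolding M_def by blast
      moreover have "overlap E u v \<le> 3 + M"
        using overlap_le_sum_deg[OF E deg3 uv] unfolding M_def .
      ultimately have "2 * cyc E + 1 - int (overlap E u v) \<ge> 0" by linarith
      then have le: "gamma2 (E - {{u, v}}) \<le> gamma2 E"
        using g[OF uv] by simp
      have "gamma2 E = 0 \<longrightarrow> exceptional E"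
      proof
        assume "gamma2 E = 0"
        with le IH[OF uv] have "gamma2 (E - {{u, v}}) = 0" by linarith
        with IH[OF uv] consider "cyc (E - {{u, v}}) = 0"
          | B where "B \<subseteq> E - {{u, v}}" "exceptional B" "cyc B = cyc (E - {{u, v}})" by blast
        then show "exceptional E"
        proof cases
          case 1
          \<comment> \<open>Here \<open>cyc E = 1\<close>, but the degrees give
            \<open>2 * cyc E \<ge> 2 + M\<close> with \<open>M \<ge> 1\<close>.\<close>
          have "u \<in> \<Union>E" using uv by blast
          then have "deg E u - 2 \<le> M" unfolding M_def by (intro member_le_sum) auto
          moreover have "deg E u \<ge> 3" using deg3 \<open>u \<in> \<Union>E\<close> by blast
          ultimately show ?thesis using lb 1 c1[OF uv] by linarith
        next
          case 2
          with min_degree_3_exceptional[OF E deg3, of B "{u, v}"] uv c1[OF uv] show ?thesis by simp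
        qed
      qed
      moreover have "gamma2 E \<ge> 0" using le IH[OF uv] by linarith
      ultimately show ?thesis using subset_refl[of E] by blast
    qed
  qed
qed

lemma gamma2_eq_0_iff:
  assumes E: "\<forall>e\<in>E. card e = 2"
  shows "gamma2 E = 0 \<longleftrightarrow> cyc E = 0 \<or> (\<exists>B\<subseteq>E. exceptional B \<and> cyc B = cyc E)"
proof
  assume "cyc E = 0 \<or> (\<exists>B\<subseteq>E. exceptional B \<and> cyc B = cyc E)"
  then show "gamma2 E = 0"
  proof
    assume "cyc E = 0"
    then show ?thesis using gamma2_subgraph[OF E, of "{}"] by (simp add: cyc_empty gamma2_empty)
  next
    assume "\<exists>B\<subseteq>E. exceptional B \<and> cyc B = cyc E"
    then show ?thesis using gamma2_subgraph[OF E] gamma2_exceptional(1) by metis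
  qed
qed (use gamma2_nonneg_and_equality[OF E] in blast)

section \<open>Cycles and 2-connected components\<close>

lemma rtrancl_imp_distinct_path:
  assumes "(u, v) \<in> R\<^sup>*"
  shows "\<exists>p. p \<noteq> [] \<and> hd p = u \<and> last p = v \<and> distinct p \<and> successively (\<lambda>a b. (a, b) \<in> R) p"
  using assms
proof (induction rule: converse_rtrancl_induct)
  case base
  show ?case by (intro exI[of _ "[v]"]) simp
next
  case (step u w)
  then obtain p where p: "p \<noteq> []" "hd p = w" "last p = v" "distinct p"
    "successively (\<lambda>a b. (a, b) \<in> R) p" by blast
  show ?case
  proof (cases "u \<in> set p")
    case False
    with p step(1) show ?thesis by (intro exI[of _ "u # p"]) (simp add: successively_Cons)
  next
    case True
    \<comment> \<open>If \<open>u\<close> already occurs on the path, the part before it is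
      dropped.\<close>
    then obtain xs ys where xy: "p = xs @ u # ys" by (meson split_list)
    with p show ?thesis by (intro exI[of _ "u # ys"]) (auto simp: successively_append_iff)
  qed
qed

lemma nonbridge_imp_distinct_path:
  assumes "(u, v) \<in> (joins (E - {{u, v}}))\<^sup>*" "u \<noteq> v"
  obtains p where "length p \<ge> 3" "hd p = u" "last p = v" "distinct p" "successively (\<lambda>a b. {a, b} \<in> E) p"
proof -
  obtain p where p: "p \<noteq> []" "hd p = u" "last p = v" "distinct p"
    "successively (\<lambda>a b. (a, b) \<in> joins (E - {{u, v}})) p"
    using rtrancl_imp_distinct_path[OF assms(1)] by blast
  have "length p \<ge> 3"
  proof (rule ccontr)
    assume "\<not> length p \<ge> 3"
    with p(1) consider a where "p = [a]" | a b where "p = [a, b]"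
      by (cases p; cases "tl p"; cases "tl (tl p)") auto
    then show False using p assms(2) by cases auto
  qed
  moreover have "successively (\<lambda>a b. {a, b} \<in> E) p"
    by (rule successively_mono[OF p(5)]) auto
  ultimately show thesis using that p by blast
qed

text \<open>The ends of the closing edge are still connected by the rest of the cycle, so deleting
  that edge lowers the cyclomatic number.\<close>

lemma is_cycle_imp_cyc_pos:
  assumes E: "\<forall>e\<in>E. card e = 2" and c: "is_cycle (UNIV, E) c"
  shows "cyc E > 0"
proof -
  let ?n = "length c"
  have n: "?n \<ge> 3" and dist: "distinct c"
    and edge: "\<And>i. i < ?n \<Longrightarrow> {c ! i, c ! (Suc i mod ?n)} \<in> E"
    using c by (auto simp: is_cycle_def)
  let ?u = "c ! 0" and ?v = "c ! (?n - 1)"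
  have uv: "{?u, ?v} \<in> E" 
  proof -
    have "Suc (?n - 1) = ?n" "?n - 1 < ?n" using n by auto
    with edge[of "?n - 1"] show ?thesis by (simp only: mod_self) (simp add: insert_commute)
  qed
  have "(?u, c ! i) \<in> (joins (E - {{?u, ?v}}))\<^sup>*" if "i < ?n" for i
    using that
  proof (induction i)
    case (Suc i)
    have "{c ! i, c ! Suc i} \<in> E" using edge[of i] Suc.prems by simp
    moreover have "{c ! i, c ! Suc i} \<noteq> {?u, ?v}"
    proof
      assume "{c ! i, c ! Suc i} = {?u, ?v}"
      then have "c ! i = ?u \<and> c ! Suc i = ?v \<or> c ! i = ?v \<and> c ! Suc i = ?u"
        by (auto simp: doubleton_eq_iff)
      moreover have "?n - 1 < ?n" "0 < ?n" using n by auto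
      ultimately have "i = 0 \<and> Suc i = ?n - 1 \<or> i = ?n - 1 \<and> Suc i = 0"
        using nth_eq_iff_index_eq[OF dist] Suc.prems by (metis Suc_lessD)
      then show False using n by auto
    qed
    ultimately have "(c ! i, c ! Suc i) \<in> joins (E - {{?u, ?v}})" by simp
    with Suc show ?case by (meson Suc_lessD rtrancl_into_rtrancl)
  qed simp
  from this[of "?n - 1"] n have "(?u, ?v) \<in> (joins (E - {{?u, ?v}}))\<^sup>*" by simp
  with cyc_delete[OF uv] cyc_nonneg[of "E - {{?u, ?v}}"] E show ?thesis by simp
qed

text \<open>A bridge of \<open>E\<close> is a bridge of every subgraph containing it, so adding the
  edges outside \<open>F\<close> one by one never closes a cycle.\<close>

lemma cyc_eq_if_bridges:
  assumes E: "\<forall>e\<in>E. card e = 2" and "F \<subseteq> E"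
    and br: "\<And>u v. {u, v} \<in> E - F \<Longrightarrow> (u, v) \<notin> (joins (E - {{u, v}}))\<^sup>*"
  shows "cyc F = cyc E"
proof -
  have "cyc (F \<union> X) = cyc F" if "X \<subseteq> E - F" for X
    using finite[of X] that
  proof (induction X rule: finite_induct)
    case (insert e X)
    obtain u v where e: "e = {u, v}" using insert.prems E by (metis Diff_iff card_2_iff insert_subset)
    have "F \<union> X \<subseteq> E - {{u, v}}" using insert assms(2) e by auto
    then have "joins (F \<union> X) \<subseteq> joins (E - {{u, v}})" by auto
    from rtrancl_mono[OF this] br[of u v] have "(u, v) \<notin> (joins (F \<union> X))\<^sup>*"
      using insert.prems e by blast
    moreover have "{u, v} \<notin> F \<union> X" using insert e by auto
    ultimately have "cyc (insert {u, v} (F \<union> X)) = cyc (F \<union> X)" by (simp add: cyc_insert)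
    then show ?case using insert e by simp
  qed simp
  from this[of "E - F"] show ?thesis using assms(2) by (simp add: Un_absorb1)
qed

lemma forest_iff_cyc:
  assumes E: "\<forall>e\<in>E. card e = 2"
  shows "forest (UNIV, E) \<longleftrightarrow> cyc E = 0"
proof
  assume "cyc E = 0"
  then show "forest (UNIV, E)" using is_cycle_imp_cyc_pos[OF E] by (force simp: forest_def)
next
  assume f: "forest (UNIV, E)"
  have "(u, v) \<notin> (joins (E - {{u, v}}))\<^sup>*" if uv: "{u, v} \<in> E" for u v
  proof
    assume "(u, v) \<in> (joins (E - {{u, v}}))\<^sup>*"
    moreover have "u \<noteq> v" using E uv by force
    ultimately obtain p where p: "length p \<ge> 3" "hd p = u" "last p = v" "distinct p"
      "successively (\<lambda>a b. {a, b} \<in> E) p" by (rule nonbridge_imp_distinct_path)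
    have "{p ! i, p ! (Suc i mod length p)} \<in> E" if "i < length p" for i
    proof (cases "Suc i < length p")
      case True
      with p(5) show ?thesis by (simp add: successively_conv_nth)
    next
      case False
      with that have "Suc i = length p" by simp
      moreover have "p \<noteq> []" using p(1) by auto
      ultimately show ?thesis
        using p(2,3) uv by (metis diff_Suc_1 hd_conv_nth insert_commute last_conv_nth mod_self)
    qed
    then have "is_cycle (UNIV, E) p" using p by (simp add: is_cycle_def)
    with f show False by (auto simp: forest_def)
  qed
  with cyc_eq_if_bridges[OF E, of "{}"] show "cyc E = 0" by (simp add: cyc_empty)
qed

section \<open>2-connected subgraphs and maximal ones\<close>

lemma connected_graphI:
  assumes "r \<in> V" "\<And>z. z \<in> V \<Longrightarrow> (r, z) \<in> (joins F)\<^sup>*"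
  shows "connected_graph (V, F)"
proof -
  have "(u, v) \<in> (joins F)\<^sup>*" if "u \<in> V" "v \<in> V" for u v
    using joins_sym[OF assms(2)[OF that(1)]] assms(2)[OF that(2)] by (rule rtrancl_trans)
  with assms(1) show ?thesis unfolding connected_graph_def by auto
qed

lemma connected_graph_successively:
  assumes "L \<noteq> []" "successively (\<lambda>a b. {a, b} \<in> F) L"
  shows "connected_graph (set L, F)"
proof (rule connected_graphI)
  show "hd L \<in> set L" using assms by simp
  show "(hd L, z) \<in> (joins F)\<^sup>*" if "z \<in> set L" for z
    using assms that
  proof (induction L)
    case (Cons a L)
    show ?case
    proof (cases "z = a")
      case False
      then have z: "z \<in> set L" "L \<noteq> []" using Cons.prems(3) by auto
      then have "(a, hd L) \<in> joins F" "successively (\<lambda>a b. {a, b} \<in> F) L"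
        using Cons.prems(2) by (auto simp: successively_Cons)
      with Cons.IH z have "(a, hd L) \<in> joins F" "(hd L, z) \<in> (joins F)\<^sup>*" by auto
      then show ?thesis by (simp add: converse_rtrancl_into_rtrancl)
    qed simp
  qed simp
qed

text \<open>Removing \<open>z\<close> from the cyclic order leaves the path \<open>ys @ xs\<close>,
  joined across the closing edge. Chords inside the vertex set are kept and do not affect
  connectivity.\<close>

lemma two_connected_cycle:
  assumes p: "length p \<ge> 3" "distinct p" "successively (\<lambda>a b. {a, b} \<in> E) p" "{hd p, last p} \<in> E"
  shows "two_connected (set p, {e \<in> E. e \<subseteq> set p})"
proof -
  let ?F = "{e \<in> E. e \<subseteq> set p}"
  have pn: "p \<noteq> []" using p(1) by auto
  have s: "successively (\<lambda>a b. {a, b} \<in> ?F) p"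
    by (rule successively_mono[OF p(3)]) auto
  have c: "connected_graph (set p, ?F)" by (rule connected_graph_successively[OF pn s])
  have "connected_graph (delete_vertex (set p, ?F) z)" if "z \<in> set p" for z
  proof -
    from that obtain xs ys where xy: "p = xs @ z # ys" by (meson split_list)
    have ne: "ys @ xs \<noteq> []" using p(1) xy by (cases xs; cases ys) auto
    have V: "set p - {z} = set (ys @ xs)" using p(2) xy by auto
    have "successively (\<lambda>a b. {a, b} \<in> ?F) (ys @ xs)"
    proof (cases "xs = [] \<or> ys = []")
      case True
      with s xy show ?thesis by (auto simp: successively_append_iff successively_Cons)
    next
      case False
      then have "hd p = hd xs" "last p = last ys" using xy by auto
      moreover have "hd xs \<in> set p" "last ys \<in> set p" using xy False by auto
      ultimately have "{last ys, hd xs} \<in> ?F" using p(4) by (simp add: insert_commute)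
      with s xy False show ?thesis by (simp add: successively_append_iff successively_Cons)
    qed
    then have "successively (\<lambda>a b. {a, b} \<in> {e \<in> ?F. z \<notin> e}) (ys @ xs)"
      by (rule successively_mono) (use V in auto)
    from connected_graph_successively[OF ne this] show ?thesis
      by (simp add: delete_vertex_def V)
  qed
  moreover have "card (set p) \<ge> 3" using p(1,2) by (simp add: distinct_card)
  ultimately show ?thesis unfolding two_connected_def using c by simp
qed

lemma single_edge_card: "single_edge G \<Longrightarrow> card (fst G) = 2"
  by (auto simp: single_edge_def)

text \<open>A third vertex \<open>w\<close> is reached from \<open>u\<close> avoiding
  \<open>v\<close>, and \<open>v\<close> is reached from \<open>w\<close> avoiding \<open>u\<close>;
  neither walk uses the edge \<open>uv\<close>.\<close>

lemma two_connected_edge_nonbridge: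
  assumes H: "two_connected H" "card (fst H) \<ge> 3" "simple_graph H" and uv: "{u, v} \<in> snd H"
  shows "(u, v) \<in> (joins (snd H - {{u, v}}))\<^sup>*"
proof -
  obtain V F where VF: "H = (V, F)" by (cases H)
  have conn: "connected_graph (delete_vertex (V, F) z)" if "z \<in> V" for z
    using H VF single_edge_card[of H] that by (auto simp: two_connected_def)
  have "{u, v} \<subseteq> V" "card {u, v} = 2" using H(3) uv VF by (auto simp: simple_graph_def)
  then have uV: "u \<in> V" "v \<in> V" "u \<noteq> v" by auto
  have "finite V" using H(3) VF by (simp add: simple_graph_def)
  have "\<not> V \<subseteq> {u, v}"
  proof
    assume "V \<subseteq> {u, v}"
    then have "card V \<le> card {u, v}" by (intro card_mono) auto
    then show False using uV H(2) VF by simp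
  qed
  then obtain w where w: "w \<in> V" "w \<noteq> u" "w \<noteq> v" by blast
  have sub: "joins {e \<in> F. z \<notin> e} \<subseteq> joins (F - {{u, v}})" if "z = u \<or> z = v" for z
    using that by auto
  have "(u, w) \<in> (joins {e \<in> F. v \<notin> e})\<^sup>*"
    using conn[OF uV(2)] uV w by (simp add: connected_graph_def delete_vertex_def)
  then have 1: "(u, w) \<in> (joins (F - {{u, v}}))\<^sup>*" using rtrancl_mono[OF sub[of v]] by blast
  have "(w, v) \<in> (joins {e \<in> F. u \<notin> e})\<^sup>*"
    using conn[OF uV(1)] uV w by (simp add: connected_graph_def delete_vertex_def)
  then have "(w, v) \<in> (joins (F - {{u, v}}))\<^sup>*" using rtrancl_mono[OF sub[of u]] by blast
  with 1 show ?thesis unfolding VF by simp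
qed

lemma two_connected_vertices:
  assumes H: "two_connected H" "simple_graph H"
  shows "fst H = \<Union>(snd H)"
proof -
  obtain V F where VF: "H = (V, F)" by (cases H)
  show ?thesis
  proof (cases "single_edge H")
    case True
    then show ?thesis by (auto simp: single_edge_def)
  next
    case False
    then have c: "connected_graph (V, F)" "card V \<ge> 3" using H VF by (auto simp: two_connected_def)
    have "z \<in> \<Union>F" if z: "z \<in> V" for z
    proof -
      have "\<not> V \<subseteq> {z}"
      proof
        assume "V \<subseteq> {z}"
        then have "card V \<le> card {z}" by (intro card_mono) auto
        then show False using c(2) by simp
      qed
      then obtain w where "w \<in> V" "w \<noteq> z" by blast
      then have "(z, w) \<in> (joins F)\<^sup>*" using c(1) z by (simp add: connected_graph_def)
      with \<open>w \<noteq> z\<close> obtain w' where "{z, w'} \<in> F" by (auto elim: converse_rtranclE)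
      then show ?thesis by blast
    qed
    moreover have "\<Union>F \<subseteq> V" using H(2) VF by (auto simp: simple_graph_def)
    ultimately show ?thesis using VF by auto
  qed
qed

text \<open>Among the finitely many 2-connected subgraphs above \<open>H\<close>, one with the most
  vertices and edges in total is inclusion-maximal.\<close>

lemma ex_two_connected_component:
  fixes G :: "'n::finite graph"
  assumes "subgraph H G" "two_connected H"
  shows "\<exists>C\<in>two_connected_components G. subgraph H C"
proof -
  let ?P = "\<lambda>C :: 'n graph. subgraph C G \<and> two_connected C \<and> subgraph H C"
  let ?f = "\<lambda>C :: 'n graph. card (fst C) + card (snd C)"
  have "?P H" using assms by (auto simp: subgraph_def)
  moreover have "\<forall>C. ?P C \<longrightarrow> ?f C < CARD('n) + CARD('n set) + 1"
  proof (intro allI impI)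
    fix C :: "'n graph"
    have "card (fst C) \<le> CARD('n)" "card (snd C) \<le> CARD('n set)"
      by (rule card_mono[OF finite subset_UNIV])+
    then show "?f C < CARD('n) + CARD('n set) + 1" by linarith
  qed
  ultimately obtain C where C: "?P C" "\<forall>C'. ?P C' \<longrightarrow> ?f C' \<le> ?f C"
    using ex_has_greatest_nat[of ?P H ?f] by blast
  have "H' = C" if H': "subgraph H' G" "two_connected H'" "subgraph C H'" for H'
  proof -
    have s: "fst C \<subseteq> fst H'" "snd C \<subseteq> snd H'" using H'(3) by (auto simp: subgraph_def)
    have "?P H'" using H' C(1) by (auto simp: subgraph_def)
    with C(2) have le: "?f H' \<le> ?f C" by blast
    have "card (fst C) \<le> card (fst H')" "card (snd C) \<le> card (snd H')" using s by (simp_all add: card_mono)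
    with le have "card (fst H') \<le> card (fst C)" "card (snd H') \<le> card (snd C)" by linarith+
    with s have "fst C = fst H'" "snd C = snd H'" by (simp_all add: card_seteq)
    then show ?thesis by (simp add: prod_eq_iff)
  qed
  with C(1) have "C \<in> two_connected_components G" by (auto simp: two_connected_components_def)
  with C(1) show ?thesis by blast
qed

section \<open>Exceptional blocks up to isomorphism\<close>

text \<open>The isomorphism is inverted into a labelling of \<open>H\<close> by the model
  \<open>K\<close>, so that the parts of the model appear as images. Edges lying inside the vertex
  set let a map and its inverse cancel on them.\<close>

lemma graph_isomorphic_iff:
  assumes "snd H \<subseteq> Pow (fst H)" "snd K \<subseteq> Pow (fst K)"
  shows "graph_isomorphic H K \<longleftrightarrow>
    (\<exists>g. inj_on g (fst K) \<and> fst H = g ` fst K \<and> snd H = (\<lambda>e. g ` e) ` snd K)"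
proof
  assume "graph_isomorphic H K"
  then obtain f where f: "bij_betw f (fst H) (fst K)" "snd K = (\<lambda>e. f ` e) ` snd H"
    by (auto simp: graph_isomorphic_def)
  let ?g = "inv_into (fst H) f"
  have b: "bij_betw ?g (fst K) (fst H)" using f(1) by (rule bij_betw_inv_into)
  have "?g ` f ` e = e" if "e \<in> snd H" for e
    using f(1) assms(1) that by (intro inv_into_image_cancel) (auto simp: bij_betw_def)
  then have "(\<lambda>e. ?g ` e) ` snd K = snd H" unfolding f(2) image_image by simp
  with b show "\<exists>g. inj_on g (fst K) \<and> fst H = g ` fst K \<and> snd H = (\<lambda>e. g ` e) ` snd K"
    by (intro exI[of _ ?g]) (simp add: bij_betw_def)
next
  assume "\<exists>g. inj_on g (fst K) \<and> fst H = g ` fst K \<and> snd H = (\<lambda>e. g ` e) ` snd K"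
  then obtain g where g: "inj_on g (fst K)" "fst H = g ` fst K" "snd H = (\<lambda>e. g ` e) ` snd K" by blast
  let ?f = "inv_into (fst K) g"
  have "bij_betw g (fst K) (fst H)" using g(1,2) by (simp add: bij_betw_def)
  then have "bij_betw ?f (fst H) (fst K)" by (rule bij_betw_inv_into)
  moreover have "?f ` g ` e = e" if "e \<in> snd K" for e
    using g(1) assms(2) that by (intro inv_into_image_cancel) auto
  then have "snd K = (\<lambda>e. ?f ` e) ` snd H" unfolding g(3) image_image by simp
  ultimately show "graph_isomorphic H K" by (auto simp: graph_isomorphic_def)
qed

lemma image_biclique:
  "(\<lambda>e. g ` e) ` snd (complete_bipartite {a, b} W) = biclique (g a) (g b) (g ` W)"
  unfolding complete_bipartite_def biclique_def snd_conv by (auto simp: image_iff) blast+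

lemma Union_biclique: "W \<noteq> {} \<Longrightarrow> \<Union>(biclique x y W) = {x, y} \<union> W"
  by (auto simp: biclique_def)

lemma Union_pairs:
  assumes "card S = 4"
  shows "\<Union>(pairs S) = S"
proof (intro equalityI subsetI)
  fix z assume z: "z \<in> S"
  then have "card (S - {z}) = 3" using assms by simp
  then obtain w where "w \<in> S - {z}" by (metis card.empty ex_in_conv zero_neq_numeral)
  then have "{z, w} \<in> pairs S" using z by (auto simp: pairs_def)
  then show "z \<in> \<Union>(pairs S)" by blast
qed (auto simp: pairs_def)

lemma image_pairs:
  assumes "inj_on g S"
  shows "(\<lambda>e. g ` e) ` pairs S = pairs (g ` S)"
proof (intro equalityI subsetI)
  fix e assume "e \<in> (\<lambda>e. g ` e) ` pairs S"
  then show "e \<in> pairs (g ` S)"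
    using assms by (auto simp: pairs_def card_image inj_on_subset)
next
  fix e assume "e \<in> pairs (g ` S)"
  then obtain e' where "e' \<subseteq> S" "e = g ` e'" "card e = 2" by (auto simp: pairs_def subset_image_iff)
  moreover from this have "card e' = 2" using assms by (metis card_image inj_on_subset)
  ultimately show "e \<in> (\<lambda>e. g ` e) ` pairs S" by (auto simp: pairs_def)
qed

lemma graph_isomorphic_K2_iff:
  assumes "snd H \<subseteq> Pow (fst H)" "l \<ge> 1"
  shows "graph_isomorphic H (K2_graph l) \<longleftrightarrow>
    (\<exists>x y W. x \<noteq> y \<and> x \<notin> W \<and> y \<notin> W \<and> card W = l \<and> fst H = {x, y} \<union> W \<and> snd H = biclique x y W)"
proof -
  have K: "snd (K2_graph l) \<subseteq> Pow (fst (K2_graph l))"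
    "fst (K2_graph l) = {1, 2} \<union> {3..l + 2}"
    by (auto simp: K2_graph_def complete_bipartite_def)
  show ?thesis unfolding graph_isomorphic_iff[OF assms(1) K(1)] K(2)
  proof
    assume "\<exists>g. inj_on g ({1, 2} \<union> {3..l + 2}) \<and> fst H = g ` ({1, 2} \<union> {3..l + 2}) \<and>
      snd H = (`) g ` snd (K2_graph l)"
    then obtain g where g: "inj_on g ({1, 2} \<union> {3..l + 2})" "fst H = g ` ({1, 2} \<union> {3..l + 2})"
      "snd H = (`) g ` snd (K2_graph l)" by blast
    have d: "g 1 \<noteq> g 2" "g 1 \<notin> g ` {3..l + 2}" "g 2 \<notin> g ` {3..l + 2}"
      using g(1) by (auto simp: inj_on_def)
    have "card (g ` {3..l + 2}) = l" using g(1) by (subst card_image) (auto simp: inj_on_def)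
    with d g(2,3) show "\<exists>x y W. x \<noteq> y \<and> x \<notin> W \<and> y \<notin> W \<and> card W = l \<and> fst H = {x, y} \<union> W \<and> snd H = biclique x y W"
      unfolding K2_graph_def image_biclique
      by (intro exI[of _ "g 1"] exI[of _ "g 2"] exI[of _ "g ` {3..l + 2}"]) (simp add: image_Un)
  next
    assume "\<exists>x y W. x \<noteq> y \<and> x \<notin> W \<and> y \<notin> W \<and> card W = l \<and> fst H = {x, y} \<union> W \<and> snd H = biclique x y W"
    then obtain x y W where W: "x \<noteq> y" "x \<notin> W" "y \<notin> W" "card W = l" "fst H = {x, y} \<union> W"
      "snd H = biclique x y W" by blast
    have "finite W" using W(4) assms(2) card.infinite by fastforce
    moreover have "card {3..l + 2} = card W" using W(4) by simp
    ultimately obtain h where h: "bij_betw h {3..l + 2} W"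
      using finite_same_card_bij[OF finite_atLeastAtMost] by blast
    define g where "g = (\<lambda>i::nat. if i = 1 then x else if i = 2 then y else h i)"
    have gW: "g ` {3..l + 2} = W" using h by (auto simp: g_def bij_betw_def image_iff)
    have "inj_on g {3..l + 2}" using h by (auto simp: g_def bij_betw_def inj_on_def)
    moreover have "g 1 = x" "g 2 = y" by (simp_all add: g_def)
    ultimately have "inj_on g ({1, 2} \<union> {3..l + 2})"
      using gW W(1-3) by (simp add: inj_on_Un)
    moreover have "fst H = g ` ({1, 2} \<union> {3..l + 2})"
      unfolding image_Un gW W(5) by (auto simp: g_def)
    moreover have "snd H = (`) g ` snd (K2_graph l)"
      unfolding K2_graph_def image_biclique gW W(6) by (simp add: g_def)
    ultimately show "\<exists>g. inj_on g ({1, 2} \<union> {3..l + 2}) \<and> fst H = g ` ({1, 2} \<union> {3..l + 2}) \<and>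
      snd H = (`) g ` snd (K2_graph l)" by blast
  qed
qed

lemma graph_isomorphic_G_iff:
  assumes "snd H \<subseteq> Pow (fst H)" "l \<ge> 3"
  shows "graph_isomorphic H (G_graph l) \<longleftrightarrow>
    (\<exists>x y W. x \<noteq> y \<and> x \<notin> W \<and> y \<notin> W \<and> card W = l - 2 \<and> fst H = {x, y} \<union> W \<and>
       snd H = insert {x, y} (biclique x y W))"
proof -
  have K: "snd (G_graph l) \<subseteq> Pow (fst (G_graph l))"
    "fst (G_graph l) = {1, 2} \<union> {3..l}"
    "snd (G_graph l) = insert {1, 2} (snd (complete_bipartite {1, 2} {3..l}))"
    using assms(2) by (auto simp: G_graph_def complete_bipartite_def)
  show ?thesis unfolding graph_isomorphic_iff[OF assms(1) K(1)] K(2)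
  proof
    assume "\<exists>g. inj_on g ({1, 2} \<union> {3..l}) \<and> fst H = g ` ({1, 2} \<union> {3..l}) \<and>
      snd H = (`) g ` snd (G_graph l)"
    then obtain g where g: "inj_on g ({1, 2} \<union> {3..l})" "fst H = g ` ({1, 2} \<union> {3..l})"
      "snd H = (`) g ` snd (G_graph l)" by blast
    have d: "g 1 \<noteq> g 2" "g 1 \<notin> g ` {3..l}" "g 2 \<notin> g ` {3..l}"
      using g(1) by (auto simp: inj_on_def)
    have "card (g ` {3..l}) = l - 2" using g(1) by (subst card_image) (auto simp: inj_on_def)
    with d g(2,3) show "\<exists>x y W. x \<noteq> y \<and> x \<notin> W \<and> y \<notin> W \<and> card W = l - 2 \<and> fst H = {x, y} \<union> W \<and>
        snd H = insert {x, y} (biclique x y W)"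
      unfolding K(3) image_insert image_biclique
      by (intro exI[of _ "g 1"] exI[of _ "g 2"] exI[of _ "g ` {3..l}"]) (simp add: image_Un)
  next
    assume "\<exists>x y W. x \<noteq> y \<and> x \<notin> W \<and> y \<notin> W \<and> card W = l - 2 \<and> fst H = {x, y} \<union> W \<and>
        snd H = insert {x, y} (biclique x y W)"
    then obtain x y W where W: "x \<noteq> y" "x \<notin> W" "y \<notin> W" "card W = l - 2" "fst H = {x, y} \<union> W"
      "snd H = insert {x, y} (biclique x y W)" by blast
    have "finite W" using W(4) assms(2) card.infinite by fastforce
    moreover have "card {3..l} = card W" using W(4) assms(2) by simp
    ultimately obtain h where h: "bij_betw h {3..l} W"
      using finite_same_card_bij[OF finite_atLeastAtMost] by blast
    define g where "g = (\<lambda>i::nat. if i = 1 then x else if i = 2 then y else h i)"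
    have gW: "g ` {3..l} = W" using h by (auto simp: g_def bij_betw_def image_iff)
    have "inj_on g {3..l}" using h by (auto simp: g_def bij_betw_def inj_on_def)
    moreover have "g 1 = x" "g 2 = y" by (simp_all add: g_def)
    ultimately have "inj_on g ({1, 2} \<union> {3..l})"
      using gW W(1-3) by (simp add: inj_on_Un)
    moreover have "fst H = g ` ({1, 2} \<union> {3..l})"
      unfolding image_Un gW W(5) by (auto simp: g_def)
    moreover have "snd H = (`) g ` snd (G_graph l)"
      unfolding K(3) image_insert image_biclique gW W(6) by (simp add: g_def)
    ultimately show "\<exists>g. inj_on g ({1, 2} \<union> {3..l}) \<and> fst H = g ` ({1, 2} \<union> {3..l}) \<and>
      snd H = (`) g ` snd (G_graph l)" by blast
  qed
qed

lemma graph_isomorphic_K4_iff: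
  assumes "snd H \<subseteq> Pow (fst H)"
  shows "graph_isomorphic H K4_graph \<longleftrightarrow> card (fst H) = 4 \<and> snd H = pairs (fst H)"
proof -
  have K: "snd K4_graph \<subseteq> Pow (fst K4_graph)" "fst K4_graph = {1..4}" "snd K4_graph = pairs {1..4}"
    by (auto simp: K4_graph_def complete_graph_def pairs_def)
  show ?thesis unfolding graph_isomorphic_iff[OF assms K(1)] K(2)
  proof
    assume "\<exists>g. inj_on g {1..4} \<and> fst H = g ` {1..4} \<and> snd H = (`) g ` snd K4_graph"
    then obtain g where g: "inj_on g {1..4::nat}" "fst H = g ` {1..4}" "snd H = (`) g ` pairs {1..4}"
      unfolding K(3) by blast
    then show "card (fst H) = 4 \<and> snd H = pairs (fst H)"
      using image_pairs[OF g(1)] by (simp add: card_image)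
  next
    assume h: "card (fst H) = 4 \<and> snd H = pairs (fst H)"
    then have "finite (fst H)" using card.infinite by fastforce
    moreover have "card {1..4::nat} = card (fst H)" using h by simp
    ultimately obtain g where "bij_betw g {1..4::nat} (fst H)"
      using finite_same_card_bij[OF finite_atLeastAtMost] by blast
    then have g: "inj_on g {1..4}" "fst H = g ` {1..4}" by (auto simp: bij_betw_def)
    moreover have "snd H = (`) g ` snd K4_graph" unfolding K(3) image_pairs[OF g(1)] using h g(2) by simp
    ultimately show "\<exists>g. inj_on g {1..4} \<and> fst H = g ` {1..4} \<and> snd H = (`) g ` snd K4_graph" by blast
  qed
qed

text \<open>No vertex is isolated, so the edge set alone determines the graph;
  \<open>G_graph l\<close> corresponds to \<open>card W = l - 2\<close>.\<close>

lemma isomorphic_iff_exceptional: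
  assumes H: "snd H \<subseteq> Pow (fst H)" "fst H = \<Union>(snd H)"
  shows "graph_isomorphic H K4_graph \<or> (\<exists>l\<ge>3. graph_isomorphic H (G_graph l)) \<or>
    (\<exists>l\<ge>2. graph_isomorphic H (K2_graph l)) \<longleftrightarrow> exceptional (snd H)" (is "?L \<longleftrightarrow> ?R")
proof
  assume ?L
  then consider "graph_isomorphic H K4_graph" | l where "l \<ge> 3" "graph_isomorphic H (G_graph l)"
    | l where "l \<ge> 2" "graph_isomorphic H (K2_graph l)" by blast
  then show ?R
  proof cases
    case 1
    then have "card (fst H) = 4 \<and> snd H = pairs (fst H)" by (simp only: graph_isomorphic_K4_iff[OF H(1)])
    then show ?thesis unfolding exceptional_def by (intro disjI2 exI[of _ "fst H"])
  next
    case 2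
    then obtain x y W where "x \<noteq> y" "x \<notin> W" "y \<notin> W" "card W = l - 2" "snd H = insert {x, y} (biclique x y W)"
      unfolding graph_isomorphic_G_iff[OF H(1) 2(1)] by blast
    moreover have "l - 2 \<ge> 1" using 2 by simp
    ultimately show ?thesis unfolding exceptional_def by (metis (no_types))
  next
    case 3
    then have "l \<ge> 1" by simp
    from 3 show ?thesis unfolding graph_isomorphic_K2_iff[OF H(1) \<open>l \<ge> 1\<close>] exceptional_def by blast
  qed
next
  assume ?R
  then show ?L
  proof (cases rule: exceptional_cases)
    case (bic x y W)
    have "W \<noteq> {}" "card W \<ge> 1" using bic by auto
    have "graph_isomorphic H (K2_graph (card W))"
      unfolding graph_isomorphic_K2_iff[OF H(1) \<open>card W \<ge> 1\<close>]
      using bic H(2) Union_biclique[OF \<open>W \<noteq> {}\<close>]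
      by (intro exI[of _ x] exI[of _ y] exI[of _ W]) simp
    with bic(4) show ?thesis by blast
  next
    case (tri x y W)
    have "W \<noteq> {}" "card W + 2 \<ge> 3" using tri by auto
    have V: "fst H = {x, y} \<union> W" unfolding H(2) tri(5) using Union_biclique[OF \<open>W \<noteq> {}\<close>] by auto
    have "graph_isomorphic H (G_graph (card W + 2))"
      unfolding graph_isomorphic_G_iff[OF H(1) \<open>card W + 2 \<ge> 3\<close>]
      using tri V
      by (intro exI[of _ x] exI[of _ y] exI[of _ W]) simp
    with \<open>card W + 2 \<ge> 3\<close> show ?thesis by blast
  next
    case (K4 S)
    then show ?thesis using graph_isomorphic_K4_iff[OF H(1)] H(2) Union_pairs[of S] by simp
  qed
qed

text \<open>After deleting a vertex the rest has a spanning star or still contains a biclique with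
  nonempty \<open>W\<close>; these are the two helpers \<open>star\<close> and
  \<open>bicl\<close>.\<close>

lemma exceptional_two_connected:
  assumes "exceptional B"
  shows "two_connected (\<Union>B, B)" "card (\<Union>B) \<ge> 3" "simple_graph (\<Union>B, B :: 'n::finite set set)"
proof -
  have star: "connected_graph (insert r W, F)" if "\<And>w. w \<in> W \<Longrightarrow> {r, w} \<in> F" for r W and F :: "'n set set"
    by (rule connected_graphI[of r]) (use that in \<open>auto intro: r_into_rtrancl\<close>)
  have bicl: "connected_graph ({x, y} \<union> W, F)" if "W \<noteq> {}" "biclique x y W \<subseteq> F" for x y W and F :: "'n set set"
  proof (rule connected_graphI[of x])
    have e: "(x, w) \<in> joins F" "(w, y) \<in> joins F" if "w \<in> W" for w
      using that \<open>biclique x y W \<subseteq> F\<close> by (auto simp: biclique_iff subset_iff)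
    fix z assume "z \<in> {x, y} \<union> W"
    then consider "z = x" | "z = y" | "z \<in> W" by blast
    then show "(x, z) \<in> (joins F)\<^sup>*"
    proof cases
      case 2
      obtain w where "w \<in> W" using \<open>W \<noteq> {}\<close> by blast
      with e 2 show ?thesis by (meson r_into_rtrancl rtrancl_into_rtrancl)
    qed (use e in auto)
  qed simp
  from assms have "two_connected (\<Union>B, B) \<and> card (\<Union>B) \<ge> 3 \<and> simple_graph (\<Union>B, B)"
  proof (cases rule: exceptional_cases)
    case (bic x y W)
    have W: "W \<noteq> {}" using bic by auto
    have V: "\<Union>B = {x, y} \<union> W" using Union_biclique[OF W] bic by simp
    have c: "card (\<Union>B) = card W + 2" unfolding V using bic by (subst card_Un_disjoint) auto
    have "connected_graph (delete_vertex (\<Union>B, B) z)" if "z \<in> \<Union>B" for z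
    proof -
      consider "z = x" | "z = y" | "z \<in> W" using \<open>z \<in> \<Union>B\<close> V by blast
      then show ?thesis
      proof cases
        case 1
        then have "\<Union>B - {z} = insert y W" using V bic by auto
        moreover have "connected_graph (insert y W, {e \<in> B. z \<notin> e})"
          using 1 bic by (intro star) (auto simp: biclique_iff)
        ultimately show ?thesis by (simp add: delete_vertex_def)
      next
        case 2
        then have "\<Union>B - {z} = insert x W" using V bic by auto
        moreover have "connected_graph (insert x W, {e \<in> B. z \<notin> e})"
          using 2 bic by (intro star) (auto simp: biclique_iff)
        ultimately show ?thesis by (simp add: delete_vertex_def)
      next
        case 3
        then have "\<Union>B - {z} = {x, y} \<union> (W - {z})" using V bic by auto
        moreover have "card (W - {z}) \<noteq> 0" using 3 bic by simp
        then have "W - {z} \<noteq> {}" by (metis card.empty)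
        then have "connected_graph ({x, y} \<union> (W - {z}), {e \<in> B. z \<notin> e})"
          using 3 bic by (intro bicl) (auto simp: biclique_def)
        ultimately show ?thesis by (simp add: delete_vertex_def)
      qed
    qed
    moreover have "connected_graph (\<Union>B, B)" unfolding V using bicl[OF W] bic by simp
    moreover have "simple_graph (\<Union>B, B)"
      using biclique_simple[of x W y] bic by (auto simp: simple_graph_def)
    ultimately show ?thesis using c bic unfolding two_connected_def by simp
  next
    case (tri x y W)
    have W: "W \<noteq> {}" using tri by auto
    have V: "\<Union>B = {x, y} \<union> W" using Union_biclique[OF W] tri by auto
    have c: "card (\<Union>B) = card W + 2" unfolding V using tri by (subst card_Un_disjoint) auto
    have "connected_graph (delete_vertex (\<Union>B, B) z)" if "z \<in> \<Union>B" for z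
    proof -
      consider "z = x" | "z = y" | "z \<in> W" using \<open>z \<in> \<Union>B\<close> V by blast
      then show ?thesis
      proof cases
        case 1
        then have "\<Union>B - {z} = insert y W" using V tri by auto
        moreover have "connected_graph (insert y W, {e \<in> B. z \<notin> e})"
          using 1 tri by (intro star) (auto simp: biclique_iff)
        ultimately show ?thesis by (simp add: delete_vertex_def)
      next
        case 2
        then have "\<Union>B - {z} = insert x W" using V tri by auto
        moreover have "connected_graph (insert x W, {e \<in> B. z \<notin> e})"
          using 2 tri by (intro star) (auto simp: biclique_iff)
        ultimately show ?thesis by (simp add: delete_vertex_def)
      next
        case 3
        then have "\<Union>B - {z} = insert x (insert y (W - {z}))" using V tri by auto
        moreover have "connected_graph (insert x (insert y (W - {z})), {e \<in> B. z \<notin> e})"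
          using 3 tri by (intro star) (auto simp: biclique_iff)
        ultimately show ?thesis by (simp add: delete_vertex_def)
      qed
    qed
    moreover have "connected_graph (\<Union>B, B)" unfolding V using bicl[OF W, of x y B] tri by auto
    moreover have "simple_graph (\<Union>B, B)"
      using biclique_simple[of x W y] tri by (auto simp: simple_graph_def)
    ultimately show ?thesis using c tri unfolding two_connected_def by simp
  next
    case (K4 S)
    have V: "\<Union>B = S" using Union_pairs[OF K4(1)] K4(2) by simp
    have compl: "connected_graph (T, {e \<in> B. e \<subseteq> T})" if "T \<subseteq> S" "T \<noteq> {}" for T
    proof -
      from that obtain r where r: "r \<in> T" by blast
      have "connected_graph (insert r (T - {r}), {e \<in> B. e \<subseteq> T})"
        using r that K4(2) by (intro star) (auto simp: pairs_def)
      then show ?thesis using r by (simp add: insert_absorb)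
    qed
    have "connected_graph (delete_vertex (\<Union>B, B) z)" if "z \<in> \<Union>B" for z
    proof -
      have "card (S - {z}) = 3" using that K4(1) V by simp
      then have "S - {z} \<noteq> {}" by (metis card.empty zero_neq_numeral)
      then have "connected_graph (S - {z}, {e \<in> B. e \<subseteq> S - {z}})" by (intro compl) auto
      moreover have "{e \<in> B. e \<subseteq> S - {z}} = {e \<in> B. z \<notin> e}" using V by auto
      ultimately show ?thesis by (simp add: delete_vertex_def V)
    qed
    moreover have "S \<noteq> {}" using K4(1) by auto
    then have "connected_graph (S, {e \<in> B. e \<subseteq> S})" by (intro compl) auto
    moreover have "{e \<in> B. e \<subseteq> S} = B" using V by auto
    moreover have "simple_graph (\<Union>B, B)" using K4 by (auto simp: simple_graph_def pairs_def)
    ultimately show ?thesis using V K4(1) unfolding two_connected_def by simp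
  qed
  then show "two_connected (\<Union>B, B)" "card (\<Union>B) \<ge> 3" "simple_graph (\<Union>B, B)" by auto
qed

text \<open>The condition \<open>cyc B = cyc E\<close> says that every edge outside \<open>B\<close>
  is a bridge. An edge on a cycle outside the block \<open>B\<close> would belong to another block
  with at least three vertices. Conversely, if all non-bridges lie in \<open>B\<close>, then so does
  every 2-connected subgraph on at least three vertices.\<close>

lemma block_condition_iff:
  fixes E :: "'n::finite set set"
  assumes E: "simple_graph (UNIV, E)"
  shows "(\<exists>B \<in> two_connected_components (UNIV, E).
       (\<forall>C \<in> two_connected_components (UNIV, E) - {B}. single_edge C) \<and>
       (graph_isomorphic B K4_graph \<or> (\<exists>l\<ge>3. graph_isomorphic B (G_graph l)) \<or>
        (\<exists>l\<ge>2. graph_isomorphic B (K2_graph l)))) \<longleftrightarrow>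
    (\<exists>B\<subseteq>E. exceptional B \<and> cyc B = cyc E)" (is "?L \<longleftrightarrow> ?R")
proof
  have simple: "\<forall>e\<in>E. card e = 2" using E by (simp add: simple_graph_def)
  {
    assume ?L
    then obtain B where B: "B \<in> two_connected_components (UNIV, E)"
      "\<forall>C \<in> two_connected_components (UNIV, E) - {B}. single_edge C"
      "graph_isomorphic B K4_graph \<or> (\<exists>l\<ge>3. graph_isomorphic B (G_graph l)) \<or>
        (\<exists>l\<ge>2. graph_isomorphic B (K2_graph l))" by blast
    then have sB: "simple_graph B" "snd B \<subseteq> E" "two_connected B"
      by (auto simp: two_connected_components_def subgraph_def)
    have V: "fst B = \<Union>(snd B)" using two_connected_vertices[OF sB(3,1)] .
    then have "exceptional (snd B)" using isomorphic_iff_exceptional[of B] B(3) by auto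
    moreover have "cyc (snd B) = cyc E"
    proof (rule cyc_eq_if_bridges[OF simple sB(2)], rule notI)
      fix u v assume uv: "{u, v} \<in> E - snd B" "(u, v) \<in> (joins (E - {{u, v}}))\<^sup>*"
      have "u \<noteq> v" using simple uv(1) by force
      with uv(2) obtain p where p: "length p \<ge> 3" "hd p = u" "last p = v" "distinct p"
        "successively (\<lambda>a b. {a, b} \<in> E) p" by (rule nonbridge_imp_distinct_path)
      let ?H = "(set p, {e \<in> E. e \<subseteq> set p})"
      have "two_connected ?H" by (rule two_connected_cycle) (use p uv in auto)
      moreover have "subgraph ?H (UNIV, E)" using simple by (auto simp: subgraph_def simple_graph_def)
      ultimately obtain C where C: "C \<in> two_connected_components (UNIV, E)" "subgraph ?H C"
        using ex_two_connected_component by blast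
      have "p \<noteq> []" using p(1) by auto
      then have "{u, v} \<subseteq> set p" using p(2,3) by auto
      then have "{u, v} \<in> snd C" using C(2) uv(1) by (auto simp: subgraph_def)
      then have "C \<noteq> B" using uv(1) by blast
      then have "card (fst C) = 2" using B(2) C(1) single_edge_card by blast
      moreover have "card (set p) \<le> card (fst C)" using C(2) by (intro card_mono) (auto simp: subgraph_def)
      moreover have "card (set p) \<ge> 3" using p(1,4) by (simp add: distinct_card)
      ultimately show False by linarith
    qed
    ultimately show ?R using sB(2) by blast
  next
    assume ?R
    then obtain B where B: "B \<subseteq> E" "exceptional B" "cyc B = cyc E" by blast
    let ?B = "(\<Union>B, B)"
    note tc = exceptional_two_connected[OF B(2)]
    have nb: "{u, v} \<in> B" if uv: "{u, v} \<in> E" "(u, v) \<in> (joins (E - {{u, v}}))\<^sup>*" for u v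
    proof (rule ccontr)
      assume "{u, v} \<notin> B"
      then have "B \<subseteq> E - {{u, v}}" using B(1) by blast
      then have "cyc B \<le> cyc (E - {{u, v}})" using simple by (intro cyc_mono) auto
      with cyc_delete[OF uv(1)] uv(2) B(3) show False by simp
    qed
    have sub: "fst H \<subseteq> \<Union>B \<and> snd H \<subseteq> B" if H: "subgraph H (UNIV, E)" "two_connected H" "card (fst H) \<ge> 3" for H
    proof -
      have sH: "simple_graph H" "snd H \<subseteq> E" using H(1) by (auto simp: subgraph_def)
      have "e \<in> B" if e: "e \<in> snd H" for e
      proof -
        obtain u v where uv: "e = {u, v}" using e sH(2) simple by (metis card_2_iff subsetD)
        then have "(u, v) \<in> (joins (snd H - {{u, v}}))\<^sup>*"
          using two_connected_edge_nonbridge[OF H(2,3) sH(1), of u v] e by simp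
        moreover have "joins (snd H - {{u, v}}) \<subseteq> joins (E - {{u, v}})" using sH(2) by auto
        ultimately have "(u, v) \<in> (joins (E - {{u, v}}))\<^sup>*" using rtrancl_mono by blast
        then show ?thesis using nb uv e sH(2) by blast
      qed
      then have "snd H \<subseteq> B" by blast
      then show ?thesis using two_connected_vertices[OF H(2) sH(1)] by blast
    qed
    have sB: "subgraph ?B (UNIV, E)" using tc(3) B(1) by (simp add: subgraph_def)
    have max: "H = ?B" if H: "subgraph H (UNIV, E)" "two_connected H" "subgraph ?B H" for H
    proof -
      have s: "\<Union>B \<subseteq> fst H" "B \<subseteq> snd H" using H(3) by (auto simp: subgraph_def)
      then have "card (\<Union>B) \<le> card (fst H)" by (intro card_mono) auto
      then have "card (fst H) \<ge> 3" using tc(2) by linarith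
      with sub[OF H(1,2)] s show ?thesis by (auto simp: prod_eq_iff)
    qed
    have comp: "?B \<in> two_connected_components (UNIV, E)"
      unfolding two_connected_components_def using sB tc(1) max by blast
    moreover have "single_edge C" if C: "C \<in> two_connected_components (UNIV, E) - {?B}" for C
    proof (rule ccontr)
      assume "\<not> single_edge C"
      moreover have C': "subgraph C (UNIV, E)" "two_connected C"
        "\<forall>H'. subgraph H' (UNIV, E) \<and> two_connected H' \<and> subgraph C H' \<longrightarrow> H' = C"
        using C by (auto simp: two_connected_components_def)
      ultimately have "card (fst C) \<ge> 3" by (simp add: two_connected_def)
      with sub[OF C'(1,2)] C'(1) have "subgraph C ?B" by (simp add: subgraph_def)
      with C'(3) sB tc(1) have "?B = C" by blast
      with C show False by blast
    qed
    moreover have "graph_isomorphic ?B K4_graph \<or> (\<exists>l\<ge>3. graph_isomorphic ?B (G_graph l)) \<or>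
        (\<exists>l\<ge>2. graph_isomorphic ?B (K2_graph l))"
      using isomorphic_iff_exceptional[of ?B] B(2) by auto
    ultimately show ?L by blast
  }
qed

theorem corollary3p12:
  fixes E :: "'n::finite set set"
  assumes "simple_graph (UNIV, E)"
  shows "gamma (sym_edge_polytope E) 2 = 0 \<longleftrightarrow>
    forest (UNIV, E) \<or>
    (\<exists>B \<in> two_connected_components (UNIV, E).
       (\<forall>C \<in> two_connected_components (UNIV, E) - {B}. single_edge C) \<and>
       (graph_isomorphic B K4_graph \<or>
        (\<exists>l\<ge>3. graph_isomorphic B (G_graph l)) \<or>
        (\<exists>l\<ge>2. graph_isomorphic B (K2_graph l))))"
proof -
  have E: "\<forall>e\<in>E. card e = 2" using assms by (simp add: simple_graph_def)
  show ?thesis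
    unfolding block_condition_iff[OF assms] forest_iff_cyc[OF E] gamma_eq_gamma2[OF E]
    by (rule gamma2_eq_0_iff[OF E])
qed

end
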